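(* Let $\mathcal E$ be a Hilbert space. If $G:[B(\mathcal H)^n]_1\to B(\mathcal H)\bar\otimes_{min}B(\mathcal E)$ is a free holomorphic function with $\Re G>0$, then $$\Gamma(z)[I+G(z)^*][G(X)+G(z)^*]^{-1}[\Re G(X)][G(z)+G(X)^*]^{-1}[I+G(z)]\Gamma(z)\ \ge\ (1-\|z\|_2^2)\left((I-Xz^* )^{-1}(I-XX^* )(I-zX^* )^{-1}\right)\otimes I_{\mathcal E}$$ for any $z\in\mathbb B_n$ and $X\in[B(\mathcal H)^n]_1$, where $$\Gamma(z):=2\left\{[I+G(z)]^{-1}[\Re G(z)][I+G(z)^*]^{-1}\right\}^{1/2}.$$
   Context: $\mathcal H$ is a separable infinite dimensional Hilbert space and $n\in\{1,2,\dots\}\cup\{\infty\}$. A tuple $X=(X_1,\dots,X_n)\in B(\mathcal H)^n$ is identified with the row operator $[X_1\,\cdots\,X_n]$; $XX^*=\sum_iX_iX_i^*$, $\|X\|=\|XX^*\|^{1/2}$, $[B(\mathcal H)^n]_1=\{X:\|X\|<1\}$. $\mathbb B_n$ is the open Euclidean unit ball of $\mathbb C^n$; for $z\in\mathbb B_n$, viewed as the row $[z_1I,\dots,z_nI]$, $Xz^*=\sum_i\bar z_iX_i$ and $zX^*=\sum_iz_iX_i^*$. $\mathbb F_n^+$ is the unital free semigroup on $g_1,\dots,g_n$; for $\alpha=g_{i_1}\cdots g_{i_k}$ put $|\alpha|=k$, $X_\alpha=X_{i_1}\cdots X_{i_k}$ ($X_\alpha=I$ for the neutral element, of length $0$). A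 free holomorphic function on $[B(\mathcal H)^n]_1$ with coefficients in $B(\mathcal E)$ is a map $G(X)=\sum_{k=0}^\infty\sum_{|\alpha|=k}X_\alpha\otimes A_{(\alpha)}$ with $A_{(\alpha)}\in B(\mathcal E)$, the series in $k$ converging in operator norm for all $X\in[B(\mathcal H)^n]_1$ ($\bar\otimes_{min}$ is the spatial tensor product). For $z\in\mathbb B_n$, $G(z)=\sum_\alpha z_\alpha A_{(\alpha)}\in B(\mathcal E)$ is identified with $I_{\mathcal H}\otimes G(z)$. $\Re T=\frac12(T+T^* )$; $\Re G>0$ means that $\Re G(X)$ is positive and invertible for every $X\in[B(\mathcal H)^n]_1$. *)

theory Defs
  imports "HOL-Analysis.Analysis"
begin

section \<open>Complex Hilbert spaces\<close>

text \<open>The inner product is linear in its first argument. The axiom \<open>cinner_self\<close> ties the norm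
  to the inner product and gives positive definiteness.\<close>

class chilbert = banach +
  fixes scaleC :: "complex \<Rightarrow> 'a \<Rightarrow> 'a"  (infixr "*\<^sub>C" 75)
    and cinner :: "'a \<Rightarrow> 'a \<Rightarrow> complex"
  assumes scaleC_add_right: "a *\<^sub>C (x + y) = a *\<^sub>C x + a *\<^sub>C y"
    and scaleC_add_left: "(a + b) *\<^sub>C x = a *\<^sub>C x + b *\<^sub>C x"
    and scaleC_scaleC: "a *\<^sub>C (b *\<^sub>C x) = (a * b) *\<^sub>C x"
    and scaleC_of_real: "complex_of_real r *\<^sub>C x = scaleR r x"
    and cinner_commute: "cinner y x = cnj (cinner x y)"
    and cinner_add_left: "cinner (x + y) w = cinner x w + cinner y w"
    and cinner_scaleC_left: "cinner (a *\<^sub>C x) y = a * cinner x y"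
    and cinner_self: "cinner x x = complex_of_real ((norm x)\<^sup>2)"

lemma scaleC_one: "1 *\<^sub>C (x :: 'a :: chilbert) = x"
  using scaleC_of_real[of 1 x] by simp

global_interpretation chilbert: vector_space "scaleC :: complex \<Rightarrow> 'a :: chilbert \<Rightarrow> 'a"
  defines cspan = chilbert.span
  by standard (simp_all add: scaleC_add_right scaleC_add_left scaleC_scaleC scaleC_one)

lemma norm_scaleC: "norm (a *\<^sub>C (x :: 'a :: chilbert)) = cmod a * norm x"
proof -
  have "cinner (a *\<^sub>C x) (a *\<^sub>C x) = a * cnj (a * cinner x x)"
    by (metis cinner_commute cinner_scaleC_left)
  also have "\<dots> = complex_of_real ((cmod a)\<^sup>2) * complex_of_real ((norm x)\<^sup>2)"
    by (simp add: cinner_self mult.assoc[symmetric] flip: complex_norm_square)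
  finally have "complex_of_real ((norm (a *\<^sub>C x))\<^sup>2) = complex_of_real ((cmod a * norm x)\<^sup>2)"
    by (simp add: cinner_self power_mult_distrib)
  then have "(norm (a *\<^sub>C x))\<^sup>2 = (cmod a * norm x)\<^sup>2"
    using of_real_eq_iff by blast
  then show ?thesis by (simp add: power2_eq_iff_nonneg)
qed

lemma bounded_linear_scaleC: "bounded_linear (\<lambda>x :: 'a :: chilbert. a *\<^sub>C x)"
proof (rule bounded_linear_intro[where K = "cmod a"])
  fix r and x :: 'a
  show "a *\<^sub>C (r *\<^sub>R x) = r *\<^sub>R (a *\<^sub>C x)"
    by (metis scaleC_scaleC scaleC_of_real mult.commute)
qed (simp_all add: scaleC_add_right norm_scaleC mult.commute)

section \<open>Bounded operators\<close>

text \<open>The elements of the type \<open>'a \<Rightarrow>\<^sub>L 'b\<close> are only real-linear; \<open>cbounded\<close> is the set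
  of complex-linear ones, so that \<open>B(H)\<close> is \<open>cbounded :: ('h \<Rightarrow>\<^sub>L 'h) set\<close>.\<close>

definition cbounded :: "('a::chilbert \<Rightarrow>\<^sub>L 'b::chilbert) set" where
  "cbounded = {T. \<forall>c x. blinfun_apply T (c *\<^sub>C x) = c *\<^sub>C blinfun_apply T x}"

lift_definition scaleC_op :: "complex \<Rightarrow> ('a::chilbert \<Rightarrow>\<^sub>L 'b::chilbert) \<Rightarrow> ('a \<Rightarrow>\<^sub>L 'b)"
  is "\<lambda>c T x. c *\<^sub>C T x"
  by (rule bounded_linear_compose[OF bounded_linear_scaleC])

definition adj :: "('a::chilbert \<Rightarrow>\<^sub>L 'b::chilbert) \<Rightarrow> ('b \<Rightarrow>\<^sub>L 'a)" where
  "adj T = (THE S. \<forall>x y. cinner (blinfun_apply T x) y = cinner x (blinfun_apply S y))"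

definition op_invertible :: "('a::chilbert \<Rightarrow>\<^sub>L 'a) \<Rightarrow> bool" where
  "op_invertible T \<longleftrightarrow> (\<exists>S. S o\<^sub>L T = id_blinfun \<and> T o\<^sub>L S = id_blinfun)"

definition op_inv :: "('a::chilbert \<Rightarrow>\<^sub>L 'a) \<Rightarrow> ('a \<Rightarrow>\<^sub>L 'a)" where
  "op_inv T = (THE S. S o\<^sub>L T = id_blinfun \<and> T o\<^sub>L S = id_blinfun)"

definition op_pos :: "('a::chilbert \<Rightarrow>\<^sub>L 'a) \<Rightarrow> bool" where
  "op_pos T \<longleftrightarrow> T \<in> cbounded \<and> (\<forall>x. cinner (blinfun_apply T x) x \<in> \<real>\<^sub>\<ge>\<^sub>0)"

definition op_le :: "('a::chilbert \<Rightarrow>\<^sub>L 'a) \<Rightarrow> ('a \<Rightarrow>\<^sub>L 'a) \<Rightarrow> bool" where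
  "op_le S T \<longleftrightarrow> op_pos (T - S)"

definition op_sqrt :: "('a::chilbert \<Rightarrow>\<^sub>L 'a) \<Rightarrow> ('a \<Rightarrow>\<^sub>L 'a)" where
  "op_sqrt T = (THE S. op_pos S \<and> S o\<^sub>L S = T)"

definition op_Re :: "('a::chilbert \<Rightarrow>\<^sub>L 'a) \<Rightarrow> ('a \<Rightarrow>\<^sub>L 'a)" where
  "op_Re T = (1 / 2) *\<^sub>R (T + adj T)"

text \<open>Unordered sums in the strong operator topology. The index sets below are infinite when
  \<open>n = \<infinity>\<close>, and the series for \<open>X X\<^sup>*\<close> and for the homogeneous parts of a
  free holomorphic function then converge only strongly; for finite \<open>n\<close> these are finite sums.\<close>

definition has_sot_sum ::
  "('i \<Rightarrow> ('a::chilbert \<Rightarrow>\<^sub>L 'b::chilbert)) \<Rightarrow> ('a \<Rightarrow>\<^sub>L 'b) \<Rightarrow> 'i set \<Rightarrow> bool" where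
  "has_sot_sum f T I \<longleftrightarrow> (\<forall>x. ((\<lambda>i. blinfun_apply (f i) x) has_sum blinfun_apply T x) I)"

definition sot_summable :: "('i \<Rightarrow> ('a::chilbert \<Rightarrow>\<^sub>L 'b::chilbert)) \<Rightarrow> 'i set \<Rightarrow> bool" where
  "sot_summable f I \<longleftrightarrow> (\<exists>T. has_sot_sum f T I)"

definition sot_sum :: "('i \<Rightarrow> ('a::chilbert \<Rightarrow>\<^sub>L 'b::chilbert)) \<Rightarrow> 'i set \<Rightarrow> ('a \<Rightarrow>\<^sub>L 'b)" where
  "sot_sum f I = (THE T. has_sot_sum f T I)"

section \<open>Hilbert space tensor products\<close>

text \<open>\<open>hilbert_tensor t\<close> says that the Hilbert space \<open>'k\<close>, with \<open>t x y\<close> as the elementary tensor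
  \<open>x \<otimes> y\<close>, is the Hilbert space tensor product of \<open>'h\<close> and \<open>'e\<close>; this determines \<open>('k, t)\<close> up to
  a unique unitary.\<close>

definition hilbert_tensor :: "('h::chilbert \<Rightarrow> 'e::chilbert \<Rightarrow> 'k::chilbert) \<Rightarrow> bool" where
  "hilbert_tensor t \<longleftrightarrow>
     (\<forall>x x' y. t (x + x') y = t x y + t x' y) \<and>
     (\<forall>x y y'. t x (y + y') = t x y + t x y') \<and>
     (\<forall>c x y. t (c *\<^sub>C x) y = c *\<^sub>C t x y) \<and>
     (\<forall>c x y. t x (c *\<^sub>C y) = c *\<^sub>C t x y) \<and>
     (\<forall>x x' y y'. cinner (t x y) (t x' y') = cinner x x' * cinner y y') \<and>
     closure (cspan {t x y | x y. True}) = UNIV"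

definition op_tensor ::
  "('h::chilbert \<Rightarrow> 'e::chilbert \<Rightarrow> 'k::chilbert) \<Rightarrow> ('h \<Rightarrow>\<^sub>L 'h) \<Rightarrow> ('e \<Rightarrow>\<^sub>L 'e) \<Rightarrow> ('k \<Rightarrow>\<^sub>L 'k)" where
  "op_tensor t S T = (THE U. U \<in> cbounded \<and>
     (\<forall>x y. blinfun_apply U (t x y) = t (blinfun_apply S x) (blinfun_apply T y)))"

text \<open>The spatial tensor product of \<open>B(H)\<close> and \<open>B(E)\<close>. The real span is the complex span here,
  because complex scalars can be absorbed into \<open>S\<close>.\<close>

definition min_tensor :: "('h::chilbert \<Rightarrow> 'e::chilbert \<Rightarrow> 'k::chilbert) \<Rightarrow> ('k \<Rightarrow>\<^sub>L 'k) set" where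
  "min_tensor t = closure (span {op_tensor t S T | S T. S \<in> cbounded \<and> T \<in> cbounded})"

section \<open>The noncommutative ball and the Euclidean ball\<close>

text \<open>The generators are indexed by a countable type \<open>'n\<close>: it has \<open>n\<close> elements if \<open>n\<close> is finite and
  is countably infinite if \<open>n = \<infinity>\<close>. Words of the free semigroup are lists over \<open>'n\<close>.\<close>

definition row_gram :: "('n::countable \<Rightarrow> ('h::chilbert \<Rightarrow>\<^sub>L 'h)) \<Rightarrow> ('h \<Rightarrow>\<^sub>L 'h)" where
  "row_gram X = sot_sum (\<lambda>i. X i o\<^sub>L adj (X i)) UNIV"

definition row_ball :: "('n::countable \<Rightarrow> ('h::chilbert \<Rightarrow>\<^sub>L 'h)) set" where
  "row_ball = {X. (\<forall>i. X i \<in> cbounded) \<and> sot_summable (\<lambda>i. X i o\<^sub>L adj (X i)) UNIV \<and>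
                  sqrt (norm (row_gram X)) < 1}"

definition word_op :: "('n::countable \<Rightarrow> ('h::chilbert \<Rightarrow>\<^sub>L 'h)) \<Rightarrow> 'n list \<Rightarrow> ('h \<Rightarrow>\<^sub>L 'h)" where
  "word_op X \<alpha> = foldr (\<lambda>i T. X i o\<^sub>L T) \<alpha> id_blinfun"

definition norm2 :: "('n::countable \<Rightarrow> complex) \<Rightarrow> real" where
  "norm2 z = sqrt (\<Sum>\<^sub>\<infinity>i. (cmod (z i))\<^sup>2)"

definition euclid_ball :: "('n::countable \<Rightarrow> complex) set" where
  "euclid_ball = {z. (\<lambda>i. (cmod (z i))\<^sup>2) summable_on UNIV \<and> norm2 z < 1}"

text \<open>\<open>X z\<^sup>*\<close> and \<open>z X\<^sup>*\<close>; by Cauchy-Schwarz these series converge in operator norm.\<close>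

definition row_times_adj :: "('n::countable \<Rightarrow> ('h::chilbert \<Rightarrow>\<^sub>L 'h)) \<Rightarrow> ('n \<Rightarrow> complex) \<Rightarrow> ('h \<Rightarrow>\<^sub>L 'h)" where
  "row_times_adj X z = (\<Sum>\<^sub>\<infinity>i. scaleC_op (cnj (z i)) (X i))"

definition scalar_times_adj :: "('n::countable \<Rightarrow> complex) \<Rightarrow> ('n \<Rightarrow> ('h::chilbert \<Rightarrow>\<^sub>L 'h)) \<Rightarrow> ('h \<Rightarrow>\<^sub>L 'h)" where
  "scalar_times_adj z X = (\<Sum>\<^sub>\<infinity>i. scaleC_op (z i) (adj (X i)))"

section \<open>Free holomorphic functions\<close>

text \<open>\<open>G\<close> is the free holomorphic function on the ball with coefficients \<open>A\<close>; its values outside the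
  ball are irrelevant. The outer series \<open>sums\<close> converges in operator norm.\<close>

definition free_holomorphic ::
  "('h::chilbert \<Rightarrow> 'e::chilbert \<Rightarrow> 'k::chilbert) \<Rightarrow> ('n::countable list \<Rightarrow> ('e \<Rightarrow>\<^sub>L 'e)) \<Rightarrow>
   (('n \<Rightarrow> ('h \<Rightarrow>\<^sub>L 'h)) \<Rightarrow> ('k \<Rightarrow>\<^sub>L 'k)) \<Rightarrow> bool" where
  "free_holomorphic t A G \<longleftrightarrow>
     (\<forall>\<alpha>. A \<alpha> \<in> cbounded) \<and>
     (\<forall>X \<in> row_ball. G X \<in> min_tensor t \<and>
        (\<forall>k. sot_summable (\<lambda>\<alpha>. op_tensor t (word_op X \<alpha>) (A \<alpha>)) {\<alpha>. length \<alpha> = k}) \<and>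
        (\<lambda>k. sot_sum (\<lambda>\<alpha>. op_tensor t (word_op X \<alpha>) (A \<alpha>)) {\<alpha>. length \<alpha> = k}) sums G X)"

text \<open>The value \<open>G(z)\<close> in \<open>B(E)\<close> at a scalar point.\<close>

definition scalar_value ::
  "('n::countable list \<Rightarrow> ('e::chilbert \<Rightarrow>\<^sub>L 'e)) \<Rightarrow> ('n \<Rightarrow> complex) \<Rightarrow> ('e \<Rightarrow>\<^sub>L 'e)" where
  "scalar_value A z =
     (\<Sum>k. sot_sum (\<lambda>\<alpha>. scaleC_op (prod_list (map z \<alpha>)) (A \<alpha>)) {\<alpha>. length \<alpha> = k})"

definition Gamma_op :: "('a::chilbert \<Rightarrow>\<^sub>L 'a) \<Rightarrow> ('a \<Rightarrow>\<^sub>L 'a)" where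
  "Gamma_op W = 2 *\<^sub>R op_sqrt
     (op_inv (id_blinfun + W) o\<^sub>L op_Re W o\<^sub>L op_inv (id_blinfun + adj W))"

end

theory Submission
  imports Defs
begin

text \<open>
  Write \<open>T = G(X)\<close>, \<open>W = I \<otimes> G(z)\<close>, \<open>D = I - X X\<^sup>*\<close>, \<open>B = (I - X z\<^sup>*)\<^sup>-\<^sup>1\<close>, \<open>R = B D\<close> and
  \<open>c = 1 / (1 - norm2 z ^ 2)\<close>, and let operators on \<open>H\<close> act on the tensor product through the first
  factor. The theorem is a Schur complement of the positivity of a two-point kernel:
  for all vectors \<open>a\<close> and \<open>b\<close> of the tensor product,
  \<open>0 \<le> Re \<langle>T (a + R b), a\<rangle> + Re \<langle>W (R\<^sup>* a + c D b), b\<rangle>\<close>  (lemma \<open>two_point_form\<close>).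

  This inequality comes from the hypothesis at a single third point \<open>Y\<close> of the row ball. As \<open>H\<close> is
  infinite dimensional, it contains two orthogonal copies of itself, so the row
  \<open>Z = X \<oplus> z I\<close> acts on \<open>H\<close>. The block operator \<open>Q = (I, R; R\<^sup>*, c D)\<close> solves the Stein equation
  \<open>Q - \<Sum> Z\<^sub>i Q Z\<^sub>i\<^sup>* = P\<close> with \<open>P = (D, D; D, D) \<ge> 0\<close>, hence \<open>Q \<ge> 0\<close> (lemma \<open>stein_nonneg\<close>),
  and for \<open>e > 0\<close> the row \<open>Y\<^sub>i = C\<^sup>-\<^sup>1 Z\<^sub>i C\<close> with \<open>C\<^sup>2 = Q + e I\<close> is a strict contraction
  (lemma \<open>two_point_row\<close>). A free holomorphic function respects intertwiners (lemma
  \<open>free_holomorphic_intertwine\<close>), so \<open>G(Y) = C\<^sup>-\<^sup>1 (G(X) \<oplus> G(z)) C\<close> on these two copies, and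
  \<open>Re G(Y) \<ge> 0\<close> says \<open>(T \<oplus> W) (Q + e I) + (Q + e I) (T \<oplus> W)\<^sup>* \<ge> 0\<close>. Letting \<open>e\<close> tend to \<open>0\<close>
  gives the kernel inequality. Going through \<open>Y\<close> replaces the usual dilation of \<open>X\<close> to the
  creation operators of the full Fock space.

  For the theorem, the kernel inequality is evaluated at \<open>a = (W + T\<^sup>*)\<^sup>-\<^sup>1 (I + W) \<Gamma> v\<close> and at
  a vector \<open>b\<close> that minimises its right-hand side. The result simplifies because \<open>\<Gamma>\<close> is normalised
  by \<open>\<Gamma> (I + W\<^sup>*) (Re W)\<^sup>-\<^sup>1 (I + W) \<Gamma> = 4\<close> (lemma \<open>Gamma_op_props\<close>) and because \<open>W\<close>, and with it
  \<open>\<Gamma>\<close>, commutes with the operators on the first factor.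

  The operators \<open>adj\<close>, \<open>op_inv\<close>, \<open>op_sqrt\<close>, \<open>op_tensor\<close> and the strong sums are definite
  descriptions, so each one needs an existence proof: adjoints by Riesz representation, inverses
  and square roots by the contraction principle for operators with coercive quadratic form, tensor
  products of operators by a Hilbert basis of one of the factors.
\<close>

section \<open>Complex inner products\<close>

lemma cinner_add_right: "cinner x (y + w) = cinner x y + cinner x (w :: 'a::chilbert)"
  by (metis cinner_commute cinner_add_left complex_cnj_add)

lemma cinner_scaleC_right: "cinner x (a *\<^sub>C y) = cnj a * cinner x (y :: 'a::chilbert)"
  by (metis cinner_commute cinner_scaleC_left complex_cnj_mult)

lemma cinner_scaleR_left: "cinner (r *\<^sub>R x) y = r *\<^sub>R cinner x (y :: 'a::chilbert)"
  by (metis cinner_scaleC_left scaleC_of_real scaleR_conv_of_real)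

lemma cinner_scaleR_right: "cinner x (r *\<^sub>R y) = r *\<^sub>R cinner x (y :: 'a::chilbert)"
  by (metis cinner_scaleC_right complex_cnj_complex_of_real scaleC_of_real scaleR_conv_of_real)

lemma cinner_zero_left [simp]: "cinner 0 (y :: 'a::chilbert) = 0"
  using cinner_add_left[of 0 0 y] by simp

lemma scaleC_scaleR: "a *\<^sub>C (r *\<^sub>R x) = r *\<^sub>R (a *\<^sub>C (x :: 'a::chilbert))"
  by (metis scaleC_scaleC scaleC_of_real mult.commute)

lemma norm_sq_eq_cinner: "(norm (x :: 'a::chilbert))\<^sup>2 = Re (cinner x x)"
  by (simp add: cinner_self)

lemma Re_cinner_commute: "Re (cinner x y) = Re (cinner y (x :: 'a::chilbert))"
  by (subst cinner_commute) simp

lemma norm_sq_add: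
  "(norm (x + y))\<^sup>2 = (norm x)\<^sup>2 + 2 * Re (cinner x y) + (norm (y :: 'a::chilbert))\<^sup>2"
  using Re_cinner_commute[of y x]
  by (simp add: norm_sq_eq_cinner cinner_add_left cinner_add_right)

text \<open>Expand the square of \<open>norm (\<beta> x - \<alpha> y)\<close> with \<open>\<alpha> = norm x\<close> and \<open>\<beta> = norm y\<close>.\<close>

lemma Re_cinner_le: "Re (cinner x y) \<le> norm x * norm (y :: 'a::chilbert)"
proof (cases "x = 0 \<or> y = 0")
  case True
  then show ?thesis using Re_cinner_commute[of x y] by auto
next
  case False
  then have pos: "norm x * norm y > 0" by simp
  have neg: "cinner u (- v) = - cinner u v" for u v :: 'a
    using cinner_scaleR_right[of u "-1" v] by simp
  have "0 \<le> (norm (norm y *\<^sub>R x + (- norm x) *\<^sub>R y))\<^sup>2" by simp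
  also have "\<dots> = 2 * (norm x * norm y) * (norm x * norm y - Re (cinner x y))"
    unfolding norm_sq_add
    by (simp add: neg cinner_scaleR_left cinner_scaleR_right power_mult_distrib power2_eq_square
        algebra_simps)
  finally show ?thesis using pos by (simp add: zero_le_mult_iff)
qed

text \<open>Rotating \<open>x\<close> turns the inner product into its own modulus, to which the bound on real parts
  applies.\<close>

lemma norm_cinner_le: "cmod (cinner x y) \<le> norm x * norm (y :: 'a::chilbert)"
proof (cases "cinner x y = 0")
  case False
  define u where "u = cnj (cinner x y) / cmod (cinner x y)"
  have "cmod u = 1" using False by (simp add: u_def norm_divide)
  have "cinner (u *\<^sub>C x) y = cmod (cinner x y)"
    using False
    by (simp add: u_def cinner_scaleC_left field_simps complex_norm_square[symmetric] power2_eq_square)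
  then show ?thesis
    using Re_cinner_le[of "u *\<^sub>C x" y] \<open>cmod u = 1\<close> by (simp add: norm_scaleC)
qed simp

lemma bounded_bilinear_cinner: "bounded_bilinear (cinner :: 'a::chilbert \<Rightarrow> 'a \<Rightarrow> complex)"
  by standard (auto simp: cinner_add_left cinner_add_right cinner_scaleR_left cinner_scaleR_right
      intro!: exI[of _ 1] norm_cinner_le)

global_interpretation cinner: bounded_bilinear "cinner :: 'a::chilbert \<Rightarrow> 'a \<Rightarrow> complex"
  by (rule bounded_bilinear_cinner)

lemma cinner_ext_right: "(\<And>x. cinner x y = cinner x z) \<Longrightarrow> y = (z :: 'a::chilbert)"
  using cinner.diff_right[of "y - z" y z] by (simp add: cinner_self)

lemma cinner_ext_left: "(\<And>x. cinner y x = cinner z x) \<Longrightarrow> y = (z :: 'a::chilbert)"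
  using cinner.diff_left[of y z "y - z"] by (simp add: cinner_self)

lemma parallelogram:
  "(norm (x - y))\<^sup>2 = 2 * (norm x)\<^sup>2 + 2 * (norm y)\<^sup>2 - (norm (x + y :: 'a::chilbert))\<^sup>2"
  using norm_sq_add[of x y] norm_sq_add[of x "- y"] by (simp add: cinner.minus_right)

section \<open>Riesz representation and adjoints\<close>

text \<open>The representing vector minimises \<open>norm x ^ 2 - 2 * Re (f x)\<close>. A minimising sequence is Cauchy
  by the parallelogram law, and comparing its limit \<open>y\<close> with \<open>y + r x\<close> for small real \<open>r\<close> gives
  \<open>Re (f x) = Re (cinner x y)\<close>; the imaginary part follows by applying this to \<open>\<i> x\<close>.\<close>

lemma riesz_representation:
  fixes f :: "'a::chilbert \<Rightarrow> complex"
  assumes bl: "bounded_linear f" and lin: "\<And>c x. f (c *\<^sub>C x) = c * f x"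
  shows "\<exists>y. \<forall>x. f x = cinner x y"
proof -
  interpret bounded_linear f by (rule bl)
  obtain K where K: "\<And>x. norm (f x) \<le> norm x * K" "0 < K" using pos_bounded by blast
  define J where "J x = (norm x)\<^sup>2 - 2 * Re (f x)" for x
  have low: "- K\<^sup>2 \<le> J x" for x
  proof -
    have "0 \<le> (norm x - K)\<^sup>2" by simp
    moreover have "Re (f x) \<le> norm x * K" using K(1)[of x] complex_Re_le_cmod order_trans by blast
    ultimately show ?thesis by (simp add: J_def power2_eq_square algebra_simps)
  qed
  define m where "m = (INF x. J x)"
  have bdd: "bdd_below (range J)" using low by (intro bdd_belowI[of _ "- K\<^sup>2"]) auto
  have m_le: "m \<le> J x" for x unfolding m_def by (rule cINF_lower[OF bdd]) simp
  have "\<exists>x. J x < m + 1 / real (Suc n)" for n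
  proof -
    have "m < m + 1 / real (Suc n)" by simp
    then show ?thesis unfolding m_def using bdd by (subst (asm) cINF_less_iff) auto
  qed
  then obtain s where s: "\<And>n. J (s n) < m + 1 / real (Suc n)" by metis
  have gap: "(norm (x - y))\<^sup>2 \<le> 2 * (J x - m) + 2 * (J y - m)" for x y
  proof -
    have "J ((1/2) *\<^sub>R v) = (norm v)\<^sup>2 / 4 - Re (f v)" for v
      by (simp add: J_def scaleR power_divide)
    moreover define mid where "mid = (1/2) *\<^sub>R (x + y)"
    ultimately have "4 * J mid = (norm (x + y))\<^sup>2 - 4 * (Re (f x) + Re (f y))"
      by (simp add: add)
    then show ?thesis using m_le[of mid] parallelogram[of x y]
      unfolding J_def[of x] J_def[of y] by (simp add: algebra_simps)
  qed
  have "Cauchy s"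
  proof (rule metric_CauchyI)
    fix e :: real assume e: "0 < e"
    then obtain N where N: "1 / real (Suc N) < e\<^sup>2 / 4"
      by (metis nat_approx_posE zero_less_power zero_less_divide_iff zero_less_numeral)
    have "dist (s i) (s j) < e" if "i \<ge> N" "j \<ge> N" for i j
    proof -
      have "1 / real (Suc k) \<le> 1 / real (Suc N)" if "k \<ge> N" for k
        using that by (simp add: frac_le)
      then have "J (s i) - m < e\<^sup>2 / 4" "J (s j) - m < e\<^sup>2 / 4"
        using s[of i] s[of j] N that by (smt (verit))+
      then have "(norm (s i - s j))\<^sup>2 < e\<^sup>2" using gap[of "s i" "s j"] by argo
      then show ?thesis using e by (simp add: dist_norm power_less_imp_less_base)
    qed
    then show "\<exists>N. \<forall>i\<ge>N. \<forall>j\<ge>N. dist (s i) (s j) < e" by blast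
  qed
  then obtain y where y: "s \<longlonglongrightarrow> y" using Cauchy_convergent_iff convergent_def by blast
  have "(\<lambda>n. J (s n)) \<longlonglongrightarrow> J y"
    unfolding J_def by (intro tendsto_intros y tendsto[OF y])
  moreover have "(\<lambda>n. m + 1 / real (Suc n)) \<longlonglongrightarrow> m + 0"
    by (intro tendsto_intros LIMSEQ_Suc[OF lim_inverse_n'])
  ultimately have "J y \<le> m + 0"
    by (rule LIMSEQ_le) (use s less_imp_le in blast)
  then have min: "J y \<le> J x" for x using m_le[of x] by linarith
  have Re_eq: "Re (f x) = Re (cinner x y)" for x
  proof -
    define d where "d = Re (cinner x y) - Re (f x)"
    have ineq: "0 \<le> 2 * r * d + r\<^sup>2 * (norm x)\<^sup>2" for r
    proof -
      have "J (y + r *\<^sub>R x) = J y + 2 * r * d + r\<^sup>2 * (norm x)\<^sup>2"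
        using Re_cinner_commute[of x y] unfolding J_def d_def norm_sq_add
        by (simp add: add scaleR cinner_scaleR_right power_mult_distrib algebra_simps)
      then show ?thesis using min[of "y + r *\<^sub>R x"] by linarith
    qed
    \<comment> \<open>The quadratic is nonnegative and vanishes at \<open>r = 0\<close>, so its linear term vanishes.\<close>
    have "0 \<le> - (d\<^sup>2) / (1 + (norm x)\<^sup>2)"
    proof -
      define q where "q = 1 + (norm x)\<^sup>2"
      have q: "q > 0" by (simp add: q_def add_pos_nonneg)
      have "0 \<le> 2 * (- d / q) * d + (- d / q)\<^sup>2 * (norm x)\<^sup>2" by (rule ineq)
      also have "\<dots> \<le> 2 * (- d / q) * d + (- d / q)\<^sup>2 * q"
        by (intro add_left_mono mult_left_mono) (simp_all add: q_def)
      also have "\<dots> = - (d\<^sup>2) / q" using q by (simp add: power2_eq_square field_simps)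
      finally show ?thesis by (simp add: q_def)
    qed
    then have "d = 0"
      by (smt (verit) divide_nonneg_pos zero_le_power2 divide_minus_left divide_eq_0_iff
          power2_eq_iff_nonneg sum_power2_eq_zero_iff zero_eq_power2)
    then show ?thesis by (simp add: d_def)
  qed
  have "f x = cinner x y" for x
    using Re_eq[of x] Re_eq[of "\<i> *\<^sub>C x"]
    by (intro complex_eqI) (simp_all add: lin cinner_scaleC_left)
  then show ?thesis by blast
qed

lemma cboundedD: "T \<in> cbounded \<Longrightarrow> blinfun_apply T (c *\<^sub>C x) = c *\<^sub>C blinfun_apply T x"
  by (simp add: cbounded_def)

lemma cboundedI: "(\<And>c x. blinfun_apply T (c *\<^sub>C x) = c *\<^sub>C blinfun_apply T x) \<Longrightarrow> T \<in> cbounded"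
  by (simp add: cbounded_def)

lemma adj_unique:
  assumes "\<And>x y. cinner (blinfun_apply T x) y = cinner x (blinfun_apply S y)"
  shows "adj T = S"
  unfolding adj_def
proof (rule the_equality)
  fix R assume "\<forall>x y. cinner (blinfun_apply T x) y = cinner x (blinfun_apply R y)"
  then show "R = S" using assms by (intro blinfun_eqI cinner_ext_right) metis
qed (use assms in blast)

lemma adj_exists:
  fixes T :: "'a::chilbert \<Rightarrow>\<^sub>L 'b::chilbert"
  assumes T: "T \<in> cbounded"
  shows "\<exists>S. \<forall>x y. cinner (blinfun_apply T x) y = cinner x (blinfun_apply S y)"
proof -
  have "\<exists>w. \<forall>x. cinner (T x) y = cinner x w" for y
    by (rule riesz_representation)
      (auto intro!: bounded_linear_compose[OF cinner.bounded_linear_left] blinfun.bounded_linear_right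
        simp: cboundedD[OF T] cinner_scaleC_left)
  then obtain g where g: "\<And>x y. cinner (T x) y = cinner x (g y)" by metis
  have "bounded_linear g"
  proof (rule bounded_linear_intro)
    show "g (x + y) = g x + g y" for x y
      by (rule cinner_ext_right) (simp add: g[symmetric] cinner_add_right)
    show "g (r *\<^sub>R x) = r *\<^sub>R g x" for r x
      by (rule cinner_ext_right) (simp add: g[symmetric] cinner_scaleR_right)
    show "norm (g x) \<le> norm x * norm T" for x
    proof (cases "g x = 0")
      case False
      have "norm (g x) * norm (g x) = Re (cinner (T (g x)) x)"
        using norm_sq_eq_cinner[of "g x"] by (simp add: g power2_eq_square)
      also have "\<dots> \<le> norm (T (g x)) * norm x" by (rule Re_cinner_le)
      also have "\<dots> \<le> (norm T * norm (g x)) * norm x"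
        by (intro mult_right_mono norm_blinfun) simp
      finally show ?thesis using False by (simp add: mult.commute mult.left_commute)
    qed simp
  qed
  then show ?thesis using g bounded_linear_Blinfun_apply by metis
qed

lemma cinner_adj_right:
  assumes "T \<in> cbounded"
  shows "cinner x (blinfun_apply (adj T) y) = cinner (blinfun_apply T x) y"
  using adj_exists[OF assms] adj_unique by metis

lemma cinner_adj_left:
  assumes "T \<in> cbounded"
  shows "cinner (blinfun_apply (adj T) x) y = cinner x (blinfun_apply T y)"
  by (metis assms cinner_adj_right cinner_commute)

section \<open>The algebra of complex-linear operators\<close>

lemma cbounded_id: "id_blinfun \<in> cbounded"
  by (simp add: cbounded_def)

lemma cbounded_comp: "S \<in> cbounded \<Longrightarrow> T \<in> cbounded \<Longrightarrow> S o\<^sub>L T \<in> cbounded"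
  by (simp add: cbounded_def)

lemma cbounded_add: "S \<in> cbounded \<Longrightarrow> T \<in> cbounded \<Longrightarrow> S + T \<in> cbounded"
  by (simp add: cbounded_def blinfun.add_left scaleC_add_right)

lemma cbounded_diff: "S \<in> cbounded \<Longrightarrow> T \<in> cbounded \<Longrightarrow> S - T \<in> cbounded"
  by (simp add: cbounded_def blinfun.diff_left chilbert.scale_right_diff_distrib)

lemma cbounded_scaleR: "T \<in> cbounded \<Longrightarrow> r *\<^sub>R T \<in> cbounded"
  by (simp add: cbounded_def blinfun.scaleR_left scaleC_scaleR)

lemma cbounded_scaleC_op: "T \<in> cbounded \<Longrightarrow> scaleC_op c T \<in> cbounded"
  by (simp add: cbounded_def scaleC_op.rep_eq mult.commute)

lemma cbounded_zero: "0 \<in> cbounded"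
  by (simp add: cbounded_def)

lemma cbounded_adj: "T \<in> cbounded \<Longrightarrow> adj T \<in> cbounded"
  by (intro cboundedI cinner_ext_right) (simp add: cinner_adj_right cinner_scaleC_right)

lemma cbounded_op_Re: "T \<in> cbounded \<Longrightarrow> op_Re T \<in> cbounded"
  unfolding op_Re_def by (intro cbounded_scaleR cbounded_add cbounded_adj)

lemmas cbounded_intros = cbounded_id cbounded_comp cbounded_add cbounded_diff cbounded_scaleR
  cbounded_scaleC_op cbounded_zero cbounded_adj cbounded_op_Re

lemma closed_cbounded: "closed (cbounded :: ('a::chilbert \<Rightarrow>\<^sub>L 'b::chilbert) set)"
proof -
  have "closed {T :: 'a \<Rightarrow>\<^sub>L 'b. T (c *\<^sub>C x) = c *\<^sub>C T x}" for c x
    by (intro closed_Collect_eq bounded_linear.continuous_on[OF bounded_linear_scaleC]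
        continuous_intros)
  then show ?thesis unfolding cbounded_def by (intro closed_Collect_all)
qed

lemma adj_adj: "T \<in> cbounded \<Longrightarrow> adj (adj T) = T"
  by (rule adj_unique) (simp add: cinner_adj_left)

lemma adj_id: "adj id_blinfun = id_blinfun"
  by (rule adj_unique) simp

lemma adj_comp:
  assumes "S \<in> cbounded" "T \<in> cbounded" shows "adj (S o\<^sub>L T) = adj T o\<^sub>L adj S"
  by (rule adj_unique) (simp add: cinner_adj_right assms)

lemma adj_add:
  assumes "S \<in> cbounded" "T \<in> cbounded" shows "adj (S + T) = adj S + adj T"
  by (rule adj_unique)
    (simp add: cinner_adj_right assms blinfun.add_left cinner_add_left cinner_add_right)

lemma adj_diff:
  assumes "S \<in> cbounded" "T \<in> cbounded" shows "adj (S - T) = adj S - adj T"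
  by (rule adj_unique)
    (simp add: cinner_adj_right assms blinfun.diff_left cinner.diff_left cinner.diff_right)

lemma adj_scaleR:
  assumes "T \<in> cbounded" shows "adj (r *\<^sub>R T) = r *\<^sub>R adj T"
  by (rule adj_unique)
    (simp add: cinner_adj_right assms blinfun.scaleR_left cinner_scaleR_left cinner_scaleR_right)

lemma adj_scaleC_op:
  assumes "T \<in> cbounded" shows "adj (scaleC_op c T) = scaleC_op (cnj c) (adj T)"
  by (rule adj_unique)
    (simp add: cinner_adj_right assms scaleC_op.rep_eq cinner_scaleC_left cinner_scaleC_right)

lemma norm_adj_le:
  assumes T: "T \<in> cbounded" shows "norm (adj T) \<le> norm T"
proof (rule norm_blinfun_bound)
  fix x
  show "norm (adj T x) \<le> norm T * norm x"
  proof (cases "adj T x = 0")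
    case False
    have "norm (adj T x) * norm (adj T x) = Re (cinner (T (adj T x)) x)"
      using norm_sq_eq_cinner[of "adj T x"] by (simp add: cinner_adj_right[OF T] power2_eq_square)
    also have "\<dots> \<le> norm (T (adj T x)) * norm x" by (rule Re_cinner_le)
    also have "\<dots> \<le> (norm T * norm (adj T x)) * norm x" by (intro mult_right_mono norm_blinfun) simp
    finally show ?thesis using False by (simp add: mult.commute mult.left_commute)
  qed simp
qed simp

text \<open>Complex polarisation: the diagonal \<open>x = y\<close> of a sesquilinear form determines the form.\<close>

lemma eq_zero_if_form_zero:
  assumes T: "T \<in> cbounded" and zero: "\<And>x. cinner (blinfun_apply T x) x = 0"
  shows "T = 0"
proof (intro blinfun_eqI cinner_ext_left)
  fix x y
  have *: "cinner (T u) v + cinner (T v) u = 0" for u v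
    using zero[of "u + v"] zero[of u] zero[of v]
    by (simp add: blinfun.add_right cinner_add_left cinner_add_right add.commute)
  have "cinner (T x) y = 0"
    using *[of x y] *[of x "\<i> *\<^sub>C y"]
    by (simp add: cboundedD[OF T] cinner_scaleC_left cinner_scaleC_right)
  then show "cinner (T x) y = cinner (blinfun_apply 0 x) y" by (simp add: zero_blinfun.rep_eq)
qed

lemma adj_eq_if_form_real:
  assumes T: "T \<in> cbounded" and real: "\<And>x. cinner (blinfun_apply T x) x \<in> \<real>"
  shows "adj T = T"
proof -
  have "adj T - T = 0"
  proof (rule eq_zero_if_form_zero)
    fix x
    have "cinner x (T x) = cinner (T x) x"
      using real[of x] by (metis cinner_commute Reals_cnj_iff)
    then show "cinner ((adj T - T) x) x = 0"
      by (simp add: blinfun.diff_left cinner.diff_left cinner_adj_left[OF T])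
  qed (intro cbounded_intros T)
  then show ?thesis by simp
qed

lemma form_real_if_adj_eq:
  assumes "T \<in> cbounded" "adj T = T"
  shows "cinner (blinfun_apply T x) x = complex_of_real (Re (cinner (blinfun_apply T x) x))"
proof -
  have "cnj (cinner (T x) x) = cinner (T x) x"
    using cinner_adj_left[OF assms(1), of x x] assms(2) by (metis cinner_commute)
  then show ?thesis by (simp add: Reals_cnj_iff[symmetric])
qed

section \<open>Positive operators\<close>

lemma op_posD:
  assumes "op_pos T"
  shows "T \<in> cbounded" "adj T = T" "0 \<le> Re (cinner (blinfun_apply T x) x)"
    "cinner (blinfun_apply T x) y = cinner x (blinfun_apply T y)"
proof -
  show T: "T \<in> cbounded" using assms by (simp add: op_pos_def)
  show sa: "adj T = T"
    by (rule adj_eq_if_form_real[OF T]) (use assms nonneg_Reals_subset_Reals in \<open>auto simp: op_pos_def\<close>)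
  show "0 \<le> Re (cinner (T x) x)"
    using assms by (auto simp: op_pos_def complex_nonneg_Reals_iff)
  show "cinner (T x) y = cinner x (T y)" using cinner_adj_left[OF T] sa by metis
qed

lemma op_posI:
  assumes "T \<in> cbounded" "adj T = T" "\<And>x. 0 \<le> Re (cinner (blinfun_apply T x) x)"
  shows "op_pos T"
  unfolding op_pos_def using assms form_real_if_adj_eq[OF assms(1,2)]
  by (metis nonneg_Reals_of_real_iff)

text \<open>Positivity of \<open>P\<close> at the vector \<open>x - P x / M\<close>.\<close>

lemma norm_sq_pos_le:
  assumes P: "op_pos P" and M: "0 < M"
    and le: "\<And>x. Re (cinner (blinfun_apply P x) x) \<le> M * (norm x)\<^sup>2"
  shows "(norm (blinfun_apply P x))\<^sup>2 \<le> M * Re (cinner (blinfun_apply P x) x)"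
proof -
  define r where "r = - (1 / M)"
  have "0 \<le> Re (cinner (P (x + r *\<^sub>R P x)) (x + r *\<^sub>R P x))"
    by (rule op_posD(3)[OF P])
  also have "\<dots> = Re (cinner (P x) x) + 2 * r * (norm (P x))\<^sup>2 + r\<^sup>2 * Re (cinner (P (P x)) (P x))"
    unfolding norm_sq_eq_cinner[of "P x"]
    by (simp add: op_posD(4)[OF P, of "P x" x]
        blinfun.add_right blinfun.scaleR_right cinner_add_left cinner_add_right
        cinner_scaleR_left cinner_scaleR_right power2_eq_square algebra_simps)
  also have "\<dots> \<le> Re (cinner (P x) x) + 2 * r * (norm (P x))\<^sup>2 + r\<^sup>2 * (M * (norm (P x))\<^sup>2)"
    by (intro add_left_mono mult_left_mono le) simp
  also have "\<dots> = Re (cinner (P x) x) - (norm (P x))\<^sup>2 / M"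
    using M by (simp add: r_def power2_eq_square field_simps)
  finally show ?thesis using M by (simp add: field_simps)
qed

lemma norm_pos_le:
  assumes P: "op_pos P" and M: "0 < M"
    and le: "\<And>x. Re (cinner (blinfun_apply P x) x) \<le> M * (norm x)\<^sup>2"
  shows "norm P \<le> M"
proof (rule norm_blinfun_bound)
  fix x
  have "(norm (P x))\<^sup>2 \<le> M * (M * (norm x)\<^sup>2)"
    using norm_sq_pos_le[OF P M le, of x] mult_left_mono[OF le[of x], of M] M by linarith
  then have "(norm (P x))\<^sup>2 \<le> (M * norm x)\<^sup>2" by (simp add: power2_eq_square ac_simps)
  then show "norm (P x) \<le> M * norm x"
    by (rule power2_le_imp_le) (use M in simp)
qed (use M in simp)

lemma form_le_norm: "Re (cinner (blinfun_apply T x) x) \<le> norm T * (norm (x::'a::chilbert))\<^sup>2"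
proof -
  have "Re (cinner (T x) x) \<le> norm (T x) * norm x" by (rule Re_cinner_le)
  also have "\<dots> \<le> (norm T * norm x) * norm x" by (intro mult_right_mono norm_blinfun) simp
  finally show ?thesis by (simp add: power2_eq_square ac_simps)
qed

text \<open>Coercivity is the quantitative form of "positive and invertible"; unlike positivity it makes
  sense for operators that are not self-adjoint, and it is stable under adding accretive operators.\<close>

definition coercive :: "('a::chilbert \<Rightarrow>\<^sub>L 'a) \<Rightarrow> bool" where
  "coercive T \<longleftrightarrow> (\<exists>d>0. \<forall>x. d * (norm x)\<^sup>2 \<le> Re (cinner (blinfun_apply T x) x))"

lemma coercive_if_pos_invertible:
  assumes P: "op_pos P" and inv: "op_invertible P"
  shows "coercive P"
proof -
  obtain S where S: "S o\<^sub>L P = id_blinfun" using inv by (auto simp: op_invertible_def)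
  define M where "M = norm P + 1"
  define s where "s = norm S + 1"
  have M: "0 < M" and s: "0 < s" by (simp_all add: M_def s_def add_nonneg_pos)
  have le: "Re (cinner (P x) x) \<le> M * (norm x)\<^sup>2" for x
    using form_le_norm[of P x] by (simp add: M_def distrib_right add_increasing2)
  have "1 / (s\<^sup>2 * M) * (norm x)\<^sup>2 \<le> Re (cinner (P x) x)" for x
  proof -
    have "norm x = norm (S (P x))" using S by (metis blinfun_apply_blinfun_compose blinfun_apply_id_blinfun id_apply)
    also have "\<dots> \<le> norm S * norm (P x)" by (rule norm_blinfun)
    also have "\<dots> \<le> s * norm (P x)" by (intro mult_right_mono) (simp_all add: s_def)
    finally have "(norm x)\<^sup>2 \<le> s\<^sup>2 * (norm (P x))\<^sup>2" by (metis norm_ge_zero power_mono power_mult_distrib)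
    also have "\<dots> \<le> s\<^sup>2 * (M * Re (cinner (P x) x))"
      by (intro mult_left_mono norm_sq_pos_le P M le) simp
    finally show ?thesis using M s by (simp add: field_simps)
  qed
  moreover have "0 < 1 / (s\<^sup>2 * M)" using M s by simp
  ultimately show ?thesis unfolding coercive_def by blast
qed

text \<open>Expanding the square, the first-order gain \<open>2 s d\<close> beats the second-order loss \<open>s\<^sup>2 m\<^sup>2\<close> by the
  most at the step \<open>s = d / m\<^sup>2\<close>. The summand \<open>d\<close> in \<open>m\<close> gives \<open>0 < m\<close> and \<open>d / m \<le> 1\<close> even on
  the zero space.\<close>

lemma norm_sq_id_minus_le:
  assumes "\<And>x. d * (norm x)\<^sup>2 \<le> Re (cinner (blinfun_apply T x) x)" "0 < d" "m = norm T + d"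
  shows "(norm (x - (d / m\<^sup>2) *\<^sub>R blinfun_apply T x))\<^sup>2 \<le> (1 - (d / m)\<^sup>2) * (norm x)\<^sup>2"
proof -
  have m: "0 < m" using assms by (simp add: add_nonneg_pos)
  define s where "s = d / m\<^sup>2"
  have s: "0 < s" using m assms by (simp add: s_def)
  have "norm (T x) \<le> m * norm x"
    using norm_blinfun[of T x] assms(2,3) by (simp add: distrib_right add_increasing2)
  then have Tx: "(norm (T x))\<^sup>2 \<le> m\<^sup>2 * (norm x)\<^sup>2" by (metis norm_ge_zero power_mono power_mult_distrib)
  have "(norm (x - s *\<^sub>R T x))\<^sup>2 = (norm x)\<^sup>2 - 2 * s * Re (cinner (T x) x) + s\<^sup>2 * (norm (T x))\<^sup>2"
    using norm_sq_add[of x "- (s *\<^sub>R T x)"]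
    by (simp add: cinner.minus_right cinner_scaleR_right Re_cinner_commute[of x] power_mult_distrib)
  also have "\<dots> \<le> (norm x)\<^sup>2 - 2 * s * (d * (norm x)\<^sup>2) + s\<^sup>2 * (m\<^sup>2 * (norm x)\<^sup>2)"
    using assms(1)[of x] Tx s by (intro add_mono diff_mono mult_left_mono) auto
  also have "\<dots> = (1 - (d / m)\<^sup>2) * (norm x)\<^sup>2"
    using m by (simp add: s_def field_simps power2_eq_square)
  finally show ?thesis by (simp add: s_def)
qed

text \<open>\<open>T x = y\<close> is the fixed-point equation of \<open>x \<mapsto> x - s (T x - y)\<close>, a contraction for a
  suitable \<open>s > 0\<close>.\<close>

lemma coercive_invertible:
  fixes T :: "'a::chilbert \<Rightarrow>\<^sub>L 'a"
  assumes "coercive T" shows "op_invertible T"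
proof -
  obtain d where d: "0 < d" and co: "\<And>x. d * (norm x)\<^sup>2 \<le> Re (cinner (T x) x)"
    using assms by (auto simp: coercive_def)
  define m where "m = norm T + d"
  have m: "0 < m" "d \<le> m" using d by (simp_all add: m_def add_nonneg_pos)
  define s where "s = d / m\<^sup>2"
  have s: "s \<noteq> 0" using m d by (simp add: s_def)
  define q where "q = sqrt (1 - (d / m)\<^sup>2)"
  have dm: "0 < (d / m)\<^sup>2" "(d / m)\<^sup>2 \<le> 1" using m d by (simp_all add: power_le_one)
  have q: "0 \<le> q" "q < 1" using dm by (simp_all add: q_def)
  have contr: "norm (x - s *\<^sub>R T x) \<le> q * norm x" for x
  proof -
    have "norm (x - s *\<^sub>R T x) = sqrt ((norm (x - s *\<^sub>R T x))\<^sup>2)" by simp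
    also have "\<dots> \<le> sqrt ((1 - (d / m)\<^sup>2) * (norm x)\<^sup>2)"
      unfolding s_def by (intro real_sqrt_le_mono norm_sq_id_minus_le[OF co d m_def])
    finally show ?thesis by (simp add: q_def real_sqrt_mult)
  qed
  have "\<exists>x. T x = y" for y
  proof -
    have "\<exists>!x. x - s *\<^sub>R (T x - y) = x"
    proof (rule banach_fix_type[OF q])
      show "\<forall>x z. dist (x - s *\<^sub>R (T x - y)) (z - s *\<^sub>R (T z - y)) \<le> q * dist x z"
      proof (intro allI)
        fix x z
        show "dist (x - s *\<^sub>R (T x - y)) (z - s *\<^sub>R (T z - y)) \<le> q * dist x z"
          using contr[of "x - z"] by (simp add: dist_norm blinfun.diff_right algebra_simps)
      qed
    qed
    then show ?thesis using s by auto
  qed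
  then obtain g where g: "\<And>y. T (g y) = y" by metis
  have low: "d * norm x \<le> norm (T x)" for x
  proof (cases "x = 0")
    case False
    have "(d * norm x) * norm x \<le> norm (T x) * norm x"
      using co[of x] Re_cinner_le[of "T x" x] by (simp add: power2_eq_square)
    then show ?thesis using False by simp
  qed simp
  have inj: "x = z" if "T x = T z" for x z
    using low[of "x - z"] that d by (simp add: blinfun.diff_right zero_le_mult_iff mult_le_0_iff)
  have "bounded_linear g"
  proof (rule bounded_linear_intro)
    show "g (x + y) = g x + g y" for x y by (rule inj) (simp add: g blinfun.add_right)
    show "g (r *\<^sub>R x) = r *\<^sub>R g x" for r x by (rule inj) (simp add: g blinfun.scaleR_right)
    show "norm (g x) \<le> norm x * (1 / d)" for x using low[of "g x"] d by (simp add: g field_simps)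
  qed
  then obtain S where S: "\<And>x. blinfun_apply S x = g x" using bounded_linear_Blinfun_apply by metis
  have "g (T x) = x" for x by (rule inj) (rule g)
  then have "S o\<^sub>L T = id_blinfun" "T o\<^sub>L S = id_blinfun"
    by (auto intro!: blinfun_eqI simp: S g)
  then show ?thesis by (auto simp: op_invertible_def)
qed

lemma op_inv_eqI:
  assumes "S o\<^sub>L T = id_blinfun" "T o\<^sub>L S = id_blinfun" shows "op_inv T = S"
  unfolding op_inv_def
proof (rule the_equality)
  fix R assume "R o\<^sub>L T = id_blinfun \<and> T o\<^sub>L R = id_blinfun"
  then show "R = S" using assms
    by (metis blinfun_apply_blinfun_compose blinfun_apply_id_blinfun blinfun_eqI id_apply)
qed (use assms in blast)

lemma op_inv_comp:
  assumes "op_invertible T"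
  shows "op_inv T o\<^sub>L T = id_blinfun" "T o\<^sub>L op_inv T = id_blinfun"
  using assms op_inv_eqI unfolding op_invertible_def by metis+

lemma op_inv_apply:
  assumes "op_invertible T"
  shows "blinfun_apply (op_inv T) (blinfun_apply T x) = x"
    "blinfun_apply T (blinfun_apply (op_inv T) x) = x"
  using op_inv_comp[OF assms]
  by (metis blinfun_apply_blinfun_compose blinfun_apply_id_blinfun id_apply)+

lemma cbounded_op_inv:
  assumes "op_invertible T" "T \<in> cbounded" shows "op_inv T \<in> cbounded"
  by (rule cboundedI) (metis assms op_inv_apply cboundedD)

lemma op_inv_commute:
  assumes T: "op_invertible T"
    and comm: "\<And>x. blinfun_apply R (blinfun_apply T x) = blinfun_apply T (blinfun_apply R x)"
  shows "blinfun_apply R (blinfun_apply (op_inv T) x) = blinfun_apply (op_inv T) (blinfun_apply R x)"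
  by (metis op_inv_apply[OF T] comm)

lemma op_inv_adj:
  assumes T: "op_invertible T" "T \<in> cbounded"
  shows "op_invertible (adj T)" "op_inv (adj T) = adj (op_inv T)"
proof -
  have *: "adj (op_inv T) o\<^sub>L adj T = id_blinfun" "adj T o\<^sub>L adj (op_inv T) = id_blinfun"
    using T by (simp_all flip: adj_comp add: cbounded_op_inv op_inv_comp adj_id)
  show "op_invertible (adj T)" using * by (auto simp: op_invertible_def)
  show "op_inv (adj T) = adj (op_inv T)" using * by (rule op_inv_eqI)
qed

section \<open>Square roots of coercive positive operators\<close>

text \<open>After scaling, \<open>M = 1 - A\<close> with \<open>norm A \<le> q < 1\<close>, and \<open>1 - B\<close> is a square root of \<open>M\<close>
  exactly when \<open>B = (A + B\<^sup>2) / 2\<close>. On the ball of radius \<open>\<rho> = 1 - sqrt (1 - q)\<close>, the fixed point of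
  the scalar equation, the right-hand side is a contraction with constant \<open>\<rho>\<close>; it preserves
  self-adjointness and the commutant of \<open>M\<close>, so the fixed point has these properties too.\<close>

lemma pos_sqrt_exists:
  fixes M :: "'a::chilbert \<Rightarrow>\<^sub>L 'a"
  assumes M: "op_pos M" and coM: "coercive M"
  shows "\<exists>S. op_pos S \<and> coercive S \<and> S o\<^sub>L S = M \<and> (\<forall>R. R o\<^sub>L M = M o\<^sub>L R \<longrightarrow> R o\<^sub>L S = S o\<^sub>L R)"
proof -
  obtain d where d: "0 < d" and co: "\<And>x. d * (norm x)\<^sup>2 \<le> Re (cinner (M x) x)"
    using coM by (auto simp: coercive_def)
  define m where "m = norm M + d"
  have m: "0 < m" "d \<le> m" using d by (simp_all add: m_def add_nonneg_pos)
  define s where "s = d / m\<^sup>2"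
  have s: "0 < s" using m d by (simp add: s_def)
  define q where "q = sqrt (1 - (d / m)\<^sup>2)"
  have dm: "0 < (d / m)\<^sup>2" "(d / m)\<^sup>2 \<le> 1" using m d by (simp_all add: power_le_one)
  have q: "0 \<le> q" "q < 1" using dm by (simp_all add: q_def)
  define A where "A = id_blinfun - s *\<^sub>R M"
  have A: "norm A \<le> q"
  proof (rule norm_blinfun_bound[OF q(1)])
    fix x
    have "norm (A x) = sqrt ((norm (x - s *\<^sub>R M x))\<^sup>2)"
      by (simp add: A_def blinfun.diff_left blinfun.scaleR_left)
    also have "\<dots> \<le> sqrt ((1 - (d / m)\<^sup>2) * (norm x)\<^sup>2)"
      unfolding s_def by (intro real_sqrt_le_mono norm_sq_id_minus_le[OF co d m_def])
    finally show "norm (A x) \<le> q * norm x" by (simp add: q_def real_sqrt_mult)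
  qed
  define \<rho> where "\<rho> = 1 - sqrt (1 - q)"
  have \<rho>: "0 \<le> \<rho>" "\<rho> < 1" "(q + \<rho>\<^sup>2) / 2 = \<rho>"
    using q by (simp_all add: \<rho>_def power2_diff)
  define U where "U = {B :: 'a \<Rightarrow>\<^sub>L 'a. norm B \<le> \<rho> \<and> B \<in> cbounded \<and>
      (\<forall>x y. cinner (B x) y = cinner x (B y)) \<and> (\<forall>R. R o\<^sub>L M = M o\<^sub>L R \<longrightarrow> R o\<^sub>L B = B o\<^sub>L R)}"
  define f where "f B = (1/2) *\<^sub>R (A + (B o\<^sub>L B))" for B :: "'a \<Rightarrow>\<^sub>L 'a"
  have fx: "f B x = (1/2) *\<^sub>R (x - s *\<^sub>R M x + B (B x))" for B x
    by (simp add: f_def A_def blinfun.add_left blinfun.diff_left blinfun.scaleR_left)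
  have "\<exists>!B. B \<in> U \<and> f B = B"
  proof (rule Banach_fix[OF _ _ \<rho>(1,2)])
    have "closed {B :: 'a \<Rightarrow>\<^sub>L 'a. norm B \<le> \<rho>}"
      by (intro closed_Collect_le continuous_on_norm continuous_on_id continuous_on_const)
    moreover have "closed {B :: 'a \<Rightarrow>\<^sub>L 'a. cinner (B x) y = cinner x (B y)}" for x y
      by (intro closed_Collect_eq cinner.continuous_on blinfun.continuous_on continuous_on_id
          continuous_on_const)
    moreover have "closed {B :: 'a \<Rightarrow>\<^sub>L 'a. R o\<^sub>L M = M o\<^sub>L R \<longrightarrow> R o\<^sub>L B = B o\<^sub>L R}" for R
      by (cases "R o\<^sub>L M = M o\<^sub>L R")
        (auto intro!: closed_Collect_eq bounded_bilinear.continuous_on[OF bounded_bilinear_blinfun_compose]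
          continuous_on_id continuous_on_const)
    ultimately have "closed ({B :: 'a \<Rightarrow>\<^sub>L 'a. norm B \<le> \<rho>} \<inter> (cbounded \<inter>
        ((\<Inter>x. \<Inter>y. {B :: 'a \<Rightarrow>\<^sub>L 'a. cinner (B x) y = cinner x (B y)}) \<inter>
         (\<Inter>R. {B. R o\<^sub>L M = M o\<^sub>L R \<longrightarrow> R o\<^sub>L B = B o\<^sub>L R}))))"
      by (intro closed_Int closed_INT ballI closed_cbounded)
    moreover have "\<dots> = U" unfolding U_def by blast
    ultimately have "closed U" by simp
    then show "complete U" by (simp add: complete_eq_closed)
    have "0 \<in> U" using \<rho> by (auto simp: U_def cbounded_zero intro!: blinfun_eqI simp: zero_blinfun.rep_eq cinner.zero_right)
    then show "U \<noteq> {}" by blast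
    show "f ` U \<subseteq> U"
    proof (rule image_subsetI)
      fix B assume B: "B \<in> U"
      have "norm (f B) = norm (A + (B o\<^sub>L B)) / 2" by (simp add: f_def)
      also have "\<dots> \<le> (norm A + norm B * norm B) / 2"
        by (intro divide_right_mono norm_triangle_mono norm_blinfun_compose) auto
      also have "\<dots> \<le> (q + \<rho> * \<rho>) / 2"
        using B A \<rho> by (intro divide_right_mono add_mono mult_mono) (auto simp: U_def)
      also have "\<dots> = \<rho>" using \<rho>(3) by (simp add: power2_eq_square)
      finally have 1: "norm (f B) \<le> \<rho>" .
      have 2: "f B \<in> cbounded"
        using B op_posD(1)[OF M] unfolding f_def A_def U_def by (intro cbounded_intros) auto
      have 3: "cinner (f B x) y = cinner x (f B y)" for x y
        using B by (simp add: fx U_def cinner_scaleR_left cinner_scaleR_right cinner_add_left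
            cinner_add_right cinner.diff_left cinner.diff_right op_posD(4)[OF M])
      have 4: "R o\<^sub>L f B = f B o\<^sub>L R" if R: "R o\<^sub>L M = M o\<^sub>L R" for R
      proof (rule blinfun_eqI)
        fix x
        have RM: "R (M x) = M (R x)" for x using R by (metis blinfun_apply_blinfun_compose)
        have RB: "R (B x) = B (R x)" for x
          using R B unfolding U_def by (metis (mono_tags, lifting) blinfun_apply_blinfun_compose mem_Collect_eq)
        show "(R o\<^sub>L f B) x = (f B o\<^sub>L R) x"
          by (simp add: fx blinfun.bilinear_simps RM RB)
      qed
      show "f B \<in> U" using 1 2 3 4 by (simp add: U_def)
    qed
    fix B C assume B: "B \<in> U" and C: "C \<in> U"
    have "f B - f C = (1/2) *\<^sub>R ((B o\<^sub>L (B - C)) + ((B - C) o\<^sub>L C))"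
      by (rule blinfun_eqI) (simp add: fx blinfun.bilinear_simps flip: scaleR_diff_right)
    then have "norm (f B - f C) = norm ((B o\<^sub>L (B - C)) + ((B - C) o\<^sub>L C)) / 2" by simp
    also have "\<dots> \<le> (norm B * norm (B - C) + norm (B - C) * norm C) / 2"
      by (intro divide_right_mono norm_triangle_mono norm_blinfun_compose) auto
    also have "\<dots> \<le> (\<rho> * norm (B - C) + norm (B - C) * \<rho>) / 2"
      using B C by (intro divide_right_mono add_mono mult_mono) (auto simp: U_def \<rho>)
    finally show "dist (f B) (f C) \<le> \<rho> * dist B C" by (simp add: dist_norm)
  qed
  then obtain B where BU: "B \<in> U" and "f B = B" by blast
  then have Bx: "B x = (1/2) *\<^sub>R (x - s *\<^sub>R M x + B (B x))" for x using fx by metis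
  define r where "r = 1 / sqrt s"
  have r: "0 < r" "r * r * s = 1" using s by (simp_all add: r_def)
  define S where "S = r *\<^sub>R (id_blinfun - B)"
  have Sx: "S x = r *\<^sub>R (x - B x)" for x by (simp add: S_def blinfun.bilinear_simps)
  have "(r * (1 - \<rho>)) * (norm x)\<^sup>2 \<le> Re (cinner (S x) x)" for x
  proof -
    have "Re (cinner (B x) x) \<le> \<rho> * (norm x)\<^sup>2"
      using form_le_norm[of B x] BU mult_right_mono[of "norm B" \<rho> "(norm x)\<^sup>2"]
      by (simp add: U_def)
    then have "(1 - \<rho>) * (norm x)\<^sup>2 \<le> (norm x)\<^sup>2 - Re (cinner (B x) x)"
      by (simp add: algebra_simps)
    then have "r * ((1 - \<rho>) * (norm x)\<^sup>2) \<le> r * ((norm x)\<^sup>2 - Re (cinner (B x) x))"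
      using r by (intro mult_left_mono) auto
    then show ?thesis
      by (simp add: Sx cinner_scaleR_left cinner.diff_left norm_sq_eq_cinner mult.assoc)
  qed
  moreover have "0 < r * (1 - \<rho>)" using r \<rho> by simp
  ultimately have co: "coercive S" and form: "0 \<le> Re (cinner (S x) x)" for x
    unfolding coercive_def by (blast, meson dual_order.trans less_imp_le mult_nonneg_nonneg zero_le_power2)
  have "S \<in> cbounded" unfolding S_def using BU by (intro cbounded_intros) (simp add: U_def)
  moreover have "adj S = S"
    by (rule adj_unique)
      (use BU in \<open>simp add: Sx U_def cinner_scaleR_left cinner_scaleR_right cinner.diff_left cinner.diff_right\<close>)
  ultimately have "op_pos S" using form by (intro op_posI)
  moreover have "S o\<^sub>L S = M"
  proof (rule blinfun_eqI)
    fix x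
    have "B x + B x = x - s *\<^sub>R M x + B (B x)"
      using arg_cong[OF Bx[of x], of "\<lambda>v. v + v"] by (simp flip: scaleR_add_left)
    then have "x - B x - B x + B (B x) = s *\<^sub>R M x" by (simp add: algebra_simps)
    then have "(x - B x) - B (x - B x) = s *\<^sub>R M x" by (simp add: blinfun.diff_right algebra_simps)
    then have "S (S x) = (r * r * s) *\<^sub>R M x"
      by (simp add: Sx blinfun.scaleR_right flip: scaleR_diff_right)
    then show "(S o\<^sub>L S) x = M x" using r by simp
  qed
  moreover have "R o\<^sub>L S = S o\<^sub>L R" if R: "R o\<^sub>L M = M o\<^sub>L R" for R
  proof (rule blinfun_eqI)
    fix x
    have "R (B x) = B (R x)"
      using R BU unfolding U_def by (metis (mono_tags, lifting) blinfun_apply_blinfun_compose mem_Collect_eq)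
    then show "(R o\<^sub>L S) x = (S o\<^sub>L R) x" by (simp add: Sx blinfun.bilinear_simps)
  qed
  ultimately show ?thesis using co by blast
qed

text \<open>A second square root \<open>S'\<close> commutes with \<open>M\<close>, hence with \<open>S\<close>, so \<open>(S + S') (S - S') = 0\<close>; and
  \<open>S + S'\<close> is injective because \<open>S\<close> is coercive.\<close>

lemma op_sqrt_coercive:
  fixes M :: "'a::chilbert \<Rightarrow>\<^sub>L 'a"
  assumes M: "op_pos M" and coM: "coercive M"
  shows "op_pos (op_sqrt M)" "coercive (op_sqrt M)" "op_sqrt M o\<^sub>L op_sqrt M = M"
    "R o\<^sub>L M = M o\<^sub>L R \<Longrightarrow> R o\<^sub>L op_sqrt M = op_sqrt M o\<^sub>L R"
proof -
  obtain S where S: "op_pos S" "coercive S" "S o\<^sub>L S = M"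
    "\<And>R. R o\<^sub>L M = M o\<^sub>L R \<Longrightarrow> R o\<^sub>L S = S o\<^sub>L R"
    using pos_sqrt_exists[OF assms] by blast
  have eq: "op_sqrt M = S" unfolding op_sqrt_def
  proof (rule the_equality)
    fix S' assume S': "op_pos S' \<and> S' o\<^sub>L S' = M"
    have "S' o\<^sub>L M = M o\<^sub>L S'" using S' by (auto intro!: blinfun_eqI)
    then have comm: "S' (S x) = S (S' x)" for x using S(4) by (metis blinfun_apply_blinfun_compose)
    obtain d where d: "0 < d" and co: "\<And>x. d * (norm x)\<^sup>2 \<le> Re (cinner (S x) x)"
      using S(2) by (auto simp: coercive_def)
    have sq: "S (S x) = S' (S' x)" for x using S(3) S' by (metis blinfun_apply_blinfun_compose)
    show "S' = S"
    proof (rule blinfun_eqI)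
      fix x
      define y where "y = S x - S' x"
      have "S y + S' y = 0" by (simp add: y_def blinfun.diff_right sq comm)
      then have "Re (cinner (S y) y) + Re (cinner (S' y) y) = 0"
        by (metis cinner_add_left cinner_zero_left plus_complex.simps(1) zero_complex.simps(1))
      then have "d * (norm y)\<^sup>2 \<le> 0" using co[of y] op_posD(3)[of S' y] S' by linarith
      then have "y = 0" using d by (simp add: mult_le_0_iff)
      then show "S' x = S x" by (simp add: y_def)
    qed
  qed (use S in blast)
  show "op_pos (op_sqrt M)" "coercive (op_sqrt M)" "op_sqrt M o\<^sub>L op_sqrt M = M"
    unfolding eq by (fact S)+
  show "R o\<^sub>L M = M o\<^sub>L R \<Longrightarrow> R o\<^sub>L op_sqrt M = op_sqrt M o\<^sub>L R"
    unfolding eq by (rule S(4))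
qed

section \<open>Square-summable families and orthonormal bases\<close>

text \<open>The Cauchy criterion, with the tail of \<open>f\<close> controlled by the square root of the tail of \<open>g\<close>.
  Orthogonal series and Cauchy-Schwarz estimates both give a bound of this kind.\<close>

lemma summable_on_if_square_bound:
  fixes f :: "'i \<Rightarrow> 'a::banach" and g :: "'i \<Rightarrow> real"
  assumes g: "g summable_on A" and K: "0 \<le> K"
    and le: "\<And>F. finite F \<Longrightarrow> F \<subseteq> A \<Longrightarrow> (norm (sum f F))\<^sup>2 \<le> K * sum g F"
  shows "f summable_on A"
proof -
  obtain L where lim: "(sum g \<longlongrightarrow> L) (finite_subsets_at_top A)"
    using g unfolding summable_on_def has_sum_def by blast
  have "\<exists>P. eventually P (finite_subsets_at_top A) \<and>
      (\<forall>F F'. P F \<and> P F' \<longrightarrow> dist (sum f F) (sum f F') < e)" if e: "e > 0" for e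
  proof -
    define d where "d = e\<^sup>2 / (8 * (K + 1))"
    have d: "0 < d" using e K by (simp add: d_def)
    have "\<forall>\<^sub>F F in finite_subsets_at_top A. dist (sum g F) L < d" using lim d by (rule tendstoD)
    then have "\<exists>F0. finite F0 \<and> F0 \<subseteq> A \<and>
        (\<forall>F. finite F \<and> F0 \<subseteq> F \<and> F \<subseteq> A \<longrightarrow> dist (sum g F) L < d)"
      by (simp only: eventually_finite_subsets_at_top)
    then obtain F0 where F0: "finite F0" "F0 \<subseteq> A"
      and close: "\<And>F. finite F \<Longrightarrow> F0 \<subseteq> F \<Longrightarrow> F \<subseteq> A \<Longrightarrow> dist (sum g F) L < d"
      by metis
    define P where "P F \<longleftrightarrow> finite F \<and> F0 \<subseteq> F \<and> F \<subseteq> A" for F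
    have "eventually P (finite_subsets_at_top A)"
      unfolding eventually_finite_subsets_at_top P_def using F0 by (intro exI[of _ F0]) simp
    moreover have half: "norm (sum f (F - F')) < e / 2" if "P F" "P F'" for F F'
    proof -
      have fin: "finite F" "finite F'" and sub: "F \<subseteq> A" "F' \<subseteq> A" "F0 \<subseteq> F'"
        using that by (auto simp: P_def)
      have "sum g (F - F') = sum g (F \<union> F') - sum g F'"
        using sum_diff[of "F \<union> F'" F' g] fin by (simp add: Un_Diff)
      also have "\<dots> < 2 * d"
        using close[of "F \<union> F'"] close[of F'] fin sub le_supI2[OF sub(3), of F]
        by (simp add: dist_real_def abs_if split: if_splits)
      finally have lt: "sum g (F - F') < 2 * d" .
      have "(norm (sum f (F - F')))\<^sup>2 \<le> K * sum g (F - F')"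
        using fin sub by (intro le) auto
      also have "\<dots> \<le> K * (2 * d)" using lt K by (intro mult_left_mono) auto
      also have "\<dots> < (e / 2)\<^sup>2" using K e by (simp add: d_def field_simps power2_eq_square)
      finally show ?thesis by (rule power_less_imp_less_base) (use e in simp)
    qed
    have "dist (sum f F) (sum f F') < e" if "P F" "P F'" for F F'
    proof -
      have fin: "finite F" "finite F'" using that by (auto simp: P_def)
      have "sum f F - sum f F' = sum f (F - F') - sum f (F' - F)"
        using sum.Int_Diff[of F f F'] sum.Int_Diff[of F' f F] fin by (simp add: Int_commute)
      then have "dist (sum f F) (sum f F') \<le> norm (sum f (F - F')) + norm (sum f (F' - F))"
        by (simp add: dist_norm norm_triangle_ineq4)
      then show ?thesis using half[of F F'] half[of F' F] that by simp
    qed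
    ultimately show ?thesis by blast
  qed
  then have "cauchy_filter (filtermap (sum f) (finite_subsets_at_top A))"
    by (simp add: cauchy_filter_metric_filtermap)
  moreover have "complete (UNIV :: 'a set)" by (rule complete_UNIV)
  ultimately obtain L' where "(sum f \<longlongrightarrow> L') (finite_subsets_at_top A)"
    using complete_uniform[where S = UNIV] by (force simp add: filterlim_def)
  then show ?thesis using summable_on_def has_sum_def by blast
qed

definition orthonormal_on :: "('s \<Rightarrow> 'a::chilbert) \<Rightarrow> 's set \<Rightarrow> bool" where
  "orthonormal_on u S \<longleftrightarrow> (\<forall>s\<in>S. \<forall>r\<in>S. cinner (u s) (u r) = (if s = r then 1 else 0))"

lemma orthonormal_onD:
  "orthonormal_on u S \<Longrightarrow> s \<in> S \<Longrightarrow> r \<in> S \<Longrightarrow> cinner (u s) (u r) = (if s = r then 1 else 0)"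
  by (simp add: orthonormal_on_def)

lemma norm_eq_1_if_orthonormal:
  assumes "orthonormal_on u S" "s \<in> S" shows "norm (u s) = 1"
  using norm_sq_eq_cinner[of "u s"] orthonormal_onD[OF assms(1), of s s] assms(2)
  by (simp add: power2_eq_1_iff) (smt (verit) norm_ge_zero)

lemma norm_sq_sum_if_orthogonal:
  assumes "finite F" "\<And>s r. s \<in> F \<Longrightarrow> r \<in> F \<Longrightarrow> s \<noteq> r \<Longrightarrow> cinner (f s) (f r :: 'a::chilbert) = 0"
  shows "(norm (sum f F))\<^sup>2 = (\<Sum>s\<in>F. (norm (f s))\<^sup>2)"
proof -
  have "cinner (sum f F) (sum f F) = (\<Sum>s\<in>F. \<Sum>r\<in>F. cinner (f s) (f r))"
    by (subst cinner.sum_left) (simp add: cinner.sum_right)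
  also have "\<dots> = (\<Sum>s\<in>F. \<Sum>r\<in>F. if r = s then cinner (f s) (f s) else 0)"
    using assms(2) by (intro sum.cong) auto
  also have "\<dots> = (\<Sum>s\<in>F. cinner (f s) (f s))" using assms(1) by simp
  finally show ?thesis by (simp add: norm_sq_eq_cinner)
qed

lemma bessel_finite:
  assumes u: "orthonormal_on u S" and F: "finite F" "F \<subseteq> S"
  shows "(\<Sum>s\<in>F. (cmod (cinner x (u s)))\<^sup>2) \<le> (norm (x :: 'a::chilbert))\<^sup>2"
proof -
  define p where "p = (\<Sum>s\<in>F. cinner x (u s) *\<^sub>C u s)"
  have uF: "cinner (u s) (u r) = (if s = r then 1 else 0)" if "s \<in> F" "r \<in> F" for s r
    using orthonormal_onD[OF u] F that by blast
  have "cinner x p = (\<Sum>s\<in>F. complex_of_real ((cmod (cinner x (u s)))\<^sup>2))"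
    by (simp add: p_def cinner.sum_right cinner_scaleC_right complex_norm_square mult.commute
        del: of_real_power)
  then have xp: "Re (cinner x p) = (\<Sum>s\<in>F. (cmod (cinner x (u s)))\<^sup>2)" by (simp del: of_real_power)
  have "(norm p)\<^sup>2 = (\<Sum>s\<in>F. (norm (cinner x (u s) *\<^sub>C u s))\<^sup>2)"
    unfolding p_def by (rule norm_sq_sum_if_orthogonal[OF F(1)])
      (simp add: cinner_scaleC_left cinner_scaleC_right uF)
  also have "\<dots> = (\<Sum>s\<in>F. (cmod (cinner x (u s)))\<^sup>2)"
  proof (intro sum.cong refl)
    fix s assume "s \<in> F"
    then have "norm (u s) = 1" using norm_eq_1_if_orthonormal[OF u] F by blast
    then show "(norm (cinner x (u s) *\<^sub>C u s))\<^sup>2 = (cmod (cinner x (u s)))\<^sup>2"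
      by (simp add: norm_scaleC)
  qed
  finally have "(norm (x + (- p)))\<^sup>2 = (norm x)\<^sup>2 - (\<Sum>s\<in>F. (cmod (cinner x (u s)))\<^sup>2)"
    unfolding norm_sq_add by (simp add: cinner.minus_right xp)
  then show ?thesis using zero_le_power2[of "norm (x + (- p))"] by linarith
qed

lemma bessel_summable:
  assumes "orthonormal_on u S"
  shows "(\<lambda>s. (cmod (cinner x (u s)))\<^sup>2) summable_on S"
  using bessel_finite[OF assms] by (intro nonneg_bdd_above_summable_on bdd_aboveI) auto

text \<open>The Fourier coefficients of \<open>x\<close> are square-summable by Bessel, and they dominate the terms of
  the orthogonal series \<open>f\<close>.\<close>

lemma fourier_summable:
  fixes x :: "'a::chilbert" and f :: "'s \<Rightarrow> 'b::chilbert"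
  assumes u: "orthonormal_on u S"
    and orth: "\<And>s r. s \<in> S \<Longrightarrow> r \<in> S \<Longrightarrow> s \<noteq> r \<Longrightarrow> cinner (f s) (f r) = 0"
    and le: "\<And>s. s \<in> S \<Longrightarrow> norm (f s) \<le> cmod (cinner x (u s))"
  shows "f summable_on S"
proof (rule summable_on_if_square_bound[OF bessel_summable[OF u, of x], of 1])
  fix F assume F: "finite F" "F \<subseteq> S"
  have "(norm (sum f F))\<^sup>2 = (\<Sum>s\<in>F. (norm (f s))\<^sup>2)"
    using F orth by (intro norm_sq_sum_if_orthogonal) auto
  also have "\<dots> \<le> (\<Sum>s\<in>F. (cmod (cinner x (u s)))\<^sup>2)"
    using F le by (intro sum_mono power_mono) auto
  finally show "(norm (sum f F))\<^sup>2 \<le> 1 * (\<Sum>s\<in>F. (cmod (cinner x (u s)))\<^sup>2)" by simp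
qed simp

definition hilbert_basis :: "'a::chilbert set \<Rightarrow> bool" where
  "hilbert_basis S \<longleftrightarrow> orthonormal_on id S \<and> (\<forall>y. (\<forall>s\<in>S. cinner y s = 0) \<longrightarrow> y = 0)"

text \<open>A maximal orthonormal set is total, since the normalisation of a nonzero vector orthogonal to it
  could be added.\<close>

lemma hilbert_basis_exists: "\<exists>S :: 'a::chilbert set. hilbert_basis S"
proof -
  have "\<exists>M\<in>{S :: 'a set. orthonormal_on id S}. \<forall>X\<in>{S. orthonormal_on id S}. M \<subseteq> X \<longrightarrow> X = M"
  proof (rule subset_Zorn', rule CollectI)
    fix C :: "'a set set" assume C: "subset.chain {S. orthonormal_on id S} C"
    show "orthonormal_on id (\<Union> C)" unfolding orthonormal_on_def
    proof (intro ballI)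
      fix s r assume "s \<in> \<Union> C" "r \<in> \<Union> C"
      then obtain S R where "S \<in> C" "R \<in> C" "s \<in> S" "r \<in> R" by blast
      moreover have "S \<subseteq> R \<or> R \<subseteq> S"
        using C \<open>S \<in> C\<close> \<open>R \<in> C\<close> by (meson subset.chain_def subset_chain_def)
      ultimately obtain T where "T \<in> C" "s \<in> T" "r \<in> T" by blast
      moreover have "orthonormal_on id T" using C \<open>T \<in> C\<close> by (auto simp: subset_chain_def)
      ultimately show "cinner (id s) (id r) = (if s = r then 1 else 0)"
        by (metis orthonormal_onD)
    qed
  qed
  then obtain M :: "'a set" where M: "orthonormal_on id M"
    and max: "\<And>X. orthonormal_on id X \<Longrightarrow> M \<subseteq> X \<Longrightarrow> X = M" by blast
  have "y = 0" if y: "\<forall>s\<in>M. cinner y s = 0" for y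
  proof (rule ccontr)
    assume "y \<noteq> 0"
    define v where "v = (1 / norm y) *\<^sub>R y"
    have vM: "cinner v s = 0" "cinner s v = 0" if "s \<in> M" for s
      using y that cinner_commute[of s v] by (auto simp: v_def cinner_scaleR_left)
    have "cinner v v = 1" using \<open>y \<noteq> 0\<close> by (simp add: cinner_self v_def)
    then have "orthonormal_on id (insert v M)"
      using M vM by (auto simp: orthonormal_on_def)
    then have "insert v M = M" by (intro max) auto
    then show False using vM(1)[of v] \<open>cinner v v = 1\<close> by auto
  qed
  then show ?thesis using M unfolding hilbert_basis_def by blast
qed

lemma has_sum_single:
  fixes a :: "'a::{comm_monoid_add,t2_space}"
  assumes "s \<in> S"
  shows "((\<lambda>r. if r = s then a else 0) has_sum a) S"
  using assms by (intro has_sum_finite_neutralI[of "{s}"]) auto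

lemma has_sum_cinner_left:
  "(f has_sum v) S \<Longrightarrow> ((\<lambda>s. cinner (f s) w) has_sum cinner v w) S"
  by (rule has_sum_bounded_linear[OF cinner.bounded_linear_left])

lemma has_sum_blinfun:
  "(f has_sum v) S \<Longrightarrow> ((\<lambda>s. blinfun_apply T (f s)) has_sum blinfun_apply T v) S"
  by (rule has_sum_bounded_linear[OF blinfun.bounded_linear_right])

text \<open>The series converges by Bessel, and the difference between \<open>x\<close> and its sum is orthogonal to the
  basis.\<close>

lemma fourier_expansion:
  assumes S: "hilbert_basis S"
  shows "((\<lambda>s. cinner x s *\<^sub>C s) has_sum x) S"
proof -
  have u: "orthonormal_on id S" using S by (simp add: hilbert_basis_def)
  have uD: "cinner s r = (if s = r then 1 else 0)" if "s \<in> S" "r \<in> S" for s r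
    using orthonormal_onD[OF u] that by simp
  have "(\<lambda>s. cinner x s *\<^sub>C s) summable_on S"
    by (rule fourier_summable[OF u, where x = x])
      (use norm_eq_1_if_orthonormal[OF u] uD in
        \<open>auto simp: norm_scaleC cinner_scaleC_left cinner_scaleC_right\<close>)
  then obtain v where v: "((\<lambda>s. cinner x s *\<^sub>C s) has_sum v) S" by (auto simp: summable_on_def)
  have "x - v = 0"
  proof -
    have "cinner (x - v) s = 0" if "s \<in> S" for s
    proof -
      have "((\<lambda>r. if r = s then cinner x s else 0) has_sum cinner v s) S"
        using has_sum_cinner_left[OF v, of s] that
        by (subst (asm) has_sum_cong[of S _ "\<lambda>r. if r = s then cinner x s else 0"])
          (auto simp: cinner_scaleC_left uD)
      then have "cinner v s = cinner x s" using has_sum_single[OF that] has_sum_unique by blast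
      then show ?thesis by (simp add: cinner.diff_left)
    qed
    then show ?thesis using S unfolding hilbert_basis_def by blast
  qed
  then show ?thesis using v by simp
qed

text \<open>The injection \<open>p\<close> of a basis into itself induces the isometry \<open>s \<mapsto> p s\<close>; two injections with
  disjoint ranges exist because an infinite set is equipotent with its double.\<close>

lemma orthogonal_isometries_exist:
  assumes infinite_dim: "\<not> (\<exists>B :: 'h::chilbert set. finite B \<and> cspan B = UNIV)"
  shows "\<exists>(V :: 'h \<Rightarrow>\<^sub>L 'h) (W :: 'h \<Rightarrow>\<^sub>L 'h). V \<in> cbounded \<and> W \<in> cbounded \<and>
    adj V o\<^sub>L V = id_blinfun \<and> adj W o\<^sub>L W = id_blinfun \<and> adj V o\<^sub>L W = 0 \<and> adj W o\<^sub>L V = 0"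
proof -
  obtain S :: "'h set" where S: "hilbert_basis S" using hilbert_basis_exists by blast
  have u: "orthonormal_on id S" using S by (simp add: hilbert_basis_def)
  have uD: "cinner s r = (if s = r then 1 else 0)" if "s \<in> S" "r \<in> S" for s r
    using orthonormal_onD[OF u] that by simp
  have inf: "infinite S"
  proof
    assume fin: "finite S"
    have "x \<in> cspan S" for x
    proof -
      have "x = (\<Sum>s\<in>S. cinner x s *\<^sub>C s)"
        using fourier_expansion[OF S, of x] fin has_sum_finite has_sum_unique by blast
      then show ?thesis
        by (metis (no_types, lifting) chilbert.span_base chilbert.span_scale chilbert.span_sum)
    qed
    then show False using fin infinite_dim by blast
  qed
  have "\<exists>h. bij_betw h (S <+> S) S"
    using card_of_Plus_infinite1[OF inf card_of_refl[THEN ordIso_iff_ordLeq[THEN iffD1], THEN conjunct1]]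
    by (simp add: card_of_ordIso)
  then obtain h where h: "inj_on h (S <+> S)" "h ` (S <+> S) = S" by (auto simp: bij_betw_def)
  define p where "p s = h (Inl s)" for s
  define q where "q s = h (Inr s)" for s
  have ran: "p s \<in> S" "q s \<in> S" if "s \<in> S" for s using h that by (auto simp: p_def q_def)
  have pq: "p s = p r \<longleftrightarrow> s = r" "q s = q r \<longleftrightarrow> s = r" "p s \<noteq> q r" "q s \<noteq> p r"
    if "s \<in> S" "r \<in> S" for s r
    using that inj_onD[OF h(1)] unfolding p_def q_def by blast+
  define V where "V f x = (\<Sum>\<^sub>\<infinity>s\<in>S. cinner x s *\<^sub>C f s)" for f :: "'h \<Rightarrow> 'h" and x
  have V: "((\<lambda>s. cinner x s *\<^sub>C f s) has_sum V f x) S" if "f = p \<or> f = q" for f x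
    unfolding V_def
    by (intro has_sum_infsum fourier_summable[OF u, where x = x])
      (use norm_eq_1_if_orthonormal[OF u] that ran in
        \<open>auto simp: norm_scaleC cinner_scaleC_left cinner_scaleC_right uD pq\<close>)
  have V_left: "((\<lambda>s. cinner x s * cinner (f s) w) has_sum cinner (V f x) w) S"
    if "f = p \<or> f = q" for f x w
    using has_sum_cinner_left[OF V[OF that, of x], of w] by (simp add: cinner_scaleC_left)
  have coeff_same: "cinner (V f y) (f s) = cinner y s" if "f = p \<or> f = q" "s \<in> S" for f y s
  proof -
    have "((\<lambda>r. if r = s then cinner y s else 0) has_sum cinner (V f y) (f s)) S"
      using V_left[OF that(1), of y "f s"] that
      by (subst (asm) has_sum_cong[of S _ "\<lambda>r. if r = s then cinner y s else 0"])
        (auto simp: uD ran pq)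
    then show ?thesis using has_sum_single[OF that(2)] has_sum_unique by blast
  qed
  have coeff_diff: "cinner (V f y) (g s) = 0"
    if "f = p \<and> g = q \<or> f = q \<and> g = p" "s \<in> S" for f g y s
  proof -
    have f: "f = p \<or> f = q" using that by blast
    have "((\<lambda>r. 0) has_sum cinner (V f y) (g s)) S"
      using V_left[OF f, of y "g s"] that
      by (subst (asm) has_sum_cong[of S _ "\<lambda>r. 0"]) (auto simp: uD ran pq)
    then show ?thesis by (metis has_sum_0_simp has_sum_unique)
  qed
  have same: "cinner (V f x) (V f y) = cinner x y" if f: "f = p \<or> f = q" for f x y
  proof -
    have "((\<lambda>s. cinner x s * cinner s y) has_sum cinner (V f x) (V f y)) S"
      using V_left[OF f, of x "V f y"] coeff_same[OF f]
      by (subst (asm) has_sum_cong[of S _ "\<lambda>s. cinner x s * cinner s y"]) (metis cinner_commute)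
    moreover have "((\<lambda>s. cinner x s * cinner s y) has_sum cinner x y) S"
      using has_sum_cinner_left[OF fourier_expansion[OF S, of x], of y]
      by (simp add: cinner_scaleC_left)
    ultimately show ?thesis using has_sum_unique by blast
  qed
  have diff: "cinner (V f x) (V g y) = 0" if fg: "f = p \<and> g = q \<or> f = q \<and> g = p" for f g x y
  proof -
    have "cinner (f s) (V g y) = 0" if "s \<in> S" for s
      using coeff_diff[of g f s y] fg that cinner_commute[of "f s" "V g y"] by auto
    moreover have f: "f = p \<or> f = q" using fg by blast
    ultimately have "((\<lambda>s. 0) has_sum cinner (V f x) (V g y)) S"
      using V_left[OF f, of x "V g y"] by (subst (asm) has_sum_cong[of S _ "\<lambda>s. 0"]) auto
    then show ?thesis by (metis has_sum_0_simp has_sum_unique)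
  qed
  have ex: "\<exists>T \<in> cbounded. \<forall>x. blinfun_apply T x = V f x" if f: "f = p \<or> f = q" for f
  proof -
    have add: "V f (x + y) = V f x + V f y" for x y
      by (rule has_sum_unique[OF V[OF f]])
        (use has_sum_add[OF V[OF f, of x] V[OF f, of y]] in \<open>simp add: cinner_add_left scaleC_add_left\<close>)
    have scale: "V f (c *\<^sub>C x) = c *\<^sub>C V f x" for c x
      by (rule has_sum_unique[OF V[OF f]])
        (use has_sum_bounded_linear[OF bounded_linear_scaleC V[OF f, of x], of c] in
          \<open>simp add: cinner_scaleC_left scaleC_scaleC\<close>)
    have norm: "norm (V f x) = norm x" for x
    proof -
      have "(norm (V f x))\<^sup>2 = (norm x)\<^sup>2" by (simp add: norm_sq_eq_cinner same[OF f])
      then show ?thesis by (simp add: power2_eq_iff_nonneg)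
    qed
    have "bounded_linear (V f)"
      by (rule bounded_linear_intro[where K = 1]) (auto simp: add norm scale simp flip: scaleC_of_real)
    then have "blinfun_apply (Blinfun (V f)) = V f" by (rule bounded_linear_Blinfun_apply)
    then show ?thesis by (intro bexI[of _ "Blinfun (V f)"] cboundedI) (auto simp: scale)
  qed
  obtain T1 T2 where T: "T1 \<in> cbounded" "T2 \<in> cbounded"
    and T1: "\<And>x. blinfun_apply T1 x = V p x" and T2: "\<And>x. blinfun_apply T2 x = V q x"
    using ex[of p] ex[of q] by blast
  have "adj T1 o\<^sub>L T1 = id_blinfun" "adj T2 o\<^sub>L T2 = id_blinfun"
    "adj T1 o\<^sub>L T2 = 0" "adj T2 o\<^sub>L T1 = 0"
    by (intro blinfun_eqI cinner_ext_right;
        simp add: cinner_adj_right T T1 T2 same diff zero_blinfun.rep_eq cinner.zero_right)+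
  then show ?thesis using T by (intro exI[of _ T1] exI[of _ T2]) simp
qed

section \<open>Operators on a tensor product\<close>

lemma norm_has_sum_le:
  fixes f :: "'i \<Rightarrow> 'a::real_normed_vector"
  assumes sum: "(f has_sum v) A" and le: "\<And>F. finite F \<Longrightarrow> F \<subseteq> A \<Longrightarrow> norm (sum f F) \<le> c"
  shows "norm v \<le> c"
proof (rule tendsto_upperbound[OF tendsto_norm[OF sum[unfolded has_sum_def]]])
  show "\<forall>\<^sub>F F in finite_subsets_at_top A. norm (sum f F) \<le> c"
    by (rule eventually_finite_subsets_at_top_weakI) (rule le)
qed simp

locale tensor_product =
  fixes t :: "'h::chilbert \<Rightarrow> 'e::chilbert \<Rightarrow> 'k::chilbert"
  assumes tensor: "hilbert_tensor t"
begin

lemma tensor_add_left: "t (x + x') y = t x y + t x' y"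
  and tensor_scaleC_left: "t (c *\<^sub>C x) y = c *\<^sub>C t x y"
  and tensor_scaleC_right: "t x (c *\<^sub>C y) = c *\<^sub>C t x y"
  and cinner_tensor: "cinner (t x y) (t x' y') = cinner x x' * cinner y y'"
  and tensor_dense: "closure (cspan {t x y | x y. True}) = UNIV"
  using tensor unfolding hilbert_tensor_def by blast+

lemma tensor_scaleR_left: "t (r *\<^sub>R x) y = r *\<^sub>R t x y"
  by (metis tensor_scaleC_left scaleC_of_real)

lemma norm_tensor: "norm (t x y) = norm x * norm y"
proof -
  have "cinner (t x y) (t x y) = complex_of_real ((norm x * norm y)\<^sup>2)"
    by (simp add: cinner_tensor cinner_self[of x] cinner_self[of y] power_mult_distrib)
  then have "(norm (t x y))\<^sup>2 = (norm x * norm y)\<^sup>2"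
    using norm_sq_eq_cinner[of "t x y"] by (simp only: Re_complex_of_real)
  then show ?thesis by (simp add: power2_eq_iff_nonneg)
qed

text \<open>Exchanging the two factors turns results about the first factor into results about the
  second.\<close>

lemma tensor_product_flip: "tensor_product (\<lambda>y x. t x y)"
proof
  have "{t x y | y x. True} = {t x y | x y. True}" by blast
  then show "hilbert_tensor (\<lambda>y x. t x y)"
    using tensor unfolding hilbert_tensor_def by (simp add: mult.commute)
qed

lemma op_eqI_tensor:
  assumes U: "U \<in> cbounded" and U': "U' \<in> cbounded"
    and eq: "\<And>x y. blinfun_apply U (t x y) = blinfun_apply U' (t x y)"
  shows "U = (U' :: 'k \<Rightarrow>\<^sub>L 'a::chilbert)"
proof (rule blinfun_eqI)
  fix v
  let ?E = "{v. blinfun_apply U v = blinfun_apply U' v}"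
  have "cspan {t x y | x y. True} \<subseteq> ?E"
    by (rule chilbert.span_minimal)
      (auto simp: eq chilbert.subspace_def blinfun.zero_right blinfun.add_right cboundedD[OF U] cboundedD[OF U'])
  moreover have "closed ?E"
    by (intro closed_Collect_eq blinfun.continuous_on continuous_on_id continuous_on_const)
  ultimately have "closure (cspan {t x y | x y. True}) \<subseteq> ?E" by (rule closure_minimal)
  then show "U v = U' v" using tensor_dense by blast
qed

definition slice :: "'e \<Rightarrow> ('h \<Rightarrow>\<^sub>L 'k)" where "slice y = Blinfun (\<lambda>x. t x y)"

lemma slice_apply: "blinfun_apply (slice y) x = t x y"
proof -
  have "bounded_linear (\<lambda>x. t x y)"
    by (rule bounded_linear_intro[where K = "norm y"])
      (simp_all add: tensor_add_left tensor_scaleR_left norm_tensor)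
  then show ?thesis by (simp add: slice_def bounded_linear_Blinfun_apply)
qed

lemma cbounded_slice: "slice y \<in> cbounded"
  by (rule cboundedI) (simp add: slice_apply tensor_scaleC_left)

lemma adj_slice_tensor: "blinfun_apply (adj (slice y)) (t x y') = cinner y' y *\<^sub>C x"
  by (rule cinner_ext_right)
    (metis cinner_adj_right[OF cbounded_slice] slice_apply cinner_tensor cinner_scaleC_right
      cinner_commute mult.commute)

text \<open>The slices along an orthonormal set are isometries with mutually orthogonal ranges, and \<open>p\<close> is
  the projection of \<open>w\<close> onto the span of finitely many of these ranges.\<close>

lemma slice_bessel:
  assumes S: "orthonormal_on id S" and F: "finite F" "F \<subseteq> S"
  shows "(\<Sum>s\<in>F. (norm (blinfun_apply (adj (slice s)) w))\<^sup>2) \<le> (norm w)\<^sup>2"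
proof -
  define c where "c s = adj (slice s) w" for s
  define p where "p = (\<Sum>s\<in>F. t (c s) s)"
  have sF: "cinner s r = (if s = r then 1 else 0)" if "s \<in> F" "r \<in> F" for s r
    using orthonormal_onD[OF S subsetD[OF F(2)] subsetD[OF F(2)]] that by simp
  have ns: "norm s = 1" if "s \<in> F" for s
    using norm_eq_1_if_orthonormal[OF S] F that by auto
  have "cinner (t (c s) s) w = cinner (c s) (c s)" for s
    unfolding c_def by (metis slice_apply cinner_adj_right[OF cbounded_slice])
  then have "cinner p w = (\<Sum>s\<in>F. cinner (c s) (c s))"
    by (simp add: p_def cinner.sum_left)
  then have pw: "Re (cinner w p) = (\<Sum>s\<in>F. (norm (c s))\<^sup>2)"
    by (simp add: Re_cinner_commute[of w] norm_sq_eq_cinner)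
  have "(norm p)\<^sup>2 = (\<Sum>s\<in>F. (norm (t (c s) s))\<^sup>2)"
    unfolding p_def by (rule norm_sq_sum_if_orthogonal[OF F(1)]) (simp add: cinner_tensor sF)
  also have "\<dots> = (\<Sum>s\<in>F. (norm (c s))\<^sup>2)" by (intro sum.cong) (simp_all add: norm_tensor ns)
  finally have "(norm (w + (- p)))\<^sup>2 = (norm w)\<^sup>2 - (\<Sum>s\<in>F. (norm (c s))\<^sup>2)"
    unfolding norm_sq_add by (simp add: cinner.minus_right pw)
  then show ?thesis using zero_le_power2[of "norm (w + (- p))"] unfolding c_def by linarith
qed

text \<open>In terms of a Hilbert basis \<open>B\<close> of the second factor, \<open>S \<otimes> I\<close> acts as \<open>S\<close> on each of the
  mutually orthogonal slices \<open>t _ s\<close> with \<open>s \<in> B\<close>.\<close>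

lemma amplification_exists:
  assumes S: "S \<in> cbounded"
  shows "\<exists>U \<in> cbounded. \<forall>x y. blinfun_apply U (t x y) = t (blinfun_apply S x) y"
proof -
  obtain B :: "'e set" where B: "hilbert_basis B" using hilbert_basis_exists by blast
  have u: "orthonormal_on id B" using B by (simp add: hilbert_basis_def)
  have uD: "cinner s r = (if s = r then 1 else 0)" if "s \<in> B" "r \<in> B" for s r
    using orthonormal_onD[OF u] that by simp
  define f where "f w s = t (S (adj (slice s) w)) s" for w s
  define U where "U w = (\<Sum>\<^sub>\<infinity>s\<in>B. f w s)" for w
  have fin: "(norm (sum (f w) F))\<^sup>2 \<le> (norm S)\<^sup>2 * (\<Sum>s\<in>F. (norm (adj (slice s) w))\<^sup>2)"
    if F: "finite F" "F \<subseteq> B" for F w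
  proof -
    have "(norm (sum (f w) F))\<^sup>2 = (\<Sum>s\<in>F. (norm (f w s))\<^sup>2)"
      by (rule norm_sq_sum_if_orthogonal[OF F(1)]) (simp add: f_def cinner_tensor uD subsetD[OF F(2)])
    also have "\<dots> \<le> (\<Sum>s\<in>F. (norm S)\<^sup>2 * (norm (adj (slice s) w))\<^sup>2)"
    proof (rule sum_mono)
      fix s assume "s \<in> F"
      then have "norm s = 1" using norm_eq_1_if_orthonormal[OF u, of s] F by auto
      then have "norm (f w s) \<le> norm S * norm (adj (slice s) w)"
        by (simp add: f_def norm_tensor norm_blinfun)
      then show "(norm (f w s))\<^sup>2 \<le> (norm S)\<^sup>2 * (norm (adj (slice s) w))\<^sup>2"
        by (metis norm_ge_zero power_mono power_mult_distrib)
    qed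
    finally show ?thesis by (simp add: sum_distrib_left)
  qed
  have summ: "(\<lambda>s. (norm (adj (slice s) w))\<^sup>2) summable_on B" for w
    using slice_bessel[OF u] by (intro nonneg_bdd_above_summable_on bdd_aboveI) auto
  have U: "(f w has_sum U w) B" for w
    unfolding U_def by (rule has_sum_infsum, rule summable_on_if_square_bound[OF summ _ fin]) auto
  have add: "U (v + w) = U v + U w" for v w
    by (rule has_sum_unique[OF U])
      (use has_sum_add[OF U[of v] U[of w]] in \<open>simp add: f_def[abs_def] blinfun.add_right tensor_add_left\<close>)
  have scale: "U (c *\<^sub>C w) = c *\<^sub>C U w" for c w
    by (rule has_sum_unique[OF U])
      (use has_sum_bounded_linear[OF bounded_linear_scaleC U[of w], of c] in
        \<open>simp add: f_def[abs_def] cboundedD[OF S] cboundedD[OF cbounded_adj[OF cbounded_slice]]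
          tensor_scaleC_left\<close>)
  have norm: "norm (U w) \<le> norm w * norm S" for w
  proof -
    have "norm (sum (f w) F) \<le> norm w * norm S" if F: "finite F" "F \<subseteq> B" for F
    proof -
      have "(norm (sum (f w) F))\<^sup>2 \<le> (norm S)\<^sup>2 * (norm w)\<^sup>2"
        using fin[OF F, of w] mult_left_mono[OF slice_bessel[OF u F, of w], of "(norm S)\<^sup>2"]
        by simp
      also have "\<dots> = (norm w * norm S)\<^sup>2" by (simp add: power_mult_distrib)
      finally show ?thesis by (rule power2_le_imp_le) simp
    qed
    then show ?thesis by (rule norm_has_sum_le[OF U])
  qed
  have "U (r *\<^sub>R w) = r *\<^sub>R U w" for r w
    using scale[of "complex_of_real r" w] by (simp only: scaleC_of_real)
  then have "bounded_linear U" by (intro bounded_linear_intro[where K = "norm S"] add norm)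
  then have app: "blinfun_apply (Blinfun U) = U" by (rule bounded_linear_Blinfun_apply)
  have "U (t x y) = t (S x) y" for x y
  proof (rule has_sum_unique[OF U])
    have "((\<lambda>s. tensor_product.slice (\<lambda>y x. t x y) (S x) (cinner y s *\<^sub>C s)) has_sum
        tensor_product.slice (\<lambda>y x. t x y) (S x) y) B"
      by (rule has_sum_blinfun[OF fourier_expansion[OF B]])
    then show "(f (t x y) has_sum t (S x) y) B"
      by (simp add: tensor_product.slice_apply[OF tensor_product_flip] f_def[abs_def]
          adj_slice_tensor cboundedD[OF S] tensor_scaleC_left tensor_scaleC_right)
  qed
  then show ?thesis
    by (intro bexI[of _ "Blinfun U"] cboundedI) (auto simp: app scale)
qed

lemma op_tensor_exists:
  assumes S: "S \<in> cbounded" and T: "T \<in> cbounded"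
  shows "\<exists>U \<in> cbounded. \<forall>x y. blinfun_apply U (t x y) = t (blinfun_apply S x) (blinfun_apply T y)"
proof -
  obtain U1 where U1: "U1 \<in> cbounded" "\<And>x y. blinfun_apply U1 (t x y) = t (S x) y"
    using amplification_exists[OF S] by blast
  obtain U2 where U2: "U2 \<in> cbounded" "\<And>x y. blinfun_apply U2 (t x y) = t x (T y)"
    using tensor_product.amplification_exists[OF tensor_product_flip T] by blast
  show ?thesis using U1 U2 by (intro bexI[of _ "U1 o\<^sub>L U2"] cbounded_comp) auto
qed

lemma op_tensor_eqI:
  assumes U: "U \<in> cbounded"
    and eq: "\<And>x y. blinfun_apply U (t x y) = t (blinfun_apply S x) (blinfun_apply T y)"
  shows "op_tensor t S T = U"
  unfolding op_tensor_def
  by (rule the_equality) (use assms op_eqI_tensor in \<open>auto intro: op_eqI_tensor\<close>)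

lemma op_tensor_cbounded_apply:
  assumes "S \<in> cbounded" "T \<in> cbounded"
  shows cbounded_op_tensor: "op_tensor t S T \<in> cbounded"
    and op_tensor_apply: "blinfun_apply (op_tensor t S T) (t x y) = t (blinfun_apply S x) (blinfun_apply T y)"
  using op_tensor_exists[OF assms] op_tensor_eqI by metis+

lemma op_tensor_comp:
  assumes "S \<in> cbounded" "T \<in> cbounded" "S' \<in> cbounded" "T' \<in> cbounded"
  shows "op_tensor t S T o\<^sub>L op_tensor t S' T' = op_tensor t (S o\<^sub>L S') (T o\<^sub>L T')"
  by (rule op_tensor_eqI[symmetric])
    (simp_all add: assms cbounded_comp cbounded_op_tensor op_tensor_apply)

lemma op_tensor_id: "op_tensor t id_blinfun id_blinfun = id_blinfun"
  by (rule op_tensor_eqI) (simp_all add: cbounded_id)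

lemma op_tensor_add_left:
  assumes "S \<in> cbounded" "S' \<in> cbounded" "T \<in> cbounded"
  shows "op_tensor t (S + S') T = op_tensor t S T + op_tensor t S' T"
  by (rule op_tensor_eqI)
    (simp_all add: assms cbounded_add cbounded_op_tensor op_tensor_apply blinfun.add_left tensor_add_left)

lemma op_tensor_scaleR_left:
  assumes "S \<in> cbounded" "T \<in> cbounded"
  shows "op_tensor t (r *\<^sub>R S) T = r *\<^sub>R op_tensor t S T"
  by (rule op_tensor_eqI)
    (simp_all add: assms cbounded_scaleR cbounded_op_tensor op_tensor_apply blinfun.scaleR_left
      tensor_scaleR_left)

lemma vec_eqI_tensor:
  assumes eq: "\<And>x y. cinner (t x y) v = cinner (t x y) w"
  shows "v = w"
proof (rule cinner_ext_right)
  fix u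
  let ?E = "{u. cinner u v = cinner u w}"
  have "cspan {t x y | x y. True} \<subseteq> ?E"
    by (rule chilbert.span_minimal)
      (auto simp: eq chilbert.subspace_def cinner_add_left cinner_scaleC_left)
  moreover have "closed ?E"
    by (intro closed_Collect_eq cinner.continuous_on continuous_on_id continuous_on_const)
  ultimately have "closure (cspan {t x y | x y. True}) \<subseteq> ?E" by (rule closure_minimal)
  then show "cinner u v = cinner u w" using tensor_dense by blast
qed

lemma adj_op_tensor:
  assumes S: "S \<in> cbounded" and T: "T \<in> cbounded"
  shows "adj (op_tensor t S T) = op_tensor t (adj S) (adj T)"
proof (rule op_tensor_eqI[symmetric])
  show "adj (op_tensor t S T) \<in> cbounded"
    by (intro cbounded_adj cbounded_op_tensor S T)
  show "adj (op_tensor t S T) (t x y) = t (adj S x) (adj T y)" for x y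
    by (rule vec_eqI_tensor)
      (simp add: cinner_adj_right cbounded_op_tensor S T op_tensor_apply cinner_tensor)
qed

end

section \<open>Strongly convergent sums and the row ball\<close>

lemma has_sot_sumD: "has_sot_sum f T I \<Longrightarrow> ((\<lambda>i. blinfun_apply (f i) x) has_sum blinfun_apply T x) I"
  by (simp add: has_sot_sum_def)

lemma sot_sum_eqI: "has_sot_sum f T I \<Longrightarrow> sot_sum f I = T"
  unfolding sot_sum_def
  by (rule the_equality) (auto simp: has_sot_sum_def intro!: blinfun_eqI intro: has_sum_unique)

lemma has_sot_sum_sot_sum: "sot_summable f I \<Longrightarrow> has_sot_sum f (sot_sum f I) I"
  unfolding sot_summable_def using sot_sum_eqI by blast

lemma cbounded_if_has_sot_sum:
  assumes "has_sot_sum f T I" "\<And>i. i \<in> I \<Longrightarrow> f i \<in> cbounded"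
  shows "T \<in> cbounded"
proof (rule cboundedI)
  fix c x
  have "((\<lambda>i. c *\<^sub>C f i x) has_sum c *\<^sub>C T x) I"
    by (rule has_sum_bounded_linear[OF bounded_linear_scaleC has_sot_sumD[OF assms(1)]])
  moreover have "((\<lambda>i. f i (c *\<^sub>C x)) has_sum T (c *\<^sub>C x)) I"
    by (rule has_sot_sumD[OF assms(1)])
  then have "((\<lambda>i. c *\<^sub>C f i x) has_sum T (c *\<^sub>C x)) I"
    by (subst (asm) has_sum_cong[of I _ "\<lambda>i. c *\<^sub>C f i x"]) (simp_all add: assms cboundedD)
  ultimately show "T (c *\<^sub>C x) = c *\<^sub>C T x" using has_sum_unique by blast
qed

text \<open>A positive quadratic form bounded by \<open>q < 1\<close> is what makes a row a strict contraction.\<close>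

lemma row_ballI:
  assumes cb: "\<And>i. X i \<in> cbounded" and N: "has_sot_sum (\<lambda>i. X i o\<^sub>L adj (X i)) N UNIV"
    and q: "0 < q" "q < 1" and le: "\<And>x. Re (cinner (blinfun_apply N x) x) \<le> q * (norm x)\<^sup>2"
  shows "X \<in> row_ball"
proof -
  have Ncb: "N \<in> cbounded" by (rule cbounded_if_has_sot_sum[OF N]) (intro cbounded_intros cb)
  have sum: "((\<lambda>i. complex_of_real ((norm (adj (X i) x))\<^sup>2)) has_sum cinner (N x) x) UNIV" for x
    using has_sum_cinner_left[OF has_sot_sumD[OF N], of x x]
    by (simp add: cinner_self[symmetric] cinner_adj_right[OF cb] del: of_real_power)
  have "cinner (N x) x \<in> \<real>\<^sub>\<ge>\<^sub>0" for x
  proof -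
    have "((\<lambda>i. (norm (adj (X i) x))\<^sup>2) has_sum Re (cinner (N x) x)) UNIV"
      using has_sum_Re[OF sum[of x]] by simp
    then have "0 \<le> Re (cinner (N x) x)" by (rule has_sum_nonneg) simp
    moreover have "Im (cinner (N x) x) = 0"
      using has_sum_Im[OF sum[of x]] by (simp add: has_sum_0_simp has_sum_unique)
    ultimately show ?thesis by (simp add: complex_nonneg_Reals_iff)
  qed
  then have "op_pos N" using Ncb by (simp add: op_pos_def)
  then have "norm N \<le> q" using q le by (intro norm_pos_le)
  then have "sqrt (norm N) < 1" using q by simp
  then show ?thesis
    using cb N sot_sum_eqI[OF N] by (auto simp: row_ball_def row_gram_def sot_summable_def)
qed

lemma row_ballD:
  assumes X: "X \<in> row_ball"
  shows "X i \<in> cbounded" "has_sot_sum (\<lambda>i. X i o\<^sub>L adj (X i)) (row_gram X) UNIV"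
    "norm (row_gram X) < 1" "row_gram X \<in> cbounded" "adj (row_gram X) = row_gram X"
    "((\<lambda>i. (norm (blinfun_apply (adj (X i)) x))\<^sup>2) has_sum
        Re (cinner (blinfun_apply (row_gram X) x) x)) UNIV"
proof -
  show cb: "X i \<in> cbounded" for i using X by (simp add: row_ball_def)
  show sot: "has_sot_sum (\<lambda>i. X i o\<^sub>L adj (X i)) (row_gram X) UNIV"
    using X unfolding row_gram_def row_ball_def by (auto intro: has_sot_sum_sot_sum)
  show "norm (row_gram X) < 1" using X by (simp add: row_ball_def)
  show gcb: "row_gram X \<in> cbounded"
    by (rule cbounded_if_has_sot_sum[OF sot]) (intro cbounded_intros cb)
  have sum: "((\<lambda>i. complex_of_real ((norm (adj (X i) x))\<^sup>2)) has_sum cinner (row_gram X x) x) UNIV" for x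
    using has_sum_cinner_left[OF has_sot_sumD[OF sot], of x x]
    by (simp add: cinner_self[symmetric] cinner_adj_right[OF cb] del: of_real_power)
  show "((\<lambda>i. (norm (adj (X i) x))\<^sup>2) has_sum Re (cinner (row_gram X x) x)) UNIV"
    using has_sum_Re[OF sum[of x]] by simp
  have "Im (cinner (row_gram X x) x) = 0" for x
    using has_sum_Im[OF sum[of x]] by (simp add: has_sum_0_simp has_sum_unique)
  then show "adj (row_gram X) = row_gram X"
    by (intro adj_eq_if_form_real gcb) (simp add: complex_is_Real_iff)
qed

lemma euclid_ballD:
  assumes z: "z \<in> euclid_ball"
  shows "((\<lambda>i. (cmod (z i))\<^sup>2) has_sum (norm2 z)\<^sup>2) UNIV" "0 \<le> norm2 z" "norm2 z < 1" "(norm2 z)\<^sup>2 < 1"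
proof -
  have "0 \<le> (\<Sum>\<^sub>\<infinity>i. (cmod (z i))\<^sup>2)" by (rule infsum_nonneg) simp
  then show "((\<lambda>i. (cmod (z i))\<^sup>2) has_sum (norm2 z)\<^sup>2) UNIV" "0 \<le> norm2 z"
    using z by (simp_all add: norm2_def euclid_ball_def)
  then show "norm2 z < 1" "(norm2 z)\<^sup>2 < 1"
    using z by (simp_all add: euclid_ball_def power_less_one_iff abs_square_less_1)
qed

text \<open>Cauchy-Schwarz for the row \<open>X\<close>, after moving each \<open>X i\<close> to the other side of the inner
  product, where \<open>\<Sum> norm (X i\<^sup>* y) ^ 2\<close> is controlled by \<open>X X\<^sup>*\<close>.\<close>

lemma norm_row_times_adj_finite:
  assumes X: "X \<in> row_ball" and F: "finite F"
  shows "(norm (\<Sum>i\<in>F. scaleC_op (cnj (z i)) (X i)))\<^sup>2 \<le> norm (row_gram X) * (\<Sum>i\<in>F. (cmod (z i))\<^sup>2)"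
proof -
  define m where "m = sqrt (norm (row_gram X) * (\<Sum>i\<in>F. (cmod (z i))\<^sup>2))"
  have m: "0 \<le> m" by (simp add: m_def sum_nonneg)
  have "norm (\<Sum>i\<in>F. scaleC_op (cnj (z i)) (X i)) \<le> m"
  proof (rule norm_blinfun_bound[OF m])
    fix x
    define y where "y = (\<Sum>i\<in>F. scaleC_op (cnj (z i)) (X i)) x"
    have y_sum: "y = (\<Sum>i\<in>F. cnj (z i) *\<^sub>C X i x)"
      by (simp add: y_def blinfun.sum_left scaleC_op.rep_eq)
    have "(norm y)\<^sup>2 = cmod (cinner y y)" by (simp add: cinner_self norm_power)
    also have "cinner y y = (\<Sum>i\<in>F. cnj (z i) * cinner x (adj (X i) y))"
      by (subst (1) y_sum)
        (simp add: cinner.sum_left cinner_scaleC_left cinner_adj_right[OF row_ballD(1)[OF X]])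
    also have "cmod \<dots> \<le> (\<Sum>i\<in>F. cmod (z i) * (norm x * norm (adj (X i) y)))"
      by (rule sum_norm_le) (simp add: norm_mult norm_cinner_le mult_left_mono)
    also have "\<dots> = norm x * (\<Sum>i\<in>F. \<bar>cmod (z i)\<bar> * \<bar>norm (adj (X i) y)\<bar>)"
      by (simp add: sum_distrib_left ac_simps)
    also have "\<dots> \<le> norm x * (L2_set (\<lambda>i. cmod (z i)) F * L2_set (\<lambda>i. norm (adj (X i) y)) F)"
      by (intro mult_left_mono L2_set_mult_ineq) simp
    also have "L2_set (\<lambda>i. norm (adj (X i) y)) F \<le> sqrt (norm (row_gram X) * (norm y)\<^sup>2)"
      unfolding L2_set_def
    proof (rule real_sqrt_le_mono)
      have "(\<Sum>i\<in>F. (norm (adj (X i) y))\<^sup>2) \<le> Re (cinner (row_gram X y) y)"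
        by (rule finite_sum_le_has_sum[OF row_ballD(6)[OF X]]) (use F in auto)
      also have "\<dots> \<le> norm (row_gram X) * (norm y)\<^sup>2" by (rule form_le_norm)
      finally show "(\<Sum>i\<in>F. (norm (adj (X i) y))\<^sup>2) \<le> norm (row_gram X) * (norm y)\<^sup>2" .
    qed
    then have "norm x * (L2_set (\<lambda>i. cmod (z i)) F * L2_set (\<lambda>i. norm (adj (X i) y)) F)
        \<le> norm x * (L2_set (\<lambda>i. cmod (z i)) F * sqrt (norm (row_gram X) * (norm y)\<^sup>2))"
      by (intro mult_left_mono) (auto simp: L2_set_nonneg)
    also have "\<dots> = norm x * m * norm y"
      by (simp add: m_def L2_set_def real_sqrt_mult)
    finally have le: "norm y * norm y \<le> (norm x * m) * norm y" by (simp add: power2_eq_square)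
    show "norm ((\<Sum>i\<in>F. scaleC_op (cnj (z i)) (X i)) x) \<le> m * norm x"
    proof (cases "y = 0")
      case False
      then have "norm y \<le> norm x * m" using le by simp
      then show ?thesis by (simp add: y_def mult.commute)
    qed (use m in \<open>simp add: y_def\<close>)
  qed
  then have "(norm (\<Sum>i\<in>F. scaleC_op (cnj (z i)) (X i)))\<^sup>2 \<le> m\<^sup>2" by (intro power_mono) auto
  then show ?thesis by (simp add: m_def sum_nonneg)
qed

lemma row_times_adj_props:
  assumes X: "X \<in> row_ball" and z: "z \<in> euclid_ball"
  shows has_sum_row_times_adj:
      "((\<lambda>i. scaleC_op (cnj (z i)) (X i)) has_sum row_times_adj X z) UNIV"
    and norm_row_times_adj: "norm (row_times_adj X z) < 1"
    and cbounded_row_times_adj: "row_times_adj X z \<in> cbounded"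
proof -
  show sum: "((\<lambda>i. scaleC_op (cnj (z i)) (X i)) has_sum row_times_adj X z) UNIV"
    unfolding row_times_adj_def
    by (rule has_sum_infsum,
        rule summable_on_if_square_bound[OF _ _ norm_row_times_adj_finite[OF X, of _ z]])
      (use z in \<open>auto simp: euclid_ball_def\<close>)
  have "norm (\<Sum>i\<in>F. scaleC_op (cnj (z i)) (X i)) \<le> norm2 z" if F: "finite F" for F
  proof (rule power2_le_imp_le[OF _ euclid_ballD(2)[OF z]])
    have "(norm (\<Sum>i\<in>F. scaleC_op (cnj (z i)) (X i)))\<^sup>2
        \<le> norm (row_gram X) * (\<Sum>i\<in>F. (cmod (z i))\<^sup>2)"
      by (rule norm_row_times_adj_finite[OF X F])
    also have "\<dots> \<le> 1 * (norm2 z)\<^sup>2"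
      using row_ballD(3)[OF X] F
      by (intro mult_mono finite_sum_le_has_sum[OF euclid_ballD(1)[OF z]]) (auto simp: sum_nonneg)
    finally show "(norm (\<Sum>i\<in>F. scaleC_op (cnj (z i)) (X i)))\<^sup>2 \<le> (norm2 z)\<^sup>2" by simp
  qed
  then have "norm (row_times_adj X z) \<le> norm2 z" by (rule norm_has_sum_le[OF sum])
  then show "norm (row_times_adj X z) < 1" using euclid_ballD(3)[OF z] by linarith
  have "has_sot_sum (\<lambda>i. scaleC_op (cnj (z i)) (X i)) (row_times_adj X z) UNIV"
    unfolding has_sot_sum_def
    by (intro allI has_sum_bounded_linear[OF blinfun.bounded_linear_left sum])
  then show "row_times_adj X z \<in> cbounded"
    by (rule cbounded_if_has_sot_sum) (intro cbounded_intros row_ballD[OF X])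
qed

lemma adj_sum: "(\<And>i. i \<in> F \<Longrightarrow> f i \<in> cbounded) \<Longrightarrow> sum f F \<in> cbounded \<and> adj (sum f F) = (\<Sum>i\<in>F. adj (f i))"
proof (induction F rule: infinite_finite_induct)
  case (insert i F)
  then show ?case by (simp add: adj_add cbounded_add)
qed (auto simp: cbounded_zero adj_unique cinner.zero_right)

text \<open>\<open>adj\<close> is not a linear map on the whole type, only additive and contractive on complex-linear
  operators; this suffices to compare the distances of the partial sums from the limits.\<close>

lemma has_sum_adj:
  assumes sum: "(f has_sum T) I" and cb: "\<And>i. i \<in> I \<Longrightarrow> f i \<in> cbounded" and T: "T \<in> cbounded"
  shows "((\<lambda>i. adj (f i)) has_sum adj T) I"
  unfolding has_sum_def
proof (rule metric_tendsto_imp_tendsto[OF sum[unfolded has_sum_def]])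
  show "\<forall>\<^sub>F F in finite_subsets_at_top I. dist (\<Sum>i\<in>F. adj (f i)) (adj T) \<le> dist (sum f F) T"
  proof (rule eventually_finite_subsets_at_top_weakI)
    fix F assume "finite F" "F \<subseteq> I"
    then have F: "sum f F \<in> cbounded" "adj (sum f F) = (\<Sum>i\<in>F. adj (f i))"
      using adj_sum[of F f] cb by blast+
    then have "(\<Sum>i\<in>F. adj (f i)) - adj T = adj (sum f F - T)" by (simp add: adj_diff T)
    then show "dist (\<Sum>i\<in>F. adj (f i)) (adj T) \<le> dist (sum f F) T"
      by (simp add: dist_norm norm_adj_le cbounded_diff F T)
  qed
qed

lemma scalar_times_adj_eq:
  assumes X: "X \<in> row_ball" and z: "z \<in> euclid_ball"
  shows "scalar_times_adj z X = adj (row_times_adj X z)"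
    and "((\<lambda>i. scaleC_op (z i) (adj (X i))) has_sum adj (row_times_adj X z)) UNIV"
proof -
  show *: "((\<lambda>i. scaleC_op (z i) (adj (X i))) has_sum adj (row_times_adj X z)) UNIV"
    using has_sum_adj[OF has_sum_row_times_adj[OF X z] _ cbounded_row_times_adj[OF X z]]
    by (simp add: cbounded_scaleC_op adj_scaleC_op row_ballD(1)[OF X])
  then show "scalar_times_adj z X = adj (row_times_adj X z)"
    unfolding scalar_times_adj_def by (rule infsumI)
qed

lemma id_minus_invertible:
  assumes "norm (T :: 'a::chilbert \<Rightarrow>\<^sub>L 'a) < 1" shows "op_invertible (id_blinfun - T)"
proof (rule coercive_invertible)
  have "(1 - norm T) * (norm x)\<^sup>2 \<le> Re (cinner ((id_blinfun - T) x) x)" for x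
    using form_le_norm[of T x]
    by (simp add: blinfun.diff_left cinner.diff_left norm_sq_eq_cinner[symmetric] algebra_simps)
  then show "coercive (id_blinfun - T)" unfolding coercive_def using assms by (metis diff_gt_0_iff_gt)
qed

definition scalar_row :: "('n::countable \<Rightarrow> complex) \<Rightarrow> 'n \<Rightarrow> ('h::chilbert \<Rightarrow>\<^sub>L 'h)" where
  "scalar_row z = (\<lambda>i. scaleC_op (z i) id_blinfun)"

lemma scalar_row_in_row_ball:
  assumes z: "z \<in> euclid_ball"
  shows "(scalar_row z :: 'n::countable \<Rightarrow> ('h::chilbert \<Rightarrow>\<^sub>L 'h)) \<in> row_ball"
proof (rule row_ballI[where N = "(norm2 z)\<^sup>2 *\<^sub>R id_blinfun" and q = "(1 + (norm2 z)\<^sup>2) / 2"])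
  show "scalar_row z i \<in> cbounded" for i
    unfolding scalar_row_def by (intro cbounded_intros)
  show "has_sot_sum (\<lambda>i. (scalar_row z i :: 'h \<Rightarrow>\<^sub>L 'h) o\<^sub>L adj (scalar_row z i))
      ((norm2 z)\<^sup>2 *\<^sub>R id_blinfun) UNIV"
    unfolding has_sot_sum_def
  proof
    fix x :: 'h
    have "((\<lambda>i. (cmod (z i))\<^sup>2 *\<^sub>R x) has_sum (norm2 z)\<^sup>2 *\<^sub>R x) UNIV"
      by (rule has_sum_bounded_linear[OF bounded_linear_scaleR_left euclid_ballD(1)[OF z]])
    moreover have "(scalar_row z i o\<^sub>L adj (scalar_row z i)) x = (cmod (z i))\<^sup>2 *\<^sub>R x" for i
      by (simp add: scalar_row_def adj_scaleC_op cbounded_id adj_id scaleC_op.rep_eq scaleC_scaleC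
          complex_norm_square[symmetric] scaleC_of_real del: of_real_power)
    ultimately show "((\<lambda>i. (scalar_row z i o\<^sub>L adj (scalar_row z i)) x) has_sum
        ((norm2 z)\<^sup>2 *\<^sub>R id_blinfun) x) UNIV"
      by (simp add: blinfun.scaleR_left)
  qed
  show "Re (cinner (((norm2 z)\<^sup>2 *\<^sub>R id_blinfun) x) x) \<le> (1 + (norm2 z)\<^sup>2) / 2 * (norm x)\<^sup>2"
    for x :: 'h
    using mult_right_mono[of "(norm2 z)\<^sup>2" "(1 + (norm2 z)\<^sup>2) / 2" "(norm x)\<^sup>2"]
      euclid_ballD(4)[OF z]
    by (simp add: blinfun.scaleR_left cinner_scaleR_left norm_sq_eq_cinner[symmetric])
qed (use euclid_ballD(4)[OF z] in \<open>auto simp: add_pos_nonneg\<close>)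

section \<open>Free holomorphic functions and intertwiners\<close>

lemma word_op_Nil: "word_op X [] = id_blinfun"
  and word_op_Cons: "word_op X (i # \<alpha>) = X i o\<^sub>L word_op X \<alpha>"
  by (simp_all add: word_op_def)

lemma cbounded_word_op: "(\<And>i. X i \<in> cbounded) \<Longrightarrow> word_op X \<alpha> \<in> cbounded"
  by (induction \<alpha>) (simp_all add: word_op_Nil word_op_Cons cbounded_id cbounded_comp)

lemma word_op_intertwine:
  assumes "\<And>i x. blinfun_apply (Y i) (blinfun_apply L x) = blinfun_apply L (blinfun_apply (X i) x)"
  shows "blinfun_apply (word_op Y \<alpha>) (blinfun_apply L x) = blinfun_apply L (blinfun_apply (word_op X \<alpha>) x)"
  by (induction \<alpha> arbitrary: x) (simp_all add: word_op_Nil word_op_Cons assms)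

lemma word_op_scalar_row: "blinfun_apply (word_op (scalar_row z) \<alpha>) x = prod_list (map z \<alpha>) *\<^sub>C x"
  by (induction \<alpha>)
    (simp_all add: word_op_Nil word_op_Cons scalar_row_def scaleC_op.rep_eq scaleC_scaleC scaleC_one)

context tensor_product
begin

definition homogeneous_part ::
  "('n::countable list \<Rightarrow> ('e \<Rightarrow>\<^sub>L 'e)) \<Rightarrow> ('n \<Rightarrow> ('h \<Rightarrow>\<^sub>L 'h)) \<Rightarrow> nat \<Rightarrow> ('k \<Rightarrow>\<^sub>L 'k)" where
  "homogeneous_part A X k = sot_sum (\<lambda>\<alpha>. op_tensor t (word_op X \<alpha>) (A \<alpha>)) {\<alpha>. length \<alpha> = k}"

lemma free_holomorphicD:
  assumes G: "free_holomorphic t A G" and X: "X \<in> row_ball"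
  shows "A \<alpha> \<in> cbounded" "homogeneous_part A X sums G X"
    "has_sot_sum (\<lambda>\<alpha>. op_tensor t (word_op X \<alpha>) (A \<alpha>)) (homogeneous_part A X k) {\<alpha>. length \<alpha> = k}"
    "op_tensor t (word_op X \<alpha>) (A \<alpha>) \<in> cbounded" "homogeneous_part A X k \<in> cbounded" "G X \<in> cbounded"
proof -
  show A: "A \<alpha> \<in> cbounded" for \<alpha> using G by (simp add: free_holomorphic_def)
  show sums: "homogeneous_part A X sums G X"
    using G X unfolding free_holomorphic_def homogeneous_part_def[abs_def] by blast
  show sot: "has_sot_sum (\<lambda>\<alpha>. op_tensor t (word_op X \<alpha>) (A \<alpha>)) (homogeneous_part A X k)
      {\<alpha>. length \<alpha> = k}" for k
    using G X unfolding free_holomorphic_def homogeneous_part_def by (blast intro: has_sot_sum_sot_sum)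
  show cbt: "op_tensor t (word_op X \<alpha>) (A \<alpha>) \<in> cbounded" for \<alpha>
    by (intro cbounded_op_tensor cbounded_word_op A row_ballD(1)[OF X])
  show hom: "homogeneous_part A X k \<in> cbounded" for k
    by (rule cbounded_if_has_sot_sum[OF sot cbt])
  have "(\<Sum>k<n. homogeneous_part A X k) \<in> cbounded" for n
    using adj_sum[of "{..<n}" "homogeneous_part A X"] hom by blast
  then show "G X \<in> cbounded"
    using closed_sequentially[OF closed_cbounded _ sums[unfolded sums_def]] by blast
qed

text \<open>An intertwiner passes through words, then through the strongly convergent homogeneous parts,
  then through the norm limit. This links the values of \<open>G\<close> at different points of the ball.\<close>

lemma free_holomorphic_intertwine:
  assumes G: "free_holomorphic t A G" and X: "X \<in> row_ball" and Y: "Y \<in> row_ball"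
    and L: "L \<in> cbounded"
    and XY: "\<And>i x. blinfun_apply (Y i) (blinfun_apply L x) = blinfun_apply L (blinfun_apply (X i) x)"
  shows "blinfun_apply (G Y) (blinfun_apply (op_tensor t L id_blinfun) v)
    = blinfun_apply (op_tensor t L id_blinfun) (blinfun_apply (G X) v)"
proof -
  let ?L = "op_tensor t L id_blinfun"
  note D = free_holomorphicD[OF G]
  have Lcb: "?L \<in> cbounded" by (intro cbounded_op_tensor L cbounded_id)
  have wcb: "word_op X \<alpha> \<in> cbounded" "word_op Y \<alpha> \<in> cbounded" for \<alpha>
    by (intro cbounded_word_op row_ballD(1)[OF X] row_ballD(1)[OF Y])+
  have "op_tensor t (word_op Y \<alpha>) (A \<alpha>) o\<^sub>L ?L = ?L o\<^sub>L op_tensor t (word_op X \<alpha>) (A \<alpha>)" for \<alpha>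
    by (rule op_eqI_tensor)
      (simp_all add: Lcb cbounded_comp D(4) X Y op_tensor_apply L cbounded_id wcb D(1)[OF X]
        word_op_intertwine[OF XY])
  then have tm: "op_tensor t (word_op Y \<alpha>) (A \<alpha>) (?L v) = ?L (op_tensor t (word_op X \<alpha>) (A \<alpha>) v)" for \<alpha> v
    by (metis blinfun_apply_blinfun_compose)
  have hom: "homogeneous_part A Y k (?L v) = ?L (homogeneous_part A X k v)" for k v
  proof (rule has_sum_unique)
    show "((\<lambda>\<alpha>. op_tensor t (word_op Y \<alpha>) (A \<alpha>) (?L v)) has_sum homogeneous_part A Y k (?L v))
        {\<alpha>. length \<alpha> = k}"
      by (rule has_sot_sumD[OF D(3)[OF Y]])
    show "((\<lambda>\<alpha>. op_tensor t (word_op Y \<alpha>) (A \<alpha>) (?L v)) has_sum ?L (homogeneous_part A X k v))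
        {\<alpha>. length \<alpha> = k}"
      unfolding tm by (rule has_sum_blinfun[OF has_sot_sumD[OF D(3)[OF X]]])
  qed
  have "(\<lambda>k. homogeneous_part A Y k (?L v)) sums G Y (?L v)"
    by (rule bounded_linear.sums[OF blinfun.bounded_linear_left D(2)[OF Y]])
  moreover have "(\<lambda>k. ?L (homogeneous_part A X k v)) sums ?L (G X v)"
    by (intro bounded_linear.sums[OF blinfun.bounded_linear_right]
        bounded_linear.sums[OF blinfun.bounded_linear_left D(2)[OF X]])
  ultimately show ?thesis unfolding hom by (rule sums_unique2)
qed

text \<open>Compressing the homogeneous parts of \<open>G (z I)\<close> to the slice of a unit vector recovers the
  series for the coefficient value \<open>G(z)\<close> on the second factor, including its convergence.\<close>

lemma scalar_value_tensor:
  assumes G: "free_holomorphic t A G" and z: "z \<in> euclid_ball" and e: "norm (e :: 'h) = 1"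
  shows "scalar_value A z \<in> cbounded"
    and "op_tensor t id_blinfun (scalar_value A z) = G (scalar_row z)"
proof -
  note Z = scalar_row_in_row_ball[OF z, where 'h = 'h]
  note D = free_holomorphicD[OF G Z]
  interpret flip: tensor_product "\<lambda>y x. t x y" by (rule tensor_product_flip)
  define J where "J = flip.slice e"
  have J: "J \<in> cbounded" and Jx: "blinfun_apply J y = t e y" for y
    by (simp_all add: J_def flip.cbounded_slice flip.slice_apply)
  have adjJ: "adj J (t e y) = y" for y
    using e by (simp add: J_def flip.adj_slice_tensor cinner_self scaleC_one)
  define H where "H = homogeneous_part A (scalar_row z)"
  define B where "B k = adj J o\<^sub>L H k o\<^sub>L J" for k
  have Bcb: "B k \<in> cbounded" for k
    unfolding B_def H_def by (intro cbounded_intros J D)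
  have tm: "op_tensor t (word_op (scalar_row z) \<alpha>) (A \<alpha>) (t x y)
      = t x (scaleC_op (prod_list (map z \<alpha>)) (A \<alpha>) y)" for \<alpha> x y
    by (simp add: op_tensor_apply D(1) cbounded_word_op row_ballD(1)[OF Z] word_op_scalar_row
        scaleC_op.rep_eq tensor_scaleC_left tensor_scaleC_right)
  have Hsum: "((\<lambda>\<alpha>. t x (scaleC_op (prod_list (map z \<alpha>)) (A \<alpha>) y)) has_sum H k (t x y))
      {\<alpha>. length \<alpha> = k}" for k x y
    using has_sot_sumD[OF D(3), of "t x y" k] unfolding tm H_def .
  have Bsot: "has_sot_sum (\<lambda>\<alpha>. scaleC_op (prod_list (map z \<alpha>)) (A \<alpha>)) (B k) {\<alpha>. length \<alpha> = k}" for k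
    unfolding has_sot_sum_def
  proof
    fix y
    show "((\<lambda>\<alpha>. scaleC_op (prod_list (map z \<alpha>)) (A \<alpha>) y) has_sum B k y) {\<alpha>. length \<alpha> = k}"
      using has_sum_blinfun[OF Hsum[of e y k], of "adj J"] by (simp add: adjJ B_def Jx)
  qed
  have Beq: "H k (t x y) = t x (B k y)" for k x y
  proof (rule has_sum_unique[OF Hsum])
    show "((\<lambda>\<alpha>. t x (scaleC_op (prod_list (map z \<alpha>)) (A \<alpha>) y)) has_sum t x (B k y))
        {\<alpha>. length \<alpha> = k}"
      using has_sum_blinfun[OF has_sot_sumD[OF Bsot[of k], of y], of "flip.slice x"]
      by (simp add: flip.slice_apply)
  qed
  have "bounded_linear (\<lambda>T. adj J o\<^sub>L T o\<^sub>L J)"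
    by (intro bounded_linear_compose[OF bounded_bilinear.bounded_linear_left[OF bounded_bilinear_blinfun_compose]]
        bounded_bilinear.bounded_linear_right[OF bounded_bilinear_blinfun_compose])
  then have Bsums: "B sums (adj J o\<^sub>L G (scalar_row z) o\<^sub>L J)"
    unfolding B_def[abs_def] using D(2) unfolding H_def by (rule bounded_linear.sums)
  then have w: "scalar_value A z = adj J o\<^sub>L G (scalar_row z) o\<^sub>L J"
    unfolding scalar_value_def sot_sum_eqI[OF Bsot] using sums_unique by metis
  show cb: "scalar_value A z \<in> cbounded" unfolding w by (intro cbounded_intros J D)
  show "op_tensor t id_blinfun (scalar_value A z) = G (scalar_row z)"
  proof (rule op_tensor_eqI[OF D(6)])
    fix x y
    have "(\<lambda>k. H k (t x y)) sums G (scalar_row z) (t x y)"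
      unfolding H_def by (rule bounded_linear.sums[OF blinfun.bounded_linear_left D(2)])
    moreover have "(\<lambda>k. flip.slice x (B k y)) sums flip.slice x (scalar_value A z y)"
      unfolding w by (intro bounded_linear.sums[OF blinfun.bounded_linear_right]
          bounded_linear.sums[OF blinfun.bounded_linear_left Bsums])
    ultimately show "G (scalar_row z) (t x y) = t (id_blinfun x) (scalar_value A z y)"
      unfolding Beq flip.slice_apply using sums_unique2 by fastforce
  qed
qed

end

section \<open>A Stein inequality and the two-point row\<close>

text \<open>Here \<open>Z i x\<close> stands for \<open>Z\<^sub>i\<^sup>* x\<close>. Iterating \<open>Q \<ge> \<Sum> Z\<^sub>i Q Z\<^sub>i\<^sup>*\<close> improves the lower bound
  \<open>- norm Q\<close> for the form of \<open>Q\<close> to \<open>- norm Q * r ^ k\<close>, since \<open>\<Sum> Z\<^sub>i Z\<^sub>i\<^sup>* \<le> r < 1\<close>.\<close>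

lemma stein_nonneg:
  fixes Q :: "'h::chilbert \<Rightarrow>\<^sub>L 'h" and Z :: "'i \<Rightarrow> 'h \<Rightarrow> 'h"
  assumes Qsum: "\<And>x. ((\<lambda>i. Re (cinner (blinfun_apply Q (Z i x)) (Z i x))) has_sum s x) UNIV"
    and le: "\<And>x. s x \<le> Re (cinner (blinfun_apply Q x) x)"
    and Zsum: "\<And>x. ((\<lambda>i. (norm (Z i x))\<^sup>2) has_sum m x) UNIV"
    and m: "\<And>x. m x \<le> r * (norm x)\<^sup>2" and r: "0 \<le> r" "r < 1"
  shows "0 \<le> Re (cinner (blinfun_apply Q x) x)"
proof -
  have bound: "- (norm Q * r ^ k) * (norm x)\<^sup>2 \<le> Re (cinner (Q x) x)" for k x
  proof (induction k arbitrary: x)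
    case 0
    have "- Re (cinner (Q x) x) \<le> norm (- Q) * (norm x)\<^sup>2"
      using form_le_norm[of "- Q" x] by (simp add: blinfun.minus_left cinner.minus_left)
    then show ?case by simp
  next
    case (Suc k)
    have "norm Q * r ^ k * m x \<le> norm Q * r ^ k * (r * (norm x)\<^sup>2)"
      using r by (intro mult_left_mono m) simp
    then have "- (norm Q * r ^ Suc k) * (norm x)\<^sup>2 \<le> - (norm Q * r ^ k) * m x"
      by (simp add: algebra_simps)
    also have "\<dots> \<le> s x"
      by (rule has_sum_mono[OF has_sum_cmult_right[OF Zsum] Qsum]) (rule Suc.IH)
    also have "\<dots> \<le> Re (cinner (Q x) x)" by (rule le)
    finally show ?case .
  qed
  have "(\<lambda>k. - (norm Q * r ^ k) * (norm x)\<^sup>2) \<longlonglongrightarrow> - (norm Q * 0) * (norm x)\<^sup>2"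
    using r by (intro tendsto_intros LIMSEQ_power_zero) simp
  then have "- (norm Q * 0) * (norm x)\<^sup>2 \<le> Re (cinner (Q x) x)"
    by (rule LIMSEQ_le_const2) (use bound in blast)
  then show ?thesis by simp
qed

text \<open>Let \<open>V\<close> and \<open>W\<close> be isometries of \<open>H\<close> with orthogonal ranges, and let \<open>Z = X \<oplus> z I\<close> act
  diagonally on these ranges. The block operators \<open>P = (D, D; D, D)\<close> and \<open>Q = (I, R; R\<^sup>*, c D)\<close>
  satisfy \<open>Q - \<Sum> Z\<^sub>i Q Z\<^sub>i\<^sup>* = P\<close>: indeed \<open>Q\<close> is the closed form of the series
  \<open>\<Sum> Z\<^sub>\<alpha> P Z\<^sub>\<alpha>\<^sup>*\<close> over all words. The summand \<open>e I\<close> makes \<open>Q + e I\<close> invertible and leaves room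
  for a strict inequality, so that conjugating \<open>Z\<close> with the square root \<open>C\<close> of \<open>Q + e I\<close> yields a
  strict row contraction \<open>Y\<close>. It is intertwined with \<open>X\<close> and \<open>z I\<close> by \<open>L1 = C\<^sup>-\<^sup>1 V\<close> and
  \<open>L2 = C\<^sup>-\<^sup>1 W\<close>, for which \<open>M1 = C V\<close> and \<open>M2 = C W\<close> form the dual system; the formulas for
  \<open>M1\<close> and \<open>M2\<close> express \<open>C = C\<^sup>-\<^sup>1 (Q + e I)\<close>.\<close>

lemma two_point_row:
  fixes X :: "'n::countable \<Rightarrow> ('h::chilbert \<Rightarrow>\<^sub>L 'h)"
  assumes infinite_dim: "\<not> (\<exists>B :: 'h::chilbert set. finite B \<and> cspan B = UNIV)"
    and X: "X \<in> row_ball" and z: "z \<in> euclid_ball" and e: "0 < (e::real)"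
    and D_def: "D = id_blinfun - row_gram X"
    and R_def: "R = op_inv (id_blinfun - row_times_adj X z) o\<^sub>L D"
    and c_def: "c = 1 / (1 - (norm2 z)\<^sup>2)"
  obtains Y :: "'n \<Rightarrow> ('h \<Rightarrow>\<^sub>L 'h)" and L1 L2 M1 M2 :: "'h \<Rightarrow>\<^sub>L 'h"
  where "Y \<in> row_ball" "L1 \<in> cbounded" "L2 \<in> cbounded" "M1 \<in> cbounded" "M2 \<in> cbounded"
    "\<And>i x. blinfun_apply (Y i) (blinfun_apply L1 x) = blinfun_apply L1 (blinfun_apply (X i) x)"
    "\<And>i x. blinfun_apply (Y i) (blinfun_apply L2 x) = blinfun_apply L2 (blinfun_apply (scalar_row z i) x)"
    "M1 = (L1 o\<^sub>L (id_blinfun + e *\<^sub>R id_blinfun)) + (L2 o\<^sub>L adj R)"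
    "M2 = (L1 o\<^sub>L R) + (L2 o\<^sub>L (c *\<^sub>R D + e *\<^sub>R id_blinfun))"
    "adj M1 o\<^sub>L L1 = id_blinfun" "adj M1 o\<^sub>L L2 = 0" "adj M2 o\<^sub>L L1 = 0" "adj M2 o\<^sub>L L2 = id_blinfun"
proof -
  obtain V W :: "'h \<Rightarrow>\<^sub>L 'h" where V: "V \<in> cbounded" and W: "W \<in> cbounded"
    and VW: "adj V o\<^sub>L V = id_blinfun" "adj W o\<^sub>L W = id_blinfun" "adj V o\<^sub>L W = 0" "adj W o\<^sub>L V = 0"
    using orthogonal_isometries_exist[OF infinite_dim] by blast
  have VWx: "adj V (V x) = x" "adj W (W x) = x" "adj V (W x) = 0" "adj W (V x) = 0" for x
    using VW by (metis blinfun_apply_blinfun_compose blinfun_apply_id_blinfun id_apply zero_blinfun.rep_eq)+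
  define g where "g = row_gram X"
  define N where "N = row_times_adj X z"
  note Xcb = row_ballD(1)[OF X]
  have gcb: "g \<in> cbounded" and gadj: "adj g = g" and g1: "norm g < 1"
    using row_ballD[OF X] by (simp_all add: g_def)
  have Ncb: "N \<in> cbounded" and N1: "norm N < 1"
    using cbounded_row_times_adj[OF X z] norm_row_times_adj[OF X z] by (simp_all add: N_def)
  have Dcb: "D \<in> cbounded" unfolding D_def by (intro cbounded_intros row_ballD[OF X])
  have Dadj: "adj D = D" unfolding D_def g_def[symmetric] by (simp add: adj_diff cbounded_id gcb adj_id gadj)
  have Dx: "D x = x - g x" for x by (simp add: D_def g_def blinfun.diff_left)
  have inv: "op_invertible (id_blinfun - N)" by (rule id_minus_invertible[OF N1])
  have Rcb: "R \<in> cbounded" unfolding R_def N_def[symmetric]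
    by (intro cbounded_comp cbounded_op_inv inv cbounded_diff cbounded_id Ncb Dcb)
  have NR: "N (R x) = R x - D x" for x
    using op_inv_apply(2)[OF inv, of "D x"] by (simp add: R_def N_def blinfun.diff_left algebra_simps)
  then have "N o\<^sub>L R = R - D" by (intro blinfun_eqI) (simp add: blinfun.diff_left)
  then have "adj (N o\<^sub>L R) = adj (R - D)" by simp
  then have "adj R o\<^sub>L adj N = adj R - D" by (simp add: adj_comp adj_diff Ncb Rcb Dcb Dadj)
  then have RN: "adj R (adj N x) = adj R x - D x" for x
    by (metis blinfun_apply_blinfun_compose blinfun.diff_left)
  define k where "k = (norm2 z)\<^sup>2"
  have k: "0 \<le> k" "k < 1" using euclid_ballD[OF z] by (simp_all add: k_def)
  have c: "c - c * k = 1" using k by (simp add: c_def k_def[symmetric] field_simps)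
  note cb = V W Xcb gcb Ncb Dcb Rcb
  note cbs = cb cb[THEN cbounded_adj]
  have moveV: "cinner (V x) y = cinner x (adj V y)" "cinner y (V x) = cinner (adj V y) x" for x y
    by (simp_all add: cinner_adj_right cinner_adj_left V)
  have moveW: "cinner (W x) y = cinner x (adj W y)" "cinner y (W x) = cinner (adj W y) x" for x y
    by (simp_all add: cinner_adj_right cinner_adj_left W)
  have moveR: "cinner (R x) y = cinner x (adj R y)" "cinner (adj R y) x = cinner y (R x)" for x y
    by (simp_all add: cinner_adj_right cinner_adj_left Rcb)
  have moveD: "cinner (D x) y = cinner x (D y)" for x y
    using cinner_adj_left[OF Dcb, of x y] by (simp add: Dadj)
  have D_nonneg: "0 \<le> Re (cinner (D x) x)" for x
    using form_le_norm[of g x] mult_right_mono[of "norm g" 1 "(norm x)\<^sup>2"] g1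
    by (simp add: Dx cinner.diff_left norm_sq_eq_cinner[symmetric])

  define Z where "Z i = (V o\<^sub>L X i o\<^sub>L adj V) + scaleC_op (z i) (W o\<^sub>L adj W)" for i
  define Q where "Q = (V o\<^sub>L adj V) + (V o\<^sub>L R o\<^sub>L adj W) + (W o\<^sub>L adj R o\<^sub>L adj V)
    + c *\<^sub>R (W o\<^sub>L D o\<^sub>L adj W)"
  \<comment> \<open>\<open>S\<close> and \<open>T\<close> are the values of \<open>\<Sum> Z\<^sub>i Q Z\<^sub>i\<^sup>*\<close> and \<open>\<Sum> Z\<^sub>i Z\<^sub>i\<^sup>*\<close>.\<close>
  define S where "S = (V o\<^sub>L ((g o\<^sub>L adj V) + (N o\<^sub>L R o\<^sub>L adj W)))
    + (W o\<^sub>L ((adj R o\<^sub>L adj N o\<^sub>L adj V) + k *\<^sub>R c *\<^sub>R (D o\<^sub>L adj W)))"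
  define T where "T = (V o\<^sub>L g o\<^sub>L adj V) + (W o\<^sub>L k *\<^sub>R adj W)"
  have Zcb: "Z i \<in> cbounded" for i
    unfolding Z_def by (intro cbounded_add cbounded_comp cbounded_scaleC_op cbs)
  have Zx: "Z i x = V (X i (adj V x)) + z i *\<^sub>C W (adj W x)" for i x
    by (simp add: Z_def blinfun.add_left scaleC_op.rep_eq)
  have adjZx: "adj (Z i) x = V (adj (X i) (adj V x)) + cnj (z i) *\<^sub>C W (adj W x)" for i x
    by (simp add: Z_def adj_add adj_comp adj_scaleC_op adj_adj cbounded_comp cbounded_scaleC_op
        cbs blinfun.add_left scaleC_op.rep_eq)
  have Qcb: "Q \<in> cbounded"
    unfolding Q_def by (intro cbounded_add cbounded_comp cbounded_scaleR cbs)
  have Qx: "Q x = V (adj V x + R (adj W x)) + W (adj R (adj V x) + c *\<^sub>R D (adj W x))" for x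
    by (simp add: Q_def blinfun.add_left blinfun.add_right blinfun.scaleR_left blinfun.scaleR_right)
  have Qadj: "adj Q = Q"
    by (rule adj_unique)
      (simp add: Qx cinner_add_left cinner_add_right moveV moveW moveR moveD
        cinner_scaleR_left cinner_scaleR_right)
  have Sx: "S x = V (g (adj V x) + N (R (adj W x)))
      + W (adj R (adj N (adj V x)) + k *\<^sub>R c *\<^sub>R D (adj W x))" for x
    by (simp add: S_def blinfun.add_left blinfun.scaleR_left)
  have Tx: "T x = V (g (adj V x)) + W (k *\<^sub>R adj W x)" for x
    by (simp add: T_def blinfun.add_left blinfun.scaleR_left)

  have s1: "((\<lambda>i. X i (adj (X i) x)) has_sum g x) UNIV" for x
    using has_sot_sumD[OF row_ballD(2)[OF X], of x] by (simp add: g_def)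
  have s2: "((\<lambda>i. cnj (z i) *\<^sub>C X i x) has_sum N x) UNIV" for x
    using has_sum_bounded_linear[OF blinfun.bounded_linear_left has_sum_row_times_adj[OF X z], of x]
    by (simp add: N_def scaleC_op.rep_eq)
  have s3: "((\<lambda>i. z i *\<^sub>C adj (X i) x) has_sum adj N x) UNIV" for x
    using has_sum_bounded_linear[OF blinfun.bounded_linear_left scalar_times_adj_eq(2)[OF X z], of x]
    by (simp add: N_def scaleC_op.rep_eq)
  have s4: "((\<lambda>i. (cmod (z i))\<^sup>2 *\<^sub>R x) has_sum k *\<^sub>R x) UNIV" for x :: 'h
    unfolding k_def
    by (rule has_sum_bounded_linear[OF bounded_linear_scaleR_left euclid_ballD(1)[OF z]])
  have zz: "(z i * cnj (z i)) *\<^sub>C x = (cmod (z i))\<^sup>2 *\<^sub>R x" for i and x :: 'h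
    by (simp add: complex_norm_square[symmetric] scaleC_of_real del: of_real_power)

  have Ssum: "((\<lambda>i. Z i (Q (adj (Z i) x))) has_sum S x) UNIV" for x
  proof -
    have "((\<lambda>i. V (X i (adj (X i) (adj V x)) + cnj (z i) *\<^sub>C X i (R (adj W x)))
        + W (adj R (z i *\<^sub>C adj (X i) (adj V x)) + (cmod (z i))\<^sup>2 *\<^sub>R c *\<^sub>R D (adj W x))) has_sum S x) UNIV"
      unfolding Sx by (intro has_sum_add has_sum_blinfun s1 s2 s3 s4)
    moreover have "Z i (Q (adj (Z i) x)) = V (X i (adj (X i) (adj V x)) + cnj (z i) *\<^sub>C X i (R (adj W x)))
        + W (adj R (z i *\<^sub>C adj (X i) (adj V x)) + (cmod (z i))\<^sup>2 *\<^sub>R c *\<^sub>R D (adj W x))" for i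
      by (simp add: Zx Qx adjZx VWx cboundedD[OF cbs(1)] cboundedD[OF cbs(2)] cboundedD cbs
          blinfun.add_right blinfun.scaleR_right scaleC_add_right zz scaleC_scaleR mult.commute)
    ultimately show ?thesis by simp
  qed
  have Tsum: "((\<lambda>i. Z i (adj (Z i) x)) has_sum T x) UNIV" for x
  proof -
    have "((\<lambda>i. V (X i (adj (X i) (adj V x))) + W ((cmod (z i))\<^sup>2 *\<^sub>R adj W x)) has_sum T x) UNIV"
      unfolding Tx by (intro has_sum_add has_sum_blinfun s1 s4)
    moreover have "Z i (adj (Z i) x) = V (X i (adj (X i) (adj V x))) + W ((cmod (z i))\<^sup>2 *\<^sub>R adj W x)" for i
      by (simp add: Zx adjZx VWx cboundedD cbs blinfun.add_right blinfun.scaleR_right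
          scaleC_add_right zz)
    ultimately show ?thesis by simp
  qed
  have moveZ: "cinner (Z i x) y = cinner x (adj (Z i) y)" for i x y
    by (simp add: cinner_adj_right Zcb)
  have Sform: "((\<lambda>i. Re (cinner (Q (adj (Z i) x)) (adj (Z i) x))) has_sum Re (cinner (S x) x)) UNIV" for x
    using has_sum_Re[OF has_sum_cinner_left[OF Ssum, of x x]] by (simp add: moveZ)
  have Tform: "((\<lambda>i. (norm (adj (Z i) x))\<^sup>2) has_sum Re (cinner (T x) x)) UNIV" for x
    using has_sum_Re[OF has_sum_cinner_left[OF Tsum, of x x]] by (simp add: moveZ norm_sq_eq_cinner)
  \<comment> \<open>The Stein equation: \<open>Q - S\<close> is the operator \<open>P\<close>, whose form is that of \<open>D\<close> at \<open>V\<^sup>* x + W\<^sup>* x\<close>.\<close>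
  have SQ: "Re (cinner (S x) x) \<le> Re (cinner (Q x) x)" for x
  proof -
    have "W (c *\<^sub>R v) - W ((k * c) *\<^sub>R v) = W v" for v
      using c by (simp add: mult.commute flip: blinfun.diff_right scaleR_diff_left)
    then have "Q x - S x = V (D (adj V x + adj W x)) + W (D (adj V x + adj W x))"
      by (simp add: Qx Sx NR RN Dx[of "adj V x"] blinfun.add_right blinfun.diff_right)
    then have "cinner (Q x - S x) x = cinner (D (adj V x + adj W x)) (adj V x + adj W x)"
      by (simp add: cinner_add_left cinner_add_right moveV moveW)
    then have "0 \<le> Re (cinner (Q x - S x) x)" using D_nonneg[of "adj V x + adj W x"] by simp
    then show ?thesis by (simp add: cinner.diff_left)
  qed
  define r where "r = max (norm g) k"
  have r: "0 \<le> r" "r < 1" using k g1 by (simp_all add: r_def)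
  have TR: "Re (cinner (T x) x) \<le> r * (norm x)\<^sup>2" for x
  proof -
    have "0 \<le> (norm (x + (- (V (adj V x) + W (adj W x)))))\<^sup>2" by simp
    also have "\<dots> = (norm x)\<^sup>2 - (norm (adj V x))\<^sup>2 - (norm (adj W x))\<^sup>2"
      unfolding norm_sq_add norm_minus_cancel
      by (simp add: norm_sq_eq_cinner cinner_add_left cinner_add_right cinner.minus_right
          cinner.diff_right moveV moveW VWx)
    finally have bessel: "(norm (adj V x))\<^sup>2 + (norm (adj W x))\<^sup>2 \<le> (norm x)\<^sup>2" by simp
    have "Re (cinner (T x) x) = Re (cinner (g (adj V x)) (adj V x)) + k * (norm (adj W x))\<^sup>2"
      by (simp add: Tx cinner_add_left moveV moveW cinner_scaleR_left norm_sq_eq_cinner)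
    also have "\<dots> \<le> norm g * (norm (adj V x))\<^sup>2 + k * (norm (adj W x))\<^sup>2"
      by (intro add_right_mono form_le_norm)
    also have "\<dots> \<le> r * (norm (adj V x))\<^sup>2 + r * (norm (adj W x))\<^sup>2"
      by (intro add_mono mult_right_mono) (simp_all add: r_def)
    also have "\<dots> \<le> r * (norm x)\<^sup>2"
      using mult_left_mono[OF bessel r(1)] by (simp add: distrib_left)
    finally show ?thesis .
  qed
  have Q_nonneg: "0 \<le> Re (cinner (Q x) x)" for x
    by (rule stein_nonneg[OF Sform SQ Tform TR r])

  define Qe where "Qe = Q + e *\<^sub>R id_blinfun"
  have Qex: "Qe x = Q x + e *\<^sub>R x" for x by (simp add: Qe_def blinfun.add_left blinfun.scaleR_left)
  have Qeform: "Re (cinner (Qe x) x) = Re (cinner (Q x) x) + e * (norm x)\<^sup>2" for x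
    by (simp add: Qex cinner_add_left cinner_scaleR_left norm_sq_eq_cinner)
  have Qepos: "op_pos Qe"
  proof (rule op_posI)
    show "Qe \<in> cbounded" unfolding Qe_def by (intro cbounded_intros Qcb)
    show "adj Qe = Qe"
      unfolding Qe_def by (simp add: adj_add adj_scaleR Qcb cbounded_scaleR cbounded_id adj_id Qadj)
    show "0 \<le> Re (cinner (Qe x) x)" for x using Q_nonneg[of x] e by (simp add: Qeform)
  qed
  have Qeco: "coercive Qe" unfolding coercive_def
    using e Q_nonneg by (intro exI[of _ e]) (simp add: Qeform)
  define C where "C = op_sqrt Qe"
  define I where "I = op_inv C"
  have Cpos: "op_pos C" and CC: "C o\<^sub>L C = Qe" and Cinv: "op_invertible C"
    using op_sqrt_coercive(1-3)[OF Qepos Qeco] by (simp_all add: C_def coercive_invertible)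
  have Ccb: "C \<in> cbounded" and Cadj: "adj C = C" using op_posD[OF Cpos] by simp_all
  have Icb: "I \<in> cbounded" unfolding I_def by (rule cbounded_op_inv[OF Cinv Ccb])
  have Iadj: "adj I = I" unfolding I_def using op_inv_adj(2)[OF Cinv Ccb] Cadj by simp
  have IC: "I (C x) = x" "C (I x) = x" for x using op_inv_apply[OF Cinv] by (simp_all add: I_def)
  have CCx: "C (C x) = Qe x" for x using CC by (metis blinfun_apply_blinfun_compose)

  define Y where "Y i = I o\<^sub>L Z i o\<^sub>L C" for i
  have adjY: "adj (Y i) = C o\<^sub>L adj (Z i) o\<^sub>L I" for i
    by (rule blinfun_eqI) (simp add: Y_def adj_comp cbounded_comp Icb Ccb Zcb Iadj Cadj)
  have "Y \<in> row_ball"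
  proof (rule row_ballI)
    show "Y i \<in> cbounded" for i unfolding Y_def by (intro cbounded_comp Icb Zcb Ccb)
    show "has_sot_sum (\<lambda>i. Y i o\<^sub>L adj (Y i)) (I o\<^sub>L (S + e *\<^sub>R T) o\<^sub>L I) UNIV"
      unfolding has_sot_sum_def
    proof
      fix x
      have "((\<lambda>i. I (Z i (Q (adj (Z i) (I x))) + e *\<^sub>R Z i (adj (Z i) (I x)))) has_sum
          I (S (I x) + e *\<^sub>R T (I x))) UNIV"
        by (intro has_sum_blinfun has_sum_add has_sum_bounded_linear[OF bounded_linear_scaleR_right]
            Ssum Tsum)
      then show "((\<lambda>i. (Y i o\<^sub>L adj (Y i)) x) has_sum (I o\<^sub>L (S + e *\<^sub>R T) o\<^sub>L I) x) UNIV"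
        by (simp add: adjY) (simp add: Y_def CCx Qex blinfun.add_left blinfun.scaleR_left
            blinfun.add_right blinfun.scaleR_right)
    qed
    \<comment> \<open>Any \<open>m \<ge> norm Qe\<close> serves; the extra summands make the contraction constant positive.\<close>
    define m where "m = norm Qe + e + 1"
    have m: "0 < m" "e * (1 - r) < m"
    proof -
      show "0 < m" using e by (simp add: m_def add_nonneg_pos)
      have "e * (1 - r) \<le> e * 1" using e r by (intro mult_left_mono) auto
      then show "e * (1 - r) < m" unfolding m_def using norm_ge_zero[of Qe] by linarith
    qed
    show "0 < 1 - e * (1 - r) / m" "1 - e * (1 - r) / m < 1" using m e r by (simp_all add: field_simps)
    show "Re (cinner ((I o\<^sub>L (S + e *\<^sub>R T) o\<^sub>L I) x) x) \<le> (1 - e * (1 - r) / m) * (norm x)\<^sup>2" for x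
    proof -
      define y where "y = I x"
      have moveI: "cinner (I u) v = cinner u (I v)" for u v
        using cinner_adj_left[OF Icb, of u v] by (simp add: Iadj)
      have moveC: "cinner (C u) v = cinner u (C v)" for u v by (rule op_posD(4)[OF Cpos])
      have x: "(norm x)\<^sup>2 = Re (cinner (Qe y) y)"
        by (simp add: y_def norm_sq_eq_cinner CCx[symmetric] IC moveC)
      have "(norm x)\<^sup>2 \<le> norm Qe * (norm y)\<^sup>2" unfolding x by (rule form_le_norm)
      also have "\<dots> \<le> m * (norm y)\<^sup>2" using e by (intro mult_right_mono) (simp_all add: m_def)
      finally have "e * (1 - r) / m * (norm x)\<^sup>2 \<le> e * (1 - r) / m * (m * (norm y)\<^sup>2)"
        using m e r by (intro mult_left_mono) simp_all
      then have xy: "e * (1 - r) / m * (norm x)\<^sup>2 \<le> e * (1 - r) * (norm y)\<^sup>2" using m by simp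
      have "Re (cinner ((I o\<^sub>L (S + e *\<^sub>R T) o\<^sub>L I) x) x)
          = Re (cinner (S y) y) + e * Re (cinner (T y) y)"
        by (simp add: moveI y_def blinfun.add_left blinfun.scaleR_left cinner_add_left cinner_scaleR_left)
      also have "\<dots> \<le> Re (cinner (Q y) y) + e * (r * (norm y)\<^sup>2)"
        using e by (intro add_mono SQ mult_left_mono TR) simp
      also have "\<dots> = (norm x)\<^sup>2 - e * (1 - r) * (norm y)\<^sup>2"
        by (simp add: x Qeform algebra_simps)
      also have "\<dots> \<le> (norm x)\<^sup>2 - e * (1 - r) / m * (norm x)\<^sup>2" using xy by simp
      finally show ?thesis by (simp add: left_diff_distrib)
    qed
  qed
  moreover have "I o\<^sub>L V \<in> cbounded" "I o\<^sub>L W \<in> cbounded" "C o\<^sub>L V \<in> cbounded" "C o\<^sub>L W \<in> cbounded"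
    by (intro cbounded_comp Icb Ccb V W)+
  moreover have "Y i ((I o\<^sub>L V) x) = (I o\<^sub>L V) (X i x)" for i x
    by (simp add: Y_def IC Zx VWx blinfun.zero_right)
  moreover have "Y i ((I o\<^sub>L W) x) = (I o\<^sub>L W) (scalar_row z i x)" for i x
    by (simp add: Y_def IC Zx VWx blinfun.zero_right scalar_row_def scaleC_op.rep_eq cboundedD[OF W])
  moreover
  have CI: "C x = I (Qe x)" for x by (simp add: CCx[symmetric] IC)
  have "C o\<^sub>L V = ((I o\<^sub>L V) o\<^sub>L (id_blinfun + e *\<^sub>R id_blinfun)) + ((I o\<^sub>L W) o\<^sub>L adj R)"
    "C o\<^sub>L W = ((I o\<^sub>L V) o\<^sub>L R) + ((I o\<^sub>L W) o\<^sub>L (c *\<^sub>R D + e *\<^sub>R id_blinfun))"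
    by (auto intro!: blinfun_eqI simp: CI Qex Qx VWx blinfun.bilinear_simps)
  moreover have "adj (C o\<^sub>L V) o\<^sub>L (I o\<^sub>L V) = id_blinfun" "adj (C o\<^sub>L V) o\<^sub>L (I o\<^sub>L W) = 0"
    "adj (C o\<^sub>L W) o\<^sub>L (I o\<^sub>L V) = 0" "adj (C o\<^sub>L W) o\<^sub>L (I o\<^sub>L W) = id_blinfun"
    by (auto intro!: blinfun_eqI simp: adj_comp Ccb V W Cadj IC VWx zero_blinfun.rep_eq)
  ultimately show thesis by (rule that)
qed

section \<open>The two-point kernel inequality\<close>

lemma cinner_op_Re:
  assumes "T \<in> cbounded"
  shows "cinner (blinfun_apply (op_Re T) x) y
    = (cinner (blinfun_apply T x) y + cinner x (blinfun_apply T y)) / 2"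
  using cinner_adj_left[OF assms, of x y]
  by (simp add: op_Re_def blinfun.scaleR_left blinfun.add_left cinner_scaleR_left cinner_add_left
      scaleR_conv_of_real)

lemma Re_cinner_op_Re:
  assumes "T \<in> cbounded"
  shows "Re (cinner (blinfun_apply (op_Re T) x) x) = Re (cinner (blinfun_apply T x) x)"
  using Re_cinner_commute[of x "blinfun_apply T x"] by (simp add: cinner_op_Re[OF assms])

lemma nonneg_if_affine_nonneg:
  fixes p q :: real
  assumes "\<And>e. 0 < e \<Longrightarrow> 0 \<le> p + e * q"
  shows "0 \<le> p"
proof (rule tendsto_lowerbound)
  show "((\<lambda>e. p + e * q) \<longlongrightarrow> p) (at_right 0)" by (auto intro!: tendsto_eq_intros)
  show "\<forall>\<^sub>F e in at_right 0. 0 \<le> p + e * q"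
    using assms by (auto simp: eventually_at_right_less intro: eventually_mono[OF eventually_at_right_less])
qed simp

context tensor_product
begin

definition amp :: "('h \<Rightarrow>\<^sub>L 'h) \<Rightarrow> ('k \<Rightarrow>\<^sub>L 'k)" where "amp S = op_tensor t S id_blinfun"

lemma cbounded_amp: "S \<in> cbounded \<Longrightarrow> amp S \<in> cbounded"
  by (simp add: amp_def cbounded_op_tensor cbounded_id)

lemma amp_id: "amp id_blinfun = id_blinfun"
  by (simp add: amp_def op_tensor_id)

lemma amp_comp: "S \<in> cbounded \<Longrightarrow> T \<in> cbounded \<Longrightarrow> amp (S o\<^sub>L T) = amp S o\<^sub>L amp T"
proof -
  assume "S \<in> cbounded" "T \<in> cbounded"
  moreover have "id_blinfun o\<^sub>L id_blinfun = (id_blinfun :: 'e \<Rightarrow>\<^sub>L 'e)" by (rule blinfun_eqI) simp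
  ultimately show ?thesis by (simp add: amp_def op_tensor_comp cbounded_id)
qed

lemma amp_add: "S \<in> cbounded \<Longrightarrow> T \<in> cbounded \<Longrightarrow> amp (S + T) = amp S + amp T"
  by (simp add: amp_def op_tensor_add_left cbounded_id)

lemma amp_scaleR: "S \<in> cbounded \<Longrightarrow> amp (r *\<^sub>R S) = r *\<^sub>R amp S"
  by (simp add: amp_def op_tensor_scaleR_left cbounded_id)

lemma amp_zero: "amp 0 = 0"
  using amp_scaleR[OF cbounded_zero, of 0] by simp

lemma adj_amp: "S \<in> cbounded \<Longrightarrow> adj (amp S) = amp (adj S)"
  by (simp add: amp_def adj_op_tensor cbounded_id adj_id)

text \<open>Positivity of \<open>Re G(Y)\<close> at the vector \<open>u = M1 a + M2 b\<close>. In terms of \<open>L1\<close> and \<open>L2\<close> the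
  intertwining relations evaluate \<open>G(Y) u\<close>, and duality evaluates its inner product with \<open>u\<close>. The
  outcome is the claim up to a term linear in \<open>e\<close>.\<close>

lemma two_point_form:
  fixes X :: "'n::countable \<Rightarrow> ('h \<Rightarrow>\<^sub>L 'h)"
  assumes infinite_dim: "\<not> (\<exists>B :: 'h set. finite B \<and> cspan B = UNIV)"
    and G: "free_holomorphic t A G"
    and pos: "\<And>Y. Y \<in> row_ball \<Longrightarrow> op_pos (op_Re (G Y))"
    and X: "X \<in> row_ball" and z: "z \<in> euclid_ball"
    and D_def: "D = id_blinfun - row_gram X"
    and R_def: "R = op_inv (id_blinfun - row_times_adj X z) o\<^sub>L D"
    and c_def: "c = 1 / (1 - (norm2 z)\<^sup>2)"
    and Dcb: "D \<in> cbounded" and Rcb: "R \<in> cbounded"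
  shows "0 \<le> Re (cinner (blinfun_apply (G X) (a + blinfun_apply (amp R) b)) a)
    + Re (cinner (blinfun_apply (G (scalar_row z))
        (blinfun_apply (adj (amp R)) a + c *\<^sub>R blinfun_apply (amp D) b)) b)"
    (is "0 \<le> ?p")
proof (rule nonneg_if_affine_nonneg)
  fix e :: real assume e: "0 < e"
  have Z: "scalar_row z \<in> row_ball" by (rule scalar_row_in_row_ball[OF z])
  obtain Y :: "'n \<Rightarrow> ('h \<Rightarrow>\<^sub>L 'h)" and L1 L2 M1 M2 :: "'h \<Rightarrow>\<^sub>L 'h" where Y: "Y \<in> row_ball"
    and L: "L1 \<in> cbounded" "L2 \<in> cbounded" and M: "M1 \<in> cbounded" "M2 \<in> cbounded"
    and YL1: "\<And>i x. Y i (L1 x) = L1 (X i x)"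
    and YL2: "\<And>i x. Y i (L2 x) = L2 (scalar_row z i x)"
    and M1: "M1 = (L1 o\<^sub>L (id_blinfun + e *\<^sub>R id_blinfun)) + (L2 o\<^sub>L adj R)"
    and M2: "M2 = (L1 o\<^sub>L R) + (L2 o\<^sub>L (c *\<^sub>R D + e *\<^sub>R id_blinfun))"
    and dualH: "adj M1 o\<^sub>L L1 = id_blinfun" "adj M1 o\<^sub>L L2 = 0" "adj M2 o\<^sub>L L1 = 0" "adj M2 o\<^sub>L L2 = id_blinfun"
    by (rule two_point_row[OF infinite_dim X z e D_def R_def c_def], rule that, assumption+)
  note cb = cbounded_id cbounded_zero cbounded_comp cbounded_add cbounded_scaleR cbounded_adj L M Dcb Rcb
  have Ms: "amp M1 a = amp L1 (a + e *\<^sub>R a) + amp L2 (adj (amp R) a)"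
    "amp M2 b = amp L1 (amp R b) + amp L2 (c *\<^sub>R amp D b + e *\<^sub>R b)"
    unfolding M1 M2
    by (simp_all add: amp_add amp_comp amp_scaleR amp_id adj_amp cb blinfun.add_left blinfun.scaleR_left)
  have dual: "adj (amp M1) (amp L1 v) = v" "adj (amp M1) (amp L2 v) = 0"
    "adj (amp M2) (amp L1 v) = 0" "adj (amp M2) (amp L2 v) = v" for v
    using dualH[THEN arg_cong[of _ _ amp]]
    by (simp_all add: amp_comp adj_amp amp_id amp_zero cb zero_blinfun.rep_eq
        flip: blinfun_apply_blinfun_compose)
  have pair: "cinner (amp L v) (amp M w) = cinner (adj (amp M) (amp L v)) w" if "M \<in> cbounded" for L M v w
    using cinner_adj_left[OF cbounded_amp[OF that]] by simp
  define u where "u = amp M1 a + amp M2 b"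
  define p where "p = a + e *\<^sub>R a + amp R b"
  define q where "q = adj (amp R) a + c *\<^sub>R amp D b + e *\<^sub>R b"
  have "u = amp L1 p + amp L2 q"
    by (simp add: u_def p_def q_def Ms blinfun.add_right)
  then have "G Y u = amp L1 (G X p) + amp L2 (G (scalar_row z) q)"
    using free_holomorphic_intertwine[OF G X Y L(1) YL1] free_holomorphic_intertwine[OF G Z Y L(2) YL2]
    by (simp add: blinfun.add_right amp_def)
  then have "cinner (G Y u) u = cinner (G X p) a + cinner (G (scalar_row z) q) b"
    by (simp add: u_def cinner_add_left cinner_add_right pair M dual)
  moreover have "0 \<le> Re (cinner (G Y u) u)"
    using op_posD(3)[OF pos[OF Y], of u] Re_cinner_op_Re[OF free_holomorphicD(6)[OF G Y], of u] by simp
  ultimately show "0 \<le> ?p + e * (Re (cinner (G X a) a) + Re (cinner (G (scalar_row z) b) b))"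
    by (simp add: p_def q_def blinfun.add_right blinfun.scaleR_right cinner_add_left cinner_scaleR_left
        algebra_simps)
qed

end

section \<open>The normalising factor\<close>

lemma op_invertible_comp:
  assumes "op_invertible S" "op_invertible T"
  shows "op_invertible (S o\<^sub>L T)"
  unfolding op_invertible_def
  by (intro exI[of _ "op_inv T o\<^sub>L op_inv S"] conjI blinfun_eqI)
    (simp_all add: op_inv_apply assms)

lemma op_invertible_op_inv: "op_invertible T \<Longrightarrow> op_invertible (op_inv T)"
  using op_inv_comp by (auto simp: op_invertible_def)

lemma coercive_if_Re_ge:
  assumes "coercive S" "\<And>x. Re (cinner (blinfun_apply S x) x) \<le> Re (cinner (blinfun_apply T x) x)"
  shows "coercive T"
  using assms unfolding coercive_def by (meson order_trans)

text \<open>The operator \<open>(1 + W\<^sup>*) (Re W)\<^sup>-\<^sup>1 (1 + W)\<close> is the inverse of \<open>M = s\<^sup>2\<close>, where \<open>Gamma_op W\<close>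
  is \<open>2 s\<close>; as a square root of \<open>M\<close>, \<open>s\<close> commutes with whatever commutes with \<open>W\<close> and \<open>W\<^sup>*\<close>.\<close>

lemma Gamma_op_props:
  fixes W :: "'k::chilbert \<Rightarrow>\<^sub>L 'k"
  assumes W: "W \<in> cbounded" and pos: "op_pos (op_Re W)" and inv: "op_invertible (op_Re W)"
  shows op_pos_Gamma_op: "op_pos (Gamma_op W)"
    and Gamma_op_sandwich: "blinfun_apply (Gamma_op W) (blinfun_apply (id_blinfun + adj W)
      (blinfun_apply (op_inv (op_Re W)) (blinfun_apply (id_blinfun + W) (blinfun_apply (Gamma_op W) x)))) = 4 *\<^sub>R x"
    and Gamma_op_commute: "(\<And>x. blinfun_apply P (blinfun_apply W x) = blinfun_apply W (blinfun_apply P x)) \<Longrightarrow>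
      (\<And>x. blinfun_apply P (blinfun_apply (adj W) x) = blinfun_apply (adj W) (blinfun_apply P x)) \<Longrightarrow>
      blinfun_apply P (blinfun_apply (Gamma_op W) x) = blinfun_apply (Gamma_op W) (blinfun_apply P x)"
proof -
  define E where "E = id_blinfun + W"
  have Ecb: "E \<in> cbounded" unfolding E_def by (intro cbounded_intros W)
  have Eadj: "adj E = id_blinfun + adj W" by (simp add: E_def adj_add cbounded_id W adj_id)
  have "coercive E" unfolding coercive_def
  proof (intro exI[of _ 1] conjI allI)
    fix x
    have "0 \<le> Re (cinner (W x) x)" using op_posD(3)[OF pos, of x] Re_cinner_op_Re[OF W] by simp
    then show "1 * (norm x)\<^sup>2 \<le> Re (cinner (E x) x)"
      by (simp add: E_def blinfun.add_left cinner_add_left norm_sq_eq_cinner)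
  qed simp
  then have Einv: "op_invertible E" by (rule coercive_invertible)
  note Einv' = op_inv_adj[OF Einv Ecb]
  define M where "M = op_inv E o\<^sub>L op_Re W o\<^sub>L op_inv (adj E)"
  have icb: "op_inv E \<in> cbounded" by (rule cbounded_op_inv[OF Einv Ecb])
  have Rcb: "op_Re W \<in> cbounded" by (rule op_posD(1)[OF pos])
  have Mcb: "M \<in> cbounded" unfolding M_def Einv'(2) by (intro cbounded_intros icb Rcb)
  have Mform: "cinner (M x) y = cinner (op_Re W (adj (op_inv E) x)) (adj (op_inv E) y)" for x y
    by (simp add: M_def Einv'(2) cinner_adj_right[OF icb])
  have Mform': "cinner x (M y) = cinner (adj (op_inv E) x) (op_Re W (adj (op_inv E) y))" for x y
    by (simp add: M_def Einv'(2) cinner_adj_left[OF icb])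
  have Madj: "adj M = M" by (rule adj_unique) (simp only: Mform Mform' op_posD(4)[OF pos])
  have Mpos: "op_pos M"
    by (rule op_posI[OF Mcb Madj]) (simp add: Mform op_posD(3)[OF pos])
  have Minv: "op_invertible M" unfolding M_def
    by (intro op_invertible_comp op_invertible_op_inv Einv inv Einv')
  have Mco: "coercive M" by (rule coercive_if_pos_invertible[OF Mpos Minv])
  define s where "s = op_sqrt M"
  note s = op_sqrt_coercive[OF Mpos Mco, folded s_def]
  have Gamma: "Gamma_op W = 2 *\<^sub>R s"
    unfolding Gamma_op_def s_def M_def Eadj unfolding E_def ..
  have ss: "s (s x) = M x" for x using s(3) by (metis blinfun_apply_blinfun_compose)
  have sinv: "op_invertible s" by (rule coercive_invertible[OF s(2)])
  show "op_pos (Gamma_op W)" unfolding Gamma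
    using op_posD[OF s(1)]
    by (intro op_posI) (simp_all add: cbounded_scaleR adj_scaleR blinfun.scaleR_left cinner_scaleR_left)
  \<comment> \<open>Since \<open>s\<close> is onto, \<open>s M\<^sup>-\<^sup>1 s = 1\<close> may be checked on vectors \<open>s y\<close>.\<close>
  have "adj E (op_inv (op_Re W) (E (M x))) = x" for x
    by (simp add: M_def op_inv_apply[OF Einv] op_inv_apply[OF Einv'(1)] op_inv_apply[OF inv])
  then have "s (adj E (op_inv (op_Re W) (E (s (s (op_inv s x)))))) = s (op_inv s x)" for x
    by (simp add: ss)
  then have "s (adj E (op_inv (op_Re W) (E (s x)))) = x" by (simp add: op_inv_apply sinv)
  then show "Gamma_op W ((id_blinfun + adj W) (op_inv (op_Re W) ((id_blinfun + W) (Gamma_op W x)))) = 4 *\<^sub>R x"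
    unfolding Gamma Eadj[symmetric] E_def[symmetric]
    by (simp add: blinfun.scaleR_left blinfun.scaleR_right)
  assume PW: "\<And>x. P (W x) = W (P x)" and PW': "\<And>x. P (adj W x) = adj W (P x)"
  have PE: "P (E x) = E (P x)" "P (adj E x) = adj E (P x)" for x
    unfolding Eadj by (simp_all add: E_def blinfun.add_left blinfun.add_right PW PW')
  have PR: "P (op_Re W x) = op_Re W (P x)" for x
    by (simp add: op_Re_def blinfun.bilinear_simps PW PW')
  have "P (M x) = M (P x)" for x
    using op_inv_commute[OF Einv PE(1)] op_inv_commute[OF Einv'(1) PE(2)] by (simp add: M_def PR)
  then have "P o\<^sub>L M = M o\<^sub>L P" by (intro blinfun_eqI) simp
  then have "P o\<^sub>L s = s o\<^sub>L P" by (rule s(4))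
  then have "P (s x) = s (P x)" by (metis blinfun_apply_blinfun_compose)
  then show "P (Gamma_op W x) = Gamma_op W (P x)"
    unfolding Gamma by (simp add: blinfun.scaleR_left blinfun.scaleR_right)
qed

section \<open>The Schwarz-Pick inequality\<close>

theorem theorem7p2:
  fixes t :: "'h::chilbert \<Rightarrow> 'e::chilbert \<Rightarrow> 'k::chilbert"
    and A :: "'n::countable list \<Rightarrow> ('e \<Rightarrow>\<^sub>L 'e)"
    and G :: "('n \<Rightarrow> ('h \<Rightarrow>\<^sub>L 'h)) \<Rightarrow> ('k \<Rightarrow>\<^sub>L 'k)"
    and z :: "'n \<Rightarrow> complex"
    and X :: "'n \<Rightarrow> ('h \<Rightarrow>\<^sub>L 'h)"
  defines "Gz \<equiv> op_tensor t id_blinfun (scalar_value A z)"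
  assumes separable: "separable_space (euclidean :: 'h topology)"
    and infinite_dim: "\<not> (\<exists>B :: 'h set. finite B \<and> cspan B = UNIV)"
    and tensor: "hilbert_tensor t"
    and holo: "free_holomorphic t A G"
    and pos: "\<And>Y. Y \<in> row_ball \<Longrightarrow> op_pos (op_Re (G Y)) \<and> op_invertible (op_Re (G Y))"
    and z: "z \<in> euclid_ball"
    and X: "X \<in> row_ball"
  shows "op_le
    ((1 - (norm2 z)\<^sup>2) *\<^sub>R op_tensor t
       (op_inv (id_blinfun - row_times_adj X z) o\<^sub>L (id_blinfun - row_gram X)
          o\<^sub>L op_inv (id_blinfun - scalar_times_adj z X))
       id_blinfun)
    (Gamma_op Gz o\<^sub>L (id_blinfun + adj Gz) o\<^sub>L op_inv (G X + adj Gz) o\<^sub>L op_Re (G X)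
       o\<^sub>L op_inv (Gz + adj (G X)) o\<^sub>L (id_blinfun + Gz) o\<^sub>L Gamma_op Gz)"
proof -
  interpret tensor_product t by standard (rule tensor)
  \<comment> \<open>A unit vector gives access to \<open>G(z)\<close> as a slice of \<open>G(z I)\<close>.\<close>
  have "\<exists>e :: 'h. norm e = 1"
  proof -
    have "\<exists>x :: 'h. x \<noteq> 0"
    proof (rule ccontr)
      assume "\<nexists>x :: 'h. x \<noteq> 0"
      then have "cspan ({} :: 'h set) = UNIV" by auto
      then show False using infinite_dim by blast
    qed
    then obtain x :: 'h where "x \<noteq> 0" by blast
    then show ?thesis by (intro exI[of _ "(1 / norm x) *\<^sub>R x"]) simp
  qed
  then obtain e :: 'h where e: "norm e = 1" by blast
  define w where "w = scalar_value A z"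
  have wcb: "w \<in> cbounded" and Gz: "Gz = G (scalar_row z)"
    using scalar_value_tensor[OF holo z e] by (simp_all add: w_def Gz_def)
  have Z: "scalar_row z \<in> row_ball" by (rule scalar_row_in_row_ball[OF z])
  have Wpos: "op_pos (op_Re Gz)" "op_invertible (op_Re Gz)" using pos[OF Z] by (simp_all add: Gz)
  have Tpos: "op_pos (op_Re (G X))" "op_invertible (op_Re (G X))" using pos[OF X] by simp_all
  have Wcb: "Gz \<in> cbounded" and Tcb: "G X \<in> cbounded"
    using free_holomorphicD(6)[OF holo] X Z by (simp_all add: Gz)

  define c where "c = 1 / (1 - (norm2 z)\<^sup>2)"
  have c: "0 < c" and inv_c: "1 - (norm2 z)\<^sup>2 = 1 / c"
    using euclid_ballD(4)[OF z] by (simp_all add: c_def)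
  define D where "D = id_blinfun - row_gram X"
  define B where "B = op_inv (id_blinfun - row_times_adj X z)"
  define R where "R = B o\<^sub>L D"
  have Dcb: "D \<in> cbounded" unfolding D_def by (intro cbounded_intros row_ballD[OF X])
  have Dadj: "adj D = D"
    by (simp add: D_def adj_diff cbounded_id row_ballD[OF X] adj_id)
  have Ninv: "op_invertible (id_blinfun - row_times_adj X z)"
    by (rule id_minus_invertible[OF norm_row_times_adj[OF X z]])
  have Ncb: "id_blinfun - row_times_adj X z \<in> cbounded"
    by (intro cbounded_intros cbounded_row_times_adj[OF X z])
  have Bcb: "B \<in> cbounded" unfolding B_def by (rule cbounded_op_inv[OF Ninv Ncb])
  have Rcb: "R \<in> cbounded" unfolding R_def by (intro cbounded_comp Bcb Dcb)
  have Badj: "op_inv (id_blinfun - scalar_times_adj z X) = adj B"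
    using op_inv_adj(2)[OF Ninv Ncb]
    by (simp add: B_def scalar_times_adj_eq(1)[OF X z] adj_diff cbounded_id
        cbounded_row_times_adj[OF X z] adj_id)
  note key = two_point_form[OF infinite_dim holo conjunct1[OF pos] X z D_def R_def[unfolded B_def] c_def Dcb Rcb]

  \<comment> \<open>Operators on the first tensor factor commute with those on the second.\<close>
  have comm: "amp S (Gz x) = Gz (amp S x)" "amp S (adj Gz x) = adj Gz (amp S x)"
    if "S \<in> cbounded" for S x
  proof -
    have *: "amp S o\<^sub>L op_tensor t id_blinfun v = op_tensor t id_blinfun v o\<^sub>L amp S"
      if "v \<in> cbounded" for v
      by (rule op_eqI_tensor)
        (simp_all add: amp_def op_tensor_apply cbounded_comp cbounded_op_tensor cbounded_id that \<open>S \<in> cbounded\<close>)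
    have "adj Gz = op_tensor t id_blinfun (adj w)"
      by (simp add: Gz_def w_def[symmetric] adj_op_tensor wcb cbounded_id adj_id)
    then show "amp S (Gz x) = Gz (amp S x)" "amp S (adj Gz x) = adj Gz (amp S x)"
      using *[OF wcb] *[OF cbounded_adj[OF wcb]]
      unfolding Gz_def w_def[symmetric] by (metis blinfun_apply_blinfun_compose)+
  qed

  define \<Gamma> where "\<Gamma> = Gamma_op Gz"
  define \<rho> where "\<rho> = op_inv (op_Re Gz)"
  define E where "E = id_blinfun + Gz"
  define K where "K = op_inv (Gz + adj (G X))"
  note Gpos = op_pos_Gamma_op[OF Wcb Wpos, folded \<Gamma>_def]
  have Gcb: "\<Gamma> \<in> cbounded" and Gsym: "cinner (\<Gamma> x) y = cinner x (\<Gamma> y)" for x y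
    using op_posD[OF Gpos] by simp_all
  have Ecb: "E \<in> cbounded" unfolding E_def by (intro cbounded_intros Wcb)
  have Eadj: "adj E = id_blinfun + adj Gz" by (simp add: E_def adj_add cbounded_id Wcb adj_id)
  have sandwich: "\<Gamma> (adj E (\<rho> (E (\<Gamma> x)))) = 4 *\<^sub>R x" for x
    using Gamma_op_sandwich[OF Wcb Wpos, of x] unfolding \<Gamma>_def \<rho>_def Eadj unfolding E_def .
  have \<rho>: "op_Re Gz (\<rho> x) = x" for x unfolding \<rho>_def by (rule op_inv_apply[OF Wpos(2)])
  have comm': "amp S (\<rho> (E (\<Gamma> x))) = \<rho> (E (\<Gamma> (amp S x)))" if S: "S \<in> cbounded" for S x
  proof -
    have "amp S (\<Gamma> x) = \<Gamma> (amp S x)" for x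
      unfolding \<Gamma>_def by (rule Gamma_op_commute[OF Wcb Wpos comm[OF S]])
    moreover have "amp S (E x) = E (amp S x)" for x
      by (simp add: E_def blinfun.add_left blinfun.add_right comm[OF S])
    moreover have "amp S (\<rho> x) = \<rho> (amp S x)" for x
      unfolding \<rho>_def
      by (rule op_inv_commute[OF Wpos(2)]) (simp add: op_Re_def blinfun.bilinear_simps comm[OF S])
    ultimately show ?thesis by simp
  qed

  have sumcb: "Gz + adj (G X) \<in> cbounded" by (intro cbounded_intros Wcb Tcb)
  have "coercive (Gz + adj (G X))"
  proof (rule coercive_if_Re_ge[OF coercive_if_pos_invertible[OF Tpos]])
    fix x
    have "Re (cinner (adj (G X) x) x) = Re (cinner (op_Re (G X) x) x)"
      using Re_cinner_commute[of x "G X x"] by (simp add: Re_cinner_op_Re[OF Tcb] cinner_adj_left[OF Tcb])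
    moreover have "0 \<le> Re (cinner (Gz x) x)"
      using op_posD(3)[OF Wpos(1), of x] by (simp add: Re_cinner_op_Re[OF Wcb])
    ultimately show "Re (cinner (op_Re (G X) x) x) \<le> Re (cinner ((Gz + adj (G X)) x) x)"
      by (simp add: blinfun.add_left cinner_add_left)
  qed
  then have Kinv: "op_invertible (Gz + adj (G X))" by (rule coercive_invertible)
  have Kcb: "K \<in> cbounded" unfolding K_def by (rule cbounded_op_inv[OF Kinv sumcb])
  have Kadj: "op_inv (G X + adj Gz) = adj K"
    using op_inv_adj(2)[OF Kinv sumcb]
    by (simp add: K_def adj_add adj_adj Wcb Tcb cbounded_adj add.commute)
  have K: "Gz (K x) + adj (G X) (K x) = x" for x
    using op_inv_apply(2)[OF Kinv, of x] by (simp add: K_def blinfun.add_left)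

  define L where "L = \<Gamma> o\<^sub>L adj E o\<^sub>L adj K o\<^sub>L op_Re (G X) o\<^sub>L K o\<^sub>L E o\<^sub>L \<Gamma>"
  define C where "C = (1 / c) *\<^sub>R amp (B o\<^sub>L D o\<^sub>L adj B)"
  have Lform: "cinner (L v) v = cinner (op_Re (G X) (K (E (\<Gamma> v)))) (K (E (\<Gamma> v)))" for v
    by (simp add: L_def Gsym cinner_adj_left[OF Ecb] cinner_adj_left[OF Kcb])
  have Cform: "cinner (C v) v = (1 / c) *\<^sub>R cinner (amp D (adj (amp B) v)) (adj (amp B) v)" for v
    by (simp add: C_def amp_comp cbounded_comp Bcb Dcb cbounded_adj adj_amp[symmetric]
        blinfun.scaleR_left cinner_scaleR_left cinner_adj_right[OF cbounded_amp[OF Bcb]])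
  have Dreal: "cinner (amp D x) x = complex_of_real (Re (cinner (amp D x) x))" for x
    by (rule form_real_if_adj_eq) (simp_all add: cbounded_amp Dcb adj_amp Dadj)
  have Treal: "cinner (op_Re (G X) x) x = complex_of_real (Re (cinner (op_Re (G X) x) x))" for x
    using op_posD[OF Tpos(1)] by (intro form_real_if_adj_eq)

  have main: "(1 / c) * Re (cinner (amp D (adj (amp B) v)) (adj (amp B) v))
      \<le> Re (cinner (op_Re (G X) (K (E (\<Gamma> v)))) (K (E (\<Gamma> v))))" for v
  proof -
    define a where "a = K (E (\<Gamma> v))"
    define g where "g = adj (amp B) v"
    define f where "f = \<rho> (E (\<Gamma> g))"
    \<comment> \<open>For fixed \<open>a\<close> the kernel inequality is quadratic in \<open>b\<close>; this vector minimises it.\<close>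
    define b where "b = (- (1 / (2 * c))) *\<^sub>R f"
    define \<sigma> where "\<sigma> = Re (cinner (amp D g) g)"
    have flip: "cinner (\<rho> (E (\<Gamma> x))) (E (\<Gamma> y)) = 4 *\<^sub>R cinner x y" for x y
    proof -
      have "cinner (\<rho> (E (\<Gamma> x))) (E (\<Gamma> y)) = cinner (\<Gamma> (adj E (\<rho> (E (\<Gamma> x))))) y"
        by (simp add: Gsym cinner_adj_left[OF Ecb])
      then show ?thesis by (simp add: sandwich cinner_scaleR_left)
    qed
    have a: "Gz a + adj (G X) a = E (\<Gamma> v)" by (simp add: a_def K)
    \<comment> \<open>The cross terms combine because \<open>(G(z) + G(X)\<^sup>*) a = (1 + G(z)) \<Gamma> v\<close>.\<close>
    have cross: "Re (cinner (G X (amp R x)) a) + Re (cinner (Gz (adj (amp R) a)) x)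
        = Re (cinner (amp R x) (E (\<Gamma> v)))" for x
    proof -
      have "cinner (Gz (adj (amp R) a)) x = cinner a (amp R (adj Gz x))"
        by (simp add: cinner_adj_left[OF cbounded_amp[OF Rcb]] flip: cinner_adj_right[OF Wcb])
      also have "\<dots> = cinner a (adj Gz (amp R x))" by (simp add: comm[OF Rcb])
      also have "\<dots> = cinner (Gz a) (amp R x)" by (rule cinner_adj_right[OF Wcb])
      finally have "Re (cinner (Gz (adj (amp R) a)) x) = Re (cinner (amp R x) (Gz a))"
        by (simp add: Re_cinner_commute)
      moreover have "cinner (G X (amp R x)) a = cinner (amp R x) (adj (G X) a)"
        by (simp add: cinner_adj_right[OF Tcb])
      ultimately show ?thesis by (simp add: a[symmetric] cinner_add_right)
    qed
    have Rf: "amp R f = \<rho> (E (\<Gamma> (amp B (amp D g))))"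
      unfolding R_def f_def by (simp add: amp_comp Bcb Dcb comm' )
    have t2: "Re (cinner (amp R f) (E (\<Gamma> v))) = 4 * \<sigma>"
      unfolding Rf flip \<sigma>_def g_def by (simp add: cinner_adj_right[OF cbounded_amp[OF Bcb]])
    have t3: "Re (cinner (Gz (amp D f)) f) = 4 * \<sigma>"
    proof -
      have D_sym: "cinner (amp D x) y = cinner x (amp D y)" for x y
        using cinner_adj_left[OF cbounded_amp[OF Dcb], of x y] by (simp add: adj_amp Dcb Dadj)
      have "cinner (Gz (amp D f)) f = cinner (Gz f) (amp D f)"
        by (simp add: comm(1)[OF Dcb, symmetric] D_sym)
      then have "Re (cinner (Gz (amp D f)) f) = Re (cinner (amp D f) (Gz f))"
        by (simp only: Re_cinner_commute[of "Gz f"])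
      moreover have "Re (cinner (op_Re Gz f) (amp D f))
          = (Re (cinner (Gz f) (amp D f)) + Re (cinner f (Gz (amp D f)))) / 2"
        by (simp add: cinner_op_Re[OF Wcb])
      ultimately have "Re (cinner (Gz (amp D f)) f) = Re (cinner (amp D f) (op_Re Gz f))"
        using Re_cinner_commute[of "Gz f" "amp D f"] Re_cinner_commute[of f "Gz (amp D f)"]
          Re_cinner_commute[of "amp D f" "op_Re Gz f"]
        by simp
      also have "\<dots> = Re (cinner (\<rho> (E (\<Gamma> (amp D g)))) (E (\<Gamma> g)))"
        by (simp add: f_def \<rho> comm'[OF Dcb])
      finally show ?thesis by (simp add: flip \<sigma>_def)
    qed
    have "0 \<le> Re (cinner (G X (a + amp R b)) a) + Re (cinner (Gz (adj (amp R) a + c *\<^sub>R amp D b)) b)"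
      using key[of a b] by (simp add: Gz)
    also have "\<dots> = Re (cinner (G X a) a)
        + (Re (cinner (G X (amp R b)) a) + Re (cinner (Gz (adj (amp R) a)) b))
        + c * Re (cinner (Gz (amp D b)) b)"
      by (simp add: blinfun.add_right blinfun.scaleR_right cinner_add_left cinner_scaleR_left)
    also have "\<dots> = Re (cinner (G X a) a) + Re (cinner (amp R b) (E (\<Gamma> v)))
        + c * Re (cinner (Gz (amp D b)) b)"
      by (simp only: cross)
    also have "\<dots> = Re (cinner (G X a) a) - (1 / (2 * c)) * (4 * \<sigma>)
        + c * ((1 / (2 * c)) * (1 / (2 * c)) * (4 * \<sigma>))"
      by (simp add: b_def t2 t3 blinfun.scaleR_right cinner_scaleR_left cinner_scaleR_right blinfun.minus_right
          cinner.minus_left cinner.minus_right)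
    finally show ?thesis using c by (simp add: a_def[symmetric] g_def[symmetric] \<sigma>_def[symmetric]
        Re_cinner_op_Re[OF Tcb])
  qed

  have "op_pos (L - C)" unfolding op_pos_def
  proof (intro conjI allI)
    show "L - C \<in> cbounded" unfolding L_def C_def
      by (intro cbounded_intros Gcb Ecb Kcb Tcb cbounded_amp Bcb Dcb)
    fix v
    have eq: "cinner ((L - C) v) v = complex_of_real
      (Re (cinner (op_Re (G X) (K (E (\<Gamma> v)))) (K (E (\<Gamma> v))))
        - (1 / c) * Re (cinner (amp D (adj (amp B) v)) (adj (amp B) v)))"
      using Treal[of "K (E (\<Gamma> v))"] Dreal[of "adj (amp B) v"]
      by (simp add: blinfun.diff_left cinner.diff_left Lform Cform scaleR_conv_of_real)
    show "cinner ((L - C) v) v \<in> \<real>\<^sub>\<ge>\<^sub>0"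
      unfolding eq using main[of v] by (simp only: nonneg_Reals_of_real_iff diff_ge_0_iff_ge)
  qed
  then show ?thesis
    unfolding op_le_def L_def C_def amp_def inv_c Badj Kadj \<Gamma>_def Eadj
    by (simp add: E_def B_def D_def K_def)
qed

end
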